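(* Let $\nu,\mu,\tau\in\mathbb{C}$ and $-1<x<1$. (i) If $\operatorname{Re}(\tau+2\nu)<0$ and $\nu-\frac12\notin\mathbb{N}_0$, then $$\frac{P_\nu^{-\tau-\nu}(x)}{(1-x^2)^{\frac{\tau+\nu}{2}}}=\frac{2^{\tau+\nu}\,\Gamma\left(\frac12-\nu\right)}{\sqrt{\pi}\,\Gamma(\tau+2\nu+1)}\sum_{n=0}^{\infty}\frac{(-1)^n\,\Gamma\left(\frac{n+\tau+2\nu+1}{2}\right)}{\Gamma\left(\frac{n+\tau-2\nu+1}{2}\right)}\,C_n^{(\tau)}(x).$$ (ii) If $\nu-\mu-\frac12\notin\mathbb{N}_0$ and $\operatorname{Re}(2\mu-\nu)>0$, then $$P_\nu^{-\mu}(x)=\left(\frac{1-x}{1+x}\right)^{\frac{\mu}{2}}\frac{\Gamma\left(\mu-\nu+\frac12\right)}{4^{\nu}\sqrt{\pi}}\sum_{n=0}^{\infty}(-1)^n c_n\,C_n^{(-\nu)}(x),$$ where $$c_n=\frac{2^{2\mu+2\nu+1}(\nu+1)_n}{\Gamma(n+2\mu-\nu+1)}F(2\mu+2\nu+1,\,n+\nu+1;\,n+2\mu-\nu+1;\,-1)=\frac{(\nu+1)_n}{\Gamma(n+2\mu-\nu+1)}F\left(2\mu+2\nu+1,\,2\mu-2\nu;\,2\mu+n-\nu+1;\,\tfrac12\right).$$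
   Context: For $x\in(-1,1)$ and $\nu,\mu\in\mathbb{C}$ the Ferrers function of the first kind is $P_\nu^{-\mu}(x)=\left(\frac{1-x}{1+x}\right)^{\mu/2}\frac{F(-\nu,\nu+1;1+\mu;\frac{1-x}{2})}{\Gamma(1+\mu)}$, where $F$ is the Gauss hypergeometric function and $F(a,b;c;z)/\Gamma(c)$ is read as the function $\sum_k \frac{(a)_k(b)_k}{\Gamma(c+k)k!}z^k$, entire in $c$; thus $P_\nu^{-\mu}(x)$ is entire in each of $\nu$ and $\mu$. Here $(a)_n=\Gamma(a+n)/\Gamma(a)$ and $\mathbb{N}_0=\{0,1,2,\dots\}$. The Gegenbauer polynomials $C_n^{(\tau)}(x)$, $\tau\in\mathbb{C}$, are defined by $(s^2+2sx+1)^{-\tau}=\sum_{n\ge0}(-1)^n s^n C_n^{(\tau)}(x)$, $|s|<1$. In (i), the quotient $\Gamma\left(\frac{n+\tau+2\nu+1}{2}\right)/\Gamma(\tau+2\nu+1)$, which is entire in $\tau+2\nu$ for each $n\in\mathbb{N}_0$, is read as its limiting value when both gamma functions have poles. *)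

theory Defs
  imports "HOL-Complex_Analysis.Complex_Analysis"
begin

definition hyp2F1_series :: "complex \<Rightarrow> complex \<Rightarrow> complex \<Rightarrow> complex \<Rightarrow> complex" where
  "hyp2F1_series a b c z =
     (\<Sum>k. pochhammer a k * pochhammer b k / (pochhammer c k * fact k) * z ^ k)"

text \<open>
  The Gauss function \<open>F(a,b;c;z)\<close>: the analytic continuation of the series along the
  segment from \<open>0\<close> to \<open>z\<close>, i.e. the value at \<open>z\<close> of a holomorphic extension of the series
  to some open set that is star-shaped about \<open>0\<close> and contains \<open>z\<close>. The complex plane cut
  along \<open>[1,\<infinity>)\<close> is itself star-shaped about \<open>0\<close>, so on it this is the usual principal
  branch (see \<open>hyp2F1_eq_principal_branch\<close>). The value does not depend on the choice of the
  set and of the extension (\<open>hyp2F1_eqI\<close>).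
\<close>

definition hyp2F1 :: "complex \<Rightarrow> complex \<Rightarrow> complex \<Rightarrow> complex \<Rightarrow> complex" where
  "hyp2F1 a b c z =
     (THE v. \<exists>S f. open S \<and> 0 \<in> S \<and> (\<forall>w\<in>S. closed_segment 0 w \<subseteq> S) \<and> z \<in> S \<and>
        f holomorphic_on S \<and> (\<forall>w\<in>S. norm w < 1 \<longrightarrow> f w = hyp2F1_series a b c w) \<and> v = f z)"

text \<open>The series of \<open>F(a,b;c;z)/\<Gamma>(c)\<close> for \<open>\<bar>z\<bar> < 1\<close>, entire in \<open>c\<close>; \<open>rGamma\<close> is \<open>1/\<Gamma>\<close>, with
  value \<open>0\<close> at the poles of \<open>\<Gamma>\<close>.\<close>

definition hyp2F1_reg :: "complex \<Rightarrow> complex \<Rightarrow> complex \<Rightarrow> complex \<Rightarrow> complex" where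
  "hyp2F1_reg a b c z =
     (\<Sum>k. pochhammer a k * pochhammer b k * rGamma (c + of_nat k) / fact k * z ^ k)"

text \<open>\<open>ferrersP \<nu> m x\<close> is \<open>P\<^sub>\<nu>\<^sup>m(x)\<close> with upper index \<open>m = -\<mu>\<close>, for \<open>-1 < x < 1\<close>.\<close>

definition ferrersP :: "complex \<Rightarrow> complex \<Rightarrow> real \<Rightarrow> complex" where
  "ferrersP \<nu> m x =
     complex_of_real ((1 - x) / (1 + x)) powr (- m / 2) *
     hyp2F1_reg (- \<nu>) (\<nu> + 1) (1 - m) (complex_of_real ((1 - x) / 2))"

text \<open>
  The coefficients of the generating function. For \<open>-1 \<le> x \<le> 1\<close> and \<open>\<bar>s\<bar> < 1\<close> the number
  \<open>s\<^sup>2 + 2sx + 1\<close> is never in \<open>(-\<infinity>,0]\<close>, so the principal power is holomorphic in \<open>s\<close>;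
  existence and uniqueness of the coefficients is \<open>gegenbauer_sums\<close> and \<open>gegenbauer_unique\<close>.
\<close>

definition gegenbauer :: "complex \<Rightarrow> real \<Rightarrow> nat \<Rightarrow> complex" where
  "gegenbauer \<tau> x =
     (THE C. \<forall>s::complex. norm s < 1 \<longrightarrow>
        (\<lambda>n. (-1) ^ n * s ^ n * C n) sums ((s\<^sup>2 + 2 * s * complex_of_real x + 1) powr (- \<tau>)))"

text \<open>
  \<open>\<Gamma>((n+w+1)/2) / \<Gamma>(w+1)\<close> as an entire function of \<open>w\<close>. A pole of the numerator is always
  a pole of the denominator.
\<close>

definition gamma_quot :: "nat \<Rightarrow> complex \<Rightarrow> complex" where
  "gamma_quot n w =
     (if (of_nat n + w + 1) / 2 \<in> \<int>\<^sub>\<le>\<^sub>0 \<and> w + 1 \<in> \<int>\<^sub>\<le>\<^sub>0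
      then Lim (at w) (\<lambda>u. Gamma ((of_nat n + u + 1) / 2) / Gamma (u + 1))
      else Gamma ((of_nat n + w + 1) / 2) * rGamma (w + 1))"


lemma star_extension_unique:
  fixes f g :: "complex \<Rightarrow> complex"
  assumes "open S" "0 \<in> S" "\<forall>w\<in>S. closed_segment 0 w \<subseteq> S" "f holomorphic_on S"
    and "open T" "0 \<in> T" "\<forall>w\<in>T. closed_segment 0 w \<subseteq> T" "g holomorphic_on T"
    and eq: "\<And>w. w \<in> S \<Longrightarrow> w \<in> T \<Longrightarrow> norm w < 1 \<Longrightarrow> f w = g w"
    and z: "z \<in> S" "z \<in> T"
  shows "f z = g z"
proof -
  have op: "open (S \<inter> T)" using assms by blast
  have "starlike (S \<inter> T)"
    unfolding starlike_def using assms by blast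
  then have con: "connected (S \<inter> T)" by (rule starlike_imp_connected)
  let ?U = "S \<inter> T \<inter> ball 0 1"
  have "open ?U" using op by blast
  moreover have "0 \<in> ?U" using assms by simp
  ultimately have lim: "0 islimpt ?U"
    by (metis interior_limit_point interior_open)
  have "f z - g z = 0"
  proof (rule analytic_continuation[of "\<lambda>w. f w - g w" "S \<inter> T" ?U 0])
    show "(\<lambda>w. f w - g w) holomorphic_on S \<inter> T"
      using assms by (intro holomorphic_intros) (auto elim: holomorphic_on_subset)
  qed (use op con lim assms in auto)
  then show ?thesis by simp
qed

lemma hyp2F1_eqI:
  assumes "open S" "0 \<in> S" "\<And>w. w \<in> S \<Longrightarrow> closed_segment 0 w \<subseteq> S" "z \<in> S"
    and "f holomorphic_on S"
    and "\<And>w. w \<in> S \<Longrightarrow> norm w < 1 \<Longrightarrow> f w = hyp2F1_series a b c w"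
  shows "hyp2F1 a b c z = f z"
  unfolding hyp2F1_def
proof (rule the_equality)
  show "\<exists>S g. open S \<and> 0 \<in> S \<and> (\<forall>w\<in>S. closed_segment 0 w \<subseteq> S) \<and> z \<in> S \<and>
        g holomorphic_on S \<and> (\<forall>w\<in>S. norm w < 1 \<longrightarrow> g w = hyp2F1_series a b c w) \<and> f z = g z"
    using assms by blast
next
  fix v
  assume "\<exists>S g. open S \<and> 0 \<in> S \<and> (\<forall>w\<in>S. closed_segment 0 w \<subseteq> S) \<and> z \<in> S \<and>
        g holomorphic_on S \<and> (\<forall>w\<in>S. norm w < 1 \<longrightarrow> g w = hyp2F1_series a b c w) \<and> v = g z"
  then obtain T g where T: "open T" "0 \<in> T" "\<forall>w\<in>T. closed_segment 0 w \<subseteq> T" "z \<in> T"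
    "g holomorphic_on T" "\<forall>w\<in>T. norm w < 1 \<longrightarrow> g w = hyp2F1_series a b c w" "v = g z"
    by blast
  have "g z = f z"
    by (rule star_extension_unique[of T g S f]) (use T assms in auto)
  then show "v = f z" using T by simp
qed

lemma hyp2F1_eq_principal_branch:
  assumes "f holomorphic_on - {complex_of_real t |t. t \<ge> 1}"
    and "\<And>w. norm w < 1 \<Longrightarrow> f w = hyp2F1_series a b c w"
    and "z \<notin> {complex_of_real t |t. t \<ge> 1}"
  shows "hyp2F1 a b c z = f z"
proof (rule hyp2F1_eqI[where S = "- {complex_of_real t |t. t \<ge> 1}"])
  have "{complex_of_real t |t. t \<ge> 1} = complex_of_real ` {1..}" by auto
  moreover have "closed (complex_of_real ` {1..})"
    by (rule closed_injective_linear_image)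
      (auto intro: linearI simp: scaleR_conv_of_real inj_on_def)
  ultimately show "open (- {complex_of_real t |t. t \<ge> 1})" by (simp add: open_Compl)
next
  fix w assume w: "w \<in> - {complex_of_real t |t. t \<ge> 1}"
  show "closed_segment 0 w \<subseteq> - {complex_of_real t |t. t \<ge> 1}"
  proof
    fix y assume "y \<in> closed_segment 0 w"
    then obtain u where u: "0 \<le> u" "u \<le> 1" "y = of_real u * w"
      by (auto simp: in_segment scaleR_conv_of_real)
    have False if "t \<ge> 1" "y = complex_of_real t" for t
    proof -
      have "u \<noteq> 0" using u that by auto
      then have "w = complex_of_real (t / u)" using u that by (simp add: field_simps)
      moreover have "t / u \<ge> 1" using u that \<open>u \<noteq> 0\<close> by (simp add: field_simps)
      ultimately show False using w by blast
    qed
    then show "y \<in> - {complex_of_real t |t. t \<ge> 1}" by blast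
  qed
qed (use assms in auto)

lemma summable_hyp2F1_series:
  fixes a b c z :: complex
  assumes "norm z < 1" "c \<notin> \<int>\<^sub>\<le>\<^sub>0"
  shows "summable (\<lambda>k. pochhammer a k * pochhammer b k / (pochhammer c k * fact k) * z ^ k)"
proof -
  have inf: "filterlim (\<lambda>k. of_nat k :: complex) at_infinity sequentially"
    by (rule tendsto_of_nat)
  have lim: "(\<lambda>k. (a + of_nat k) / (c + of_nat k)) \<longlonglongrightarrow> 1" for a c :: complex
  proof -
    have "(\<lambda>k. 1 + (a - c) / (c + of_nat k)) \<longlonglongrightarrow> 1 + 0"
      by (intro tendsto_intros tendsto_divide_0[OF tendsto_const]
          tendsto_add_filterlim_at_infinity[OF tendsto_const inf])
    moreover have "\<forall>\<^sub>F k in sequentially. c + of_nat k \<noteq> 0"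
      using filterlim_at_infinity_imp_eventually_ne
        [OF tendsto_add_filterlim_at_infinity[OF tendsto_const inf]] .
    then have "\<forall>\<^sub>F k in sequentially. 1 + (a - c) / (c + of_nat k) = (a + of_nat k) / (c + of_nat k)"
      by eventually_elim (simp add: field_simps)
    ultimately show ?thesis by (simp add: tendsto_cong)
  qed
  define q where "q k = (a + of_nat k) / (c + of_nat k) * ((b + of_nat k) / (1 + of_nat k)) * z" for k
  have "(\<lambda>k. norm (q k)) \<longlonglongrightarrow> norm (1 * 1 * z)"
    unfolding q_def using lim[of b 1] by (intro tendsto_intros lim)
  moreover obtain r where r: "norm z < r" "r < 1" using assms dense by blast
  ultimately have "\<forall>\<^sub>F k in sequentially. norm (q k) < r"
    by (intro order_tendstoD) auto
  then obtain N where N: "\<And>k. k \<ge> N \<Longrightarrow> norm (q k) < r"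
    by (auto simp: eventually_sequentially)
  define t where "t k = pochhammer a k * pochhammer b k / (pochhammer c k * fact k) * z ^ k" for k
  have "t (Suc k) = q k * t k" for k
    by (simp add: t_def q_def pochhammer_Suc field_simps)
  then have "norm (t (Suc k)) \<le> r * norm (t k)" if "k \<ge> N" for k
    using N[OF that] by (simp add: norm_mult mult_right_mono)
  then have "summable t" using r by (intro summable_ratio_test) auto
  then show ?thesis unfolding t_def .
qed

lemma hyp2F1_eq_series:
  assumes "norm z < 1" "c \<notin> \<int>\<^sub>\<le>\<^sub>0"
  shows "hyp2F1 a b c z = hyp2F1_series a b c z"
proof (rule hyp2F1_eqI[where S = "ball 0 1"])
  show "hyp2F1_series a b c holomorphic_on ball 0 1"
  proof (rule power_series_holomorphic)
    fix w :: complex assume "w \<in> ball 0 1"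
    then show "(\<lambda>n. pochhammer a n * pochhammer b n / (pochhammer c n * fact n) * (w - 0) ^ n)
                 sums hyp2F1_series a b c w"
      using summable_hyp2F1_series[of w c a b] assms
      by (simp add: hyp2F1_series_def summable_sums)
  qed
next
  fix w :: complex assume "w \<in> ball 0 1"
  then show "closed_segment 0 w \<subseteq> ball 0 1" by (intro closed_segment_subset) auto
qed (use assms in auto)

lemma gegenbauer_base_nonpos:
  fixes s :: complex
  assumes "-1 \<le> x" "x \<le> 1" "norm s < 1"
  shows "s\<^sup>2 + 2 * s * complex_of_real x + 1 \<notin> \<real>\<^sub>\<le>\<^sub>0"
proof
  define y where "y = sqrt (1 - x\<^sup>2)"
  have y: "x\<^sup>2 + y\<^sup>2 = 1" using assms by (simp add: y_def abs_square_le_1)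
  define e where "e = Complex x y"
  have "norm e = 1" using y by (simp add: e_def cmod_def)
  have pos: "Re (1 + s * u) > 0" if "norm u = 1" for u
  proof -
    have "\<bar>Re (s * u)\<bar> \<le> norm (s * u)" by (rule abs_Re_le_cmod)
    then show ?thesis using that assms by (simp add: norm_mult)
  qed
  have f: "s\<^sup>2 + 2 * s * complex_of_real x + 1 = (1 + s * e) * (1 + s * cnj e)"
  proof -
    have "e * cnj e = 1" using \<open>norm e = 1\<close> by (simp add: complex_norm_square[symmetric])
    moreover have "e + cnj e = 2 * complex_of_real x" by (simp add: e_def complex_eq_iff)
    moreover have "(1 + s * e) * (1 + s * cnj e) = 1 + s * (e + cnj e) + s\<^sup>2 * (e * cnj e)"
      by (simp add: algebra_simps power2_eq_square)
    ultimately show ?thesis by (simp add: algebra_simps)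
  qed
  define p where "p = 1 + s * e"
  define q where "q = 1 + s * cnj e"
  have pq: "Re p > 0" "Re q > 0" 
    unfolding p_def q_def using \<open>norm e = 1\<close> by (intro pos; simp)+
  assume "s\<^sup>2 + 2 * s * complex_of_real x + 1 \<in> \<real>\<^sub>\<le>\<^sub>0"
  then have n: "Re (p * q) \<le> 0" "Im (p * q) = 0"
    unfolding f p_def[symmetric] q_def[symmetric] by (auto simp: complex_nonpos_Reals_iff)
  then have "Re p * Im q = - (Im p * Re q)" by simp
  then have "Im q = - (Im p * Re q / Re p)" using pq by (simp add: field_simps)
  then have "Re (p * q) = Re p * Re q + (Im p)\<^sup>2 * (Re q / Re p)"
    by (simp add: power2_eq_square)
  moreover have "Re p * Re q > 0" "(Im p)\<^sup>2 * (Re q / Re p) \<ge> 0" using pq by auto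
  ultimately show False using n by linarith
qed

lemma gegenbauer_unique:
  fixes C D :: "nat \<Rightarrow> complex" and f :: "complex \<Rightarrow> complex"
  assumes C: "\<forall>s. norm s < 1 \<longrightarrow> (\<lambda>n. (-1) ^ n * s ^ n * C n) sums f s"
    and D: "\<forall>s. norm s < 1 \<longrightarrow> (\<lambda>n. (-1) ^ n * s ^ n * D n) sums f s"
  shows "C = D"
proof
  fix n
  have coeff: "(-1) ^ n * E n = (deriv ^^ n) f 0 / fact n"
    if E: "\<forall>s. norm s < 1 \<longrightarrow> (\<lambda>n. (-1) ^ n * s ^ n * E n) sums f s" for E :: "nat \<Rightarrow> complex"
  proof -
    define F where "F = Abs_fps (\<lambda>n. (-1) ^ n * E n)"
    have s: "(\<lambda>n. fps_nth F n * w ^ n) sums f w" if "norm w < 1" for w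
      using E that by (simp add: F_def mult_ac)
    have "f has_fps_expansion F"
      unfolding has_fps_expansion_def
    proof
      have "fps_conv_radius F \<ge> 1"
        unfolding fps_conv_radius_def
      proof (rule conv_radius_geI_ex)
        fix r :: real assume "0 < r" "ereal r < 1"
        then show "\<exists>z. norm z = r \<and> summable (\<lambda>n. fps_nth F n * z ^ n)"
          using s[of "of_real r"] by (intro exI[of _ "of_real r"]) (auto simp: sums_iff)
      qed
      then show "fps_conv_radius F > 0" by (rule less_le_trans[rotated]) simp
      have "\<forall>\<^sub>F z in nhds 0. z \<in> ball (0::complex) 1"
        by (intro eventually_nhds_in_open) auto
      then show "\<forall>\<^sub>F z in nhds 0. eval_fps F z = f z"
        by eventually_elim (use s in \<open>auto simp: eval_fps_def sums_iff\<close>)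
    qed
    then have "fps_nth F n = (deriv ^^ n) f 0 / fact n"
      by (rule fps_nth_fps_expansion)
    then show ?thesis by (simp add: F_def)
  qed
  have "(-1) ^ n * C n = (-1) ^ n * D n" using coeff[OF C] coeff[OF D] by argo
  then show "C n = D n" by simp
qed

lemma gegenbauer_sums:
  fixes s :: complex
  assumes x: "-1 \<le> x" "x \<le> 1" and "norm s < 1"
  shows "(\<lambda>n. (-1) ^ n * s ^ n * gegenbauer \<tau> x n) sums
           ((s\<^sup>2 + 2 * s * complex_of_real x + 1) powr (- \<tau>))"
proof -
  define f where "f s = (s\<^sup>2 + 2 * s * complex_of_real x + 1) powr (- \<tau>)" for s
  have "f holomorphic_on ball 0 1"
    unfolding f_def using gegenbauer_base_nonpos[OF x] by (intro holomorphic_intros) auto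
  from holomorphic_power_series[OF this]
  have f: "(\<lambda>n. (deriv ^^ n) f 0 / fact n * w ^ n) sums f w" if "norm w < 1" for w
    using that by simp
  define C where "C n = (-1) ^ n * ((deriv ^^ n) f 0 / fact n)" for n
  have C: "\<forall>s. norm s < 1 \<longrightarrow> (\<lambda>n. (-1) ^ n * s ^ n * C n) sums f s"
  proof (intro allI impI)
    fix s :: complex assume "norm s < 1"
    moreover have "(-1) ^ n * s ^ n * C n = (deriv ^^ n) f 0 / fact n * s ^ n" for n
    proof -
      have "(-1) ^ n * (-1) ^ n = (1::complex)" by (simp flip: power_mult_distrib)
      then have "(-1) ^ n * s ^ n * C n = 1 * ((deriv ^^ n) f 0 / fact n * s ^ n)"
        unfolding C_def by (metis (no_types, lifting) mult.assoc mult.commute)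
      then show ?thesis by simp
    qed
    ultimately show "(\<lambda>n. (-1) ^ n * s ^ n * C n) sums f s" using f by presburger
  qed
  have "gegenbauer \<tau> x = C"
    unfolding gegenbauer_def f_def[symmetric]
    using C by (intro the_equality) (auto intro: gegenbauer_unique)
  then show ?thesis using C assms by (simp add: f_def)
qed

end

theory Submission
  imports Defs "HOL-Real_Asymp.Real_Asymp"
begin

text \<open>
  Both expansions are cases of one identity: for \<open>Re (\<tau> - 2\<beta>) < 0\<close> and \<open>z = (1-x)/2\<close>, the function
  \<open>F(\<tau>,\<alpha>;\<alpha>+\<beta>;z)/\<Gamma>(\<alpha>+\<beta>)\<close> is a multiple of
  \<open>\<Sum>\<^sub>n (-1)\<^sup>n (\<alpha>)\<^sub>n F(2\<alpha>+2\<beta>-2\<tau>-1, 2\<beta>; n+\<alpha>+2\<beta>; 1/2)/\<Gamma>(n+\<alpha>+2\<beta>) C\<^sub>n(x)\<close>. Part (i) is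
  \<open>\<alpha> = \<tau>+2\<nu>+1, \<beta> = -\<nu>\<close>, where Bailey's theorem evaluates the coefficients and Euler's
  transformation rewrites the left side; part (ii) is \<open>\<alpha> = \<nu>+1, \<beta> = \<mu>-\<nu>\<close> with \<open>-\<nu>\<close> for \<open>\<tau>\<close>,
  and Pfaff's transformation relates the two forms of \<open>c\<^sub>n\<close>. For real parameters with
  \<open>\<alpha>, \<beta> > 1\<close> and \<open>\<tau> < 0\<close> the identity evaluates in two ways the integral of
  \<open>s\<^sup>\<alpha>\<^sup>-\<^sup>1 (1-s)\<^sup>2\<^sup>\<beta>\<^sup>-\<^sup>1 (1+s)\<^sup>1\<^sup>+\<^sup>2\<^sup>\<tau>\<^sup>-\<^sup>2\<^sup>\<alpha>\<^sup>-\<^sup>2\<^sup>\<beta> (s\<^sup>2+2sx+1)\<^sup>-\<^sup>\<tau>\<close> over \<open>[0,1]\<close>. It extends to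
  complex parameters by analytic continuation in \<open>\<tau>\<close>, \<open>\<alpha>\<close>, \<open>\<beta>\<close> in turn, since the terms are
  \<open>O(n\<^sup>-\<^sup>1\<^sup>-\<^sup>\<delta>)\<close> locally uniformly in the parameters.
\<close>

section \<open>Growth of Pochhammer ratios\<close>

text \<open>The family of part (i) is out of reach of the integral under these bounds: \<alpha> > 1
  means \<tau> + 2\<nu> > 0, whereas the series asks for Re (\<tau> + 2\<nu>) < 0. Treating
  \<alpha>, \<beta>, \<tau> as independent removes the conflict: the integral only has to cover some
  real box, and its bounds disappear in the continuation. What survives is Re (\<tau> - 2\<beta>) <
  0, because the Gegenbauer coefficients are O(n^(Re \<tau> - 1)) for |x| < 1 and the other factor
  is O(n^(-2 Re \<beta>)). Continuation needs holomorphic sides, hence 1/\<Gamma> throughout. The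
  factor 1/\<Gamma>(\<beta> + 1/2) stays beside the hypergeometric function and is moved across only
  at the end; this is where \<nu> - 1/2 \<notin> \<nat> and \<nu> - \<mu> - 1/2 \<notin> \<nat>
  enter. The obstacle is uniformity: each growth bound needs one constant for a whole disc of
  parameters. The bounds therefore come from recurrences, through a discrete Gronwall inequality,
  and not from asymptotic expansions.\<close>

lemma discrete_gronwall:
  fixes Q :: "nat \<Rightarrow> real"
  assumes "N \<ge> 1" "K \<ge> 0" "\<And>n. Q n \<ge> 0"
    and step: "\<And>n. n \<ge> N \<Longrightarrow> Q (Suc n) \<le> exp (K / (real n)\<^sup>2) * Q n"
    and "n \<ge> N"
  shows "Q n \<le> exp (2 * K) * Q N"
proof -
  \<comment> \<open>The weight exp (2K/n) absorbs the growth factor: K/n^2 is at most the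
    telescoping difference 2K/n - 2K/(n+1), so the weighted sequence is nonincreasing from N
    on.\<close>
  have "Q n * exp (2 * K / real n) \<le> Q N * exp (2 * K / real N)"
    using \<open>n \<ge> N\<close>
  proof (induction n rule: dec_induct)
    case (step n)
    have n: "real n \<ge> 1" using step assms by simp
    have "1 / (real n)\<^sup>2 \<le> 2 / (real n * (real n + 1))"
      using n by (simp add: divide_simps power2_eq_square)
    from mult_left_mono[OF this assms(2)]
    have "K / (real n)\<^sup>2 \<le> K * (2 / (real n * (real n + 1)))" by simp
    also have "\<dots> = 2 * K / real n - 2 * K / real (Suc n)"
      using n by (simp add: field_simps)
    finally have *: "K / (real n)\<^sup>2 + 2 * K / real (Suc n) \<le> 2 * K / real n" by simp
    have "Q (Suc n) * exp (2 * K / real (Suc n)) \<le>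
            exp (K / (real n)\<^sup>2) * Q n * exp (2 * K / real (Suc n))"
      using assms(4)[OF step(1)] by (intro mult_right_mono) auto
    also have "\<dots> = Q n * exp (K / (real n)\<^sup>2 + 2 * K / real (Suc n))"
      by (simp add: exp_add)
    also have "\<dots> \<le> Q n * exp (2 * K / real n)"
      using * assms(3) by (intro mult_left_mono) auto
    finally show ?case using step.IH by linarith
  qed auto
  moreover have "Q n * 1 \<le> Q n * exp (2 * K / real n)"
    using assms by (intro mult_left_mono) auto
  moreover have "2 * K / real N \<le> 2 * K / 1"
    using assms by (intro divide_left_mono) auto
  then have "Q N * exp (2 * K / real N) \<le> Q N * exp (2 * K)"
    using assms by (intro mult_left_mono) auto
  ultimately show ?thesis by (simp add: mult.commute)
qed

text \<open>The linear term is Re u and not |u|. The drift Re (p - q)/n of a Pochhammer ratio can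
  then be cancelled exactly by a power of n, with only O(1/n^2) left over.\<close>

lemma norm_one_plus_le_exp: "norm (1 + u) \<le> exp (Re u + (norm u)\<^sup>2 / 2)" for u :: complex
proof -
  have "(norm (1 + u))\<^sup>2 = 1 + (2 * Re u + (norm u)\<^sup>2)"
    by (simp add: cmod_power2) (simp add: power2_eq_square algebra_simps)
  also have "\<dots> \<le> exp (2 * Re u + (norm u)\<^sup>2)" by (rule exp_ge_add_one_self)
  also have "\<dots> = (exp (Re u + (norm u)\<^sup>2 / 2))\<^sup>2"
    by (simp flip: exp_of_nat_mult add: exp_double[symmetric] algebra_simps)
  finally show ?thesis by (rule power2_le_imp_le) simp
qed

lemma norm_pochhammer_le:
  fixes z :: complex
  assumes "norm z \<le> R"
  shows "norm (pochhammer z n) \<le> pochhammer R n"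
proof -
  have "norm (z + of_nat i) \<le> R + real i" for i
    using norm_triangle_ineq[of z "of_nat i"] assms by simp
  then show ?thesis
    unfolding pochhammer_prod prod_norm[symmetric] by (intro prod_mono) auto
qed

text \<open>With d = p - q, consecutive terms have ratio 1 + d/(q+n) = 1 + d/n + O(1/n^2).
  Multiplying by n^(-Re d) removes the first-order part, and the Gronwall inequality bounds the
  product. The constants depend on R alone.\<close>

lemma pochhammer_rGamma_growth:
  fixes R :: real
  assumes "R \<ge> 0"
  obtains C N where "C \<ge> 0" "N \<ge> 1"
    "\<And>p q n. norm p \<le> R \<Longrightarrow> norm q \<le> R \<Longrightarrow> n \<ge> N \<Longrightarrow>
       norm (pochhammer p n * rGamma (q + of_nat n) :: complex) \<le> C * real n powr Re (p - q)"
proof -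
  \<comment> \<open>From n >= 2R on, |q + n| >= n/2, so that |u| <= 4R/n below.\<close>
  define N where "N = nat \<lceil>2 * R\<rceil> + 1"
  have N: "N \<ge> 1" "2 * R \<le> real N" "2 * R < real N" by (auto simp: N_def) linarith+
  \<comment> \<open>The three O(1/n^2) errors: 8R^2 comes from |u|^2/2, 4R^2 from replacing q + n by
    n in the denominator of u, and 2R from replacing ln (1 + 1/n) by 1/n.\<close>
  define K where "K = 8 * R\<^sup>2 + 4 * R\<^sup>2 + 2 * R"
  have "compact ((\<lambda>q::complex. rGamma (q + of_nat N)) ` cball 0 R)"
    by (intro compact_continuous_image holomorphic_on_imp_continuous_on holomorphic_intros) auto
  then obtain M where "M > 0" and M: "\<And>q::complex. norm q \<le> R \<Longrightarrow> norm (rGamma (q + of_nat N)) \<le> M"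
    by (auto dest!: compact_imp_bounded simp: bounded_pos)
  define C where "C = exp (2 * K) * (pochhammer R N * M * real N powr (2 * R))"
  have KK: "K \<ge> 0" using assms by (simp add: K_def)
  show ?thesis
  proof (rule that[of C N])
    have "0 \<le> norm (pochhammer (0::complex) N)" by simp
    also have "\<dots> \<le> pochhammer R N" using assms by (intro norm_pochhammer_le) auto
    finally show "C \<ge> 0" using \<open>M > 0\<close> by (simp add: C_def)
    fix p q :: complex and n assume p: "norm p \<le> R" and q: "norm q \<le> R" and n: "n \<ge> N"
    define d where "d = p - q"
    define Q where "Q n = norm (pochhammer p n * rGamma (q + of_nat n)) * real n powr (- Re d)" for n
    have d: "norm d \<le> 2 * R" using norm_triangle_ineq4[of p q] p q by (simp add: d_def)
    have step: "Q (Suc n) \<le> exp (K / (real n)\<^sup>2) * Q n" if "n \<ge> N" for n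
    proof -
      have n: "real n \<ge> 1" "2 * R \<le> real n" using that N by linarith+
      have "norm (of_nat n :: complex) \<le> norm (q + of_nat n) + norm q"
        using norm_triangle_ineq4[of "q + of_nat n" q] by simp
      then have qn: "norm (q + of_nat n) \<ge> real n / 2" using q n by simp
      then have nz: "q + of_nat n \<noteq> 0" using n by auto
      define u where "u = d / (q + of_nat n)"
      have Sn: "q + of_nat (Suc n) = (q + of_nat n) + 1" by simp
      have "rGamma (q + of_nat n) = (q + of_nat n) * rGamma (q + of_nat (Suc n))"
        unfolding Sn by (rule rGamma_plus1[symmetric])
      then have "pochhammer p (Suc n) * rGamma (q + of_nat (Suc n)) =
          (1 + u) * (pochhammer p n * rGamma (q + of_nat n))"
        using nz by (simp add: pochhammer_Suc u_def d_def field_simps)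
      then have e1: "norm (pochhammer p (Suc n) * rGamma (q + of_nat (Suc n))) =
          norm (1 + u) * norm (pochhammer p n * rGamma (q + of_nat n))"
        by (simp add: norm_mult)
      have nu: "norm u \<le> 4 * R / real n"
      proof -
        have "norm u \<le> 2 * R / (real n / 2)"
          unfolding u_def norm_divide using d qn n assms by (intro frac_le) auto
        then show ?thesis by simp
      qed
      have "u * (q + of_nat n) = d" using nz by (simp add: u_def)
      then have "u * of_nat n = d - u * q" by (simp add: algebra_simps)
      then have "u = d / of_nat n - u * q / of_nat n"
        using n by (simp add: diff_divide_distrib[symmetric] eq_divide_eq)
      then have "Re u = Re d / real n - Re (u * q / of_nat n)"
        by (metis Re_divide_of_nat minus_complex.simps(1))
      have "- Re (u * q / of_nat n) \<le> norm (u * q / of_nat n)"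
        using abs_Re_le_cmod[of "u * q / of_nat n"] by linarith
      have "norm (u * q / of_nat n) \<le> (4 * R / real n) * R / real n"
        unfolding norm_divide norm_mult norm_of_nat
        by (intro divide_right_mono mult_mono nu q) (use assms in auto)
      have Reu: "Re u \<le> Re d / real n + 4 * R\<^sup>2 / (real n)\<^sup>2"
      proof -
        have "(4 * R / real n) * R / real n = 4 * R\<^sup>2 / (real n)\<^sup>2"
          by (simp add: power2_eq_square)
        then show ?thesis
          using \<open>Re u = _\<close> \<open>- Re (u * q / of_nat n) \<le> _\<close> \<open>norm (u * q / of_nat n) \<le> _\<close> by linarith
      qed
      have "(norm u)\<^sup>2 \<le> (4 * R / real n)\<^sup>2" using nu by (intro power_mono) auto
      then have "Re u + (norm u)\<^sup>2 / 2 \<le> Re d / real n + (4 * R\<^sup>2 + 8 * R\<^sup>2) / (real n)\<^sup>2"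
        using Reu by (simp add: power_divide add_divide_distrib power_mult_distrib)
      then have e2: "norm (1 + u) \<le> exp (Re d / real n + (4 * R\<^sup>2 + 8 * R\<^sup>2) / (real n)\<^sup>2)"
        using norm_one_plus_le_exp[of u] by (meson exp_le_cancel_iff order_trans)
      have "\<bar>ln (1 + 1 / real n) - 1 / real n\<bar> \<le> (1 / real n)\<^sup>2"
        using n by (intro abs_ln_one_plus_x_minus_x_bound_nonneg) auto
      moreover have "\<bar>Re d\<bar> \<le> 2 * R" using abs_Re_le_cmod[of d] d by linarith
      ultimately have "\<bar>Re d\<bar> * \<bar>ln (1 + 1 / real n) - 1 / real n\<bar> \<le> 2 * R * (1 / real n)\<^sup>2"
        by (intro mult_mono) auto
      then have "- Re d * (ln (1 + 1 / real n) - 1 / real n) \<le> 2 * R * (1 / real n)\<^sup>2"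
        using abs_ge_self[of "- Re d * (ln (1 + 1 / real n) - 1 / real n)"]
        unfolding abs_mult abs_minus_cancel by linarith
      then have l: "- Re d * ln (1 + 1 / real n) \<le> - Re d / real n + 2 * R / (real n)\<^sup>2"
        by (simp add: algebra_simps power_divide)
      have "real (Suc n) = real n * (1 + 1 / real n)" using n by (simp add: field_simps)
      then have "real (Suc n) powr (- Re d) = real n powr (- Re d) * (1 + 1 / real n) powr (- Re d)"
        using powr_mult[of "real n" "1 + 1 / real n" "- Re d"] n by simp
      also have "(1 + 1 / real n) powr (- Re d) = exp (- Re d * ln (1 + 1 / real n))"
        unfolding powr_def using n by (auto simp: add_nonneg_eq_0_iff)
      also have "\<dots> \<le> exp (- Re d / real n + 2 * R / (real n)\<^sup>2)" using l by simp
      finally have e3: "real (Suc n) powr (- Re d) \<le>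
        real n powr (- Re d) * exp (- Re d / real n + 2 * R / (real n)\<^sup>2)"
        by (simp add: mult_left_mono)
      have "Q (Suc n) \<le> (exp (Re d / real n + (4 * R\<^sup>2 + 8 * R\<^sup>2) / (real n)\<^sup>2) *
            norm (pochhammer p n * rGamma (q + of_nat n))) *
            (real n powr (- Re d) * exp (- Re d / real n + 2 * R / (real n)\<^sup>2))"
        unfolding Q_def e1 using e2 e3 by (intro mult_mono mult_right_mono) auto
      also have "\<dots> = exp ((Re d / real n + (4 * R\<^sup>2 + 8 * R\<^sup>2) / (real n)\<^sup>2) +
           (- Re d / real n + 2 * R / (real n)\<^sup>2)) * Q n"
        unfolding Q_def exp_add by simp
      also have "(Re d / real n + (4 * R\<^sup>2 + 8 * R\<^sup>2) / (real n)\<^sup>2) +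
           (- Re d / real n + 2 * R / (real n)\<^sup>2) = K / (real n)\<^sup>2"
        by (simp add: K_def add_divide_distrib)
      finally show ?thesis .
    qed
    have "Q n \<le> exp (2 * K) * Q N"
      by (rule discrete_gronwall[OF N(1) KK _ _ n]) (use step in \<open>auto simp: Q_def\<close>)
    also have "Q N \<le> pochhammer R N * M * real N powr (2 * R)"
    proof -
      have "- Re d \<le> 2 * R" using abs_Re_le_cmod[of d] d by linarith
      moreover have "pochhammer R N \<ge> 0"
        using norm_pochhammer_le[OF p, of N] norm_ge_zero[of "pochhammer p N"] by linarith
      ultimately show ?thesis unfolding Q_def norm_mult
        using N M[OF q] norm_pochhammer_le[OF p, of N] \<open>M > 0\<close>
        by (intro mult_mono powr_mono) auto
    qed
    finally have "Q n \<le> C" by (simp add: C_def)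
    then have "Q n * real n powr Re d \<le> C * real n powr Re d" by (intro mult_right_mono) auto
    moreover have "real n \<noteq> 0" using n N by simp
    ultimately show "norm (pochhammer p n * rGamma (q + of_nat n)) \<le> C * real n powr Re (p - q)"
      by (simp add: Q_def d_def[symmetric] mult.assoc powr_add[symmetric])
  qed (use N in auto)
qed

text \<open>Weierstrass's theorem on locally uniform limits, with the majorant required only from
  some index on, since the growth estimates hold only for large n.\<close>

lemma holomorphic_suminf:
  fixes f :: "nat \<Rightarrow> complex \<Rightarrow> complex"
  assumes "open A" "\<And>n. f n holomorphic_on A"
    and "\<And>t. t \<in> A \<Longrightarrow> \<exists>d M N. d > 0 \<and> cball t d \<subseteq> A \<and> summable M \<and>
           (\<forall>n\<ge>N. \<forall>s\<in>cball t d. norm (f n s) \<le> M n)"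
  shows "(\<lambda>t. \<Sum>n. f n t) holomorphic_on A"
proof (rule holomorphic_uniform_sequence[OF assms(1)])
  fix n show "(\<lambda>t. \<Sum>i<n. f i t) holomorphic_on A"
    by (intro holomorphic_intros assms)
next
  fix t assume "t \<in> A"
  from assms(3)[OF this] obtain d and M :: "nat \<Rightarrow> real" and N where
    d: "d > 0" "cball t d \<subseteq> A" "summable M" "\<forall>n\<ge>N. \<forall>s\<in>cball t d. norm (f n s) \<le> M n"
    by blast
  have "\<forall>\<^sub>F n in sequentially. \<forall>s\<in>cball t d. norm (f n s) \<le> M n"
    using d(4) by (auto simp: eventually_sequentially)
  from Weierstrass_m_test_ev[OF this d(3)] d
  show "\<exists>d>0. cball t d \<subseteq> A \<and>
      uniform_limit (cball t d) (\<lambda>n t. \<Sum>i<n. f i t) (\<lambda>t. \<Sum>i. f i t) sequentially"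
    by blast
qed

section \<open>Gegenbauer coefficients\<close>

text \<open>Absorbing the sign leaves the plain Taylor coefficients of the generating function, to
  which formal power series apply.\<close>

definition gcoef :: "complex \<Rightarrow> real \<Rightarrow> nat \<Rightarrow> complex" where
  "gcoef \<tau> x n = (-1) ^ n * gegenbauer \<tau> x n"

lemma gcoef_sums:
  fixes s :: complex
  assumes "-1 \<le> x" "x \<le> 1" "norm s < 1"
  shows "(\<lambda>n. gcoef \<tau> x n * s ^ n) sums ((s\<^sup>2 + 2 * s * of_real x + 1) powr (- \<tau>))"
  using gegenbauer_sums[OF assms, of \<tau>] by (simp add: gcoef_def mult_ac)

text \<open>The generating function f = u^(-\<tau>) solves u f' = -\<tau> u' f. Comparing the
  coefficients of order 0 and n + 1 in this equation gives the last two claims.\<close>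

lemma
  assumes x: "-1 \<le> x" "x \<le> 1"
  shows gcoef_0: "gcoef \<tau> x 0 = 1"
    and gcoef_1: "gcoef \<tau> x (Suc 0) = - 2 * \<tau> * of_real x"
    and gcoef_rec: "of_nat (n + 2) * gcoef \<tau> x (n + 2) =
      - 2 * of_real x * (of_nat (n + 1) + \<tau>) * gcoef \<tau> x (n + 1) -
      (of_nat n + 2 * \<tau>) * gcoef \<tau> x n"
proof -
  define u where "u s = s\<^sup>2 + 2 * s * complex_of_real x + 1" for s
  define f where "f s = u s powr (- \<tau>)" for s
  define F where "F = Abs_fps (gcoef \<tau> x)"
  have sums: "(\<lambda>n. fps_nth F n * s ^ n) sums f s" if "norm s < 1" for s
    using gcoef_sums[OF x that, of \<tau>] by (simp add: F_def f_def u_def)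
  have ev: "\<forall>\<^sub>F s in nhds (0::complex). norm s < 1"
    using eventually_nhds_in_open[of "ball (0::complex) 1" 0] by simp
  have F: "f has_fps_expansion F"
    by (rule has_fps_expansionI) (use ev sums in \<open>auto elim!: eventually_mono\<close>)
  have eq: "u s * deriv f s = - \<tau> * ((2 * s + 2 * of_real x) * f s)" if "norm s < 1" for s
  proof -
    have nz: "u s \<notin> \<real>\<^sub>\<le>\<^sub>0" unfolding u_def using gegenbauer_base_nonpos[OF x that] .
    then have "u s \<noteq> 0" by auto
    have "(f has_field_derivative (- \<tau> * u s powr (- \<tau> - 1) * (2 * s + 2 * of_real x))) (at s)"
      unfolding f_def using nz unfolding u_def by (auto intro!: derivative_eq_intros)
    then have "deriv f s = - \<tau> * u s powr (- \<tau> - 1) * (2 * s + 2 * of_real x)"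
      by (rule DERIV_imp_deriv)
    moreover have "u s powr (- \<tau> - 1) * u s = u s powr (- \<tau>)"
      using \<open>u s \<noteq> 0\<close> by (simp add: powr_diff)
    ultimately show ?thesis by (simp add: f_def mult_ac)
  qed
  have "(\<lambda>s. s ^ 2 + 2 * of_real x * s + 1) has_fps_expansion
      fps_X ^ 2 + fps_const (2 * complex_of_real x) * fps_X + 1"
    by (intro fps_expansion_intros)
  then have U: "u has_fps_expansion fps_X ^ 2 + fps_const (2 * complex_of_real x) * fps_X + 1"
    by (simp add: u_def[abs_def] mult_ac)
  have e1: "(\<lambda>s. u s * deriv f s) has_fps_expansion
      (fps_X ^ 2 + fps_const (2 * complex_of_real x) * fps_X + 1) * fps_deriv F"
    by (intro fps_expansion_intros U F)
  have e2: "(\<lambda>s. - \<tau> * ((2 * s + 2 * of_real x) * f s)) has_fps_expansion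
      fps_const (- \<tau>) * ((fps_const 2 * fps_X + fps_const (2 * of_real x)) * F)"
    by (intro fps_expansion_intros F)
  have e3: "\<forall>\<^sub>F s in nhds 0. u s * deriv f s = - \<tau> * ((2 * s + 2 * of_real x) * f s)"
    using ev by eventually_elim (use eq in auto)
  have ode: "(fps_X ^ 2 + fps_const (2 * complex_of_real x) * fps_X + 1) * fps_deriv F =
      fps_const (- \<tau>) * ((fps_const 2 * fps_X + fps_const (2 * of_real x)) * F)"
    using fps_expansion_unique_complex[OF _ e2] e1 has_fps_expansion_cong[OF e3 refl] by blast
  have F_nth: "fps_nth F k = gcoef \<tau> x k" for k by (simp add: F_def)
  have "fps_nth F 0 = f 0"
    using F by (rule has_fps_expansion_imp_0_eq_fps_nth_0[symmetric])
  then show g0: "gcoef \<tau> x 0 = 1" by (simp add: F_def f_def u_def)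
  have ode': "fps_X * (fps_X * fps_deriv F) + fps_const (2 * complex_of_real x) * (fps_X * fps_deriv F)
      + fps_deriv F = fps_const (- \<tau>) * (fps_const 2 * (fps_X * F) + fps_const (2 * of_real x) * F)"
    using ode by (simp add: algebra_simps power2_eq_square)
  show "gcoef \<tau> x (Suc 0) = - 2 * \<tau> * of_real x"
    using arg_cong[OF ode', of "\<lambda>G. fps_nth G 0"] g0 by (simp add: F_nth)
  show "of_nat (n + 2) * gcoef \<tau> x (n + 2) =
      - 2 * of_real x * (of_nat (n + 1) + \<tau>) * gcoef \<tau> x (n + 1) -
      (of_nat n + 2 * \<tau>) * gcoef \<tau> x n"
  proof -
    have "of_nat n * gcoef \<tau> x n + 2 * of_real x * (of_nat (n + 1) * gcoef \<tau> x (n + 1)) +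
        of_nat (n + 2) * gcoef \<tau> x (n + 2) =
        - \<tau> * (2 * gcoef \<tau> x n + 2 * of_real x * gcoef \<tau> x (n + 1))"
      using arg_cong[OF ode', of "\<lambda>G. fps_nth G (Suc n)"]
      by (cases n) (simp_all add: F_nth mult.assoc del: fps_const_mult fps_const_neg)
    then show ?thesis by algebra
  qed
qed

text \<open>\<open>gegenbauer\<close> is a definite description for each \<tau> separately and says
  nothing about its dependence on \<tau>. The recurrence does: every coefficient is a polynomial in
  \<tau>.\<close>

lemma holomorphic_gcoef:
  assumes x: "-1 \<le> x" "x \<le> 1" and f: "f holomorphic_on A"
  shows "(\<lambda>t. gcoef (f t) x n) holomorphic_on A"
proof (induction n rule: less_induct)
  case (less n)
  consider "n = 0" | "n = Suc 0" | m where "n = m + 2"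
    by (metis One_nat_def add_2_eq_Suc' less_2_cases not_less_eq old.nat.exhaust)
  then show ?case
  proof cases
    case 3
    have "gcoef \<tau> x n = (- 2 * of_real x * (of_nat (m + 1) + \<tau>) * gcoef \<tau> x (m + 1) -
      (of_nat m + 2 * \<tau>) * gcoef \<tau> x m) / of_nat n" for \<tau>
      using gcoef_rec[OF x, of m \<tau>] 3
      by (metis nonzero_mult_div_cancel_left of_nat_eq_0_iff add_is_0 zero_neq_numeral)
    moreover have "(\<lambda>t. gcoef (f t) x (m + 1)) holomorphic_on A" "(\<lambda>t. gcoef (f t) x m) holomorphic_on A"
      using 3 by (auto intro!: less)
    ultimately show ?thesis using 3 by (simp only:) (intro holomorphic_intros f, auto)
  qed (auto simp: gcoef_0[OF x] gcoef_1[OF x] intro!: holomorphic_intros f)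
qed

text \<open>
  Dividing the coefficients by \<open>\<Gamma>(n+\<tau>)/n!\<close> turns the three-term recurrence into an
  \<open>O(1/n\<^sup>2)\<close> perturbation of \<open>D\<^sub>n\<^sub>+\<^sub>2 = -2x D\<^sub>n\<^sub>+\<^sub>1 - D\<^sub>n\<close>, whose characteristic roots \<open>\<rho>\<close> and
  \<open>cnj \<rho>\<close> lie on the unit circle and are distinct as \<open>\<bar>x\<bar> < 1\<close>.
\<close>
lemma gcoef_growth:
  fixes R x :: real
  assumes R: "R \<ge> 0" and x: "-1 < x" "x < 1"
  obtains C N where "C \<ge> 0" "N \<ge> 1"
    "\<And>\<tau> n. norm \<tau> \<le> R \<Longrightarrow> n \<ge> N \<Longrightarrow> norm (gcoef \<tau> x n) \<le> C * real n powr (Re \<tau> - 1)"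
proof -
  define N where "N = nat \<lceil>2 * R\<rceil> + 2"
  have N: "N \<ge> 2" "2 * R \<le> real N" "R < real N" by (auto simp: N_def) linarith+
  have x': "-1 \<le> x" "x \<le> 1" using x by auto
  define y where "y = sqrt (1 - x\<^sup>2)"
  have y: "y > 0" "x\<^sup>2 + y\<^sup>2 = 1" using x by (auto simp: y_def abs_square_less_1 abs_square_le_1)
  define \<rho> where "\<rho> = Complex (- x) y"
  have \<rho>: "norm \<rho> = 1" "\<rho> + cnj \<rho> = - 2 * of_real x" "\<rho> * cnj \<rho> = 1" "cnj \<rho> - \<rho> = - 2 * \<i> * of_real y"
    using y by (auto simp: \<rho>_def cmod_def complex_eq_iff power2_eq_square)
  \<comment> \<open>|\<tau> (\<tau> - 1)| <= R (R + 1), the two denominators of the perturbation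
    \<open>e\<close> are at least m/2 each, and 1/y is the price of recovering D from V and
    W.\<close>
  define K where "K = 4 * (R * (R + 1)) / y"
  have K: "K \<ge> 0" using R y by (simp add: K_def)
  \<comment> \<open>Starting the Pochhammer symbol at \<tau> + N keeps L nonzero on the whole disc
    |\<tau>| <= R. The symbol started at \<tau> would vanish when \<tau> is a nonpositive
    integer.\<close>
  define L where "L \<tau> n = pochhammer (\<tau> + of_nat N) (n - N) * rGamma (1 + of_nat n :: complex)" for \<tau> n
  define B where "B = norm (rGamma (1 + of_nat N :: complex))"
  define B' where "B' = norm (rGamma (1 + of_nat (Suc N) :: complex))"
  have rG: "rGamma (1 + of_nat n :: complex) \<noteq> 0" for n
    using Gamma_fact[of n, where 'a = complex] by (auto simp: Gamma_def)
  have B: "B > 0" "B' > 0" using rG unfolding B_def B'_def zero_less_norm_iff by blast+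
  have "(\<lambda>\<tau>. gcoef \<tau> x n) holomorphic_on cball 0 R" for n
    by (rule holomorphic_gcoef[OF x']) (rule holomorphic_on_ident)
  then have "bounded ((\<lambda>\<tau>. gcoef \<tau> x n) ` cball 0 R)" for n
    by (intro compact_imp_bounded compact_continuous_image holomorphic_on_imp_continuous_on) auto
  then have "\<exists>M. \<forall>\<tau>. norm \<tau> \<le> R \<longrightarrow> norm (gcoef \<tau> x n) \<le> M" for n
    unfolding bounded_iff by (metis imageI mem_cball_0)
  then obtain M where M: "\<And>n \<tau>. norm \<tau> \<le> R \<Longrightarrow> norm (gcoef \<tau> x n) \<le> M n" by metis
  define M' where "M' = exp (2 * K) * (2 * (M (Suc N) / B' + M N / B)) / (2 * y)"
  have main: "norm (gcoef \<tau> x n) \<le> M' * norm (L \<tau> n)" if \<tau>: "norm \<tau> \<le> R" and n: "n \<ge> N" for \<tau> n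
  proof -
    have nt: "norm (of_nat m + \<tau>) \<ge> real m / 2" if "m \<ge> N" for m
    proof -
      have "norm (of_nat m :: complex) \<le> norm (of_nat m + \<tau>) + norm \<tau>"
        using norm_triangle_ineq4[of "of_nat m + \<tau>" \<tau>] by simp
      moreover have "2 * R \<le> real m" using that N by linarith
      ultimately show ?thesis using \<tau> by simp
    qed
    have nz: "of_nat m + \<tau> \<noteq> 0" if "m \<ge> N" for m
      using nt[OF that] that N by auto
    have L0: "L \<tau> m \<noteq> 0" for m
    proof -
      have "\<tau> + of_nat N + of_nat i \<noteq> 0" for i using nz[of "N + i"] by (simp add: add_ac)
      then have "\<tau> + of_nat N \<noteq> - of_nat i" for i by (metis add.left_inverse)
      then show ?thesis using rG by (simp add: L_def pochhammer_eq_0_iff)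
    qed
    have LS: "L \<tau> (Suc m) * of_nat (Suc m) = L \<tau> m * (of_nat m + \<tau>)" if "m \<ge> N" for m
    proof -
      have "rGamma (1 + of_nat m) = (1 + of_nat m) * rGamma (1 + of_nat (Suc m) :: complex)"
        using rGamma_plus1[of "1 + of_nat m :: complex"] by (simp add: add_ac)
      then show ?thesis using that
        by (simp add: L_def Suc_diff_le pochhammer_Suc of_nat_diff algebra_simps)
    qed
    define D where "D m = gcoef \<tau> x m / L \<tau> m" for m
    \<comment> \<open>The coefficient of D m after rescaling is (m + 2\<tau>)(m + 1)/((m + \<tau>)(m
      + 1 + \<tau>)). Numerator and denominator differ only by the constant \<tau> (\<tau> - 1), so
      the coefficient is 1 + O(1/m^2).\<close>
    define e where "e m = - \<tau> * (\<tau> - 1) / ((of_nat m + \<tau>) * (of_nat (Suc m) + \<tau>))" for m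
    have rec: "D (m + 2) = (\<rho> + cnj \<rho>) * D (Suc m) - (1 + e m) * D m" if m: "m \<ge> N" for m
    proof -
      define a where "a = of_nat m + \<tau>"
      define b where "b = of_nat (Suc m) + \<tau>"
      have ab: "a \<noteq> 0" "b \<noteq> 0" using nz[of m] nz[of "Suc m"] m by (simp_all add: a_def b_def)
      have L1: "L \<tau> m = L \<tau> (m + 2) * of_nat (m + 2) * of_nat (Suc m) / (a * b)"
        and L2: "L \<tau> (Suc m) = L \<tau> (m + 2) * of_nat (m + 2) / b"
        using LS[of m] LS[of "Suc m"] m ab unfolding a_def[symmetric] b_def[symmetric]
        by (simp_all add: eq_divide_eq del: of_nat_Suc of_nat_add)
      have e: "1 + e m = (of_nat m + 2 * \<tau>) * of_nat (Suc m) / (a * b)"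
      proof -
        have "(1 + e m) * (a * b) = a * b - \<tau> * (\<tau> - 1)"
          using ab unfolding e_def a_def[symmetric] b_def[symmetric] distrib_right by simp
        also have "\<dots> = (of_nat m + 2 * \<tau>) * of_nat (Suc m)"
          by (simp add: a_def b_def algebra_simps)
        finally show ?thesis using ab by (simp add: field_simps)
      qed
      have s: "of_nat (Suc m) \<noteq> (0::complex)" "of_nat (m + 2) \<noteq> (0::complex)"
        by (simp_all del: of_nat_Suc of_nat_add)
      define l where "l = L \<tau> (m + 2)"
      have l: "l \<noteq> 0" using L0 by (simp add: l_def)
      have g: "gcoef \<tau> x (m + 2) = (- 2 * of_real x * b * gcoef \<tau> x (Suc m) -
          (of_nat m + 2 * \<tau>) * gcoef \<tau> x m) / of_nat (m + 2)"
        using gcoef_rec[OF x', of m \<tau>] s by (simp add: b_def field_simps)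
      have D1: "D (Suc m) = gcoef \<tau> x (Suc m) * b / (l * of_nat (m + 2))"
        unfolding D_def L2 l_def[symmetric] by simp
      have D0: "D m = gcoef \<tau> x m * (a * b) / (l * of_nat (m + 2) * of_nat (Suc m))"
        unfolding D_def L1 l_def[symmetric] by simp
      have "(1 + e m) * D m = (of_nat m + 2 * \<tau>) * gcoef \<tau> x m / (l * of_nat (m + 2))"
        unfolding e D0 using ab s(1) by (simp del: of_nat_Suc of_nat_add)
      then show ?thesis
        unfolding D1 \<rho>(2) D_def[of "m + 2"] l_def[symmetric] g
        by (simp add: diff_divide_distrib mult_ac del: of_nat_Suc of_nat_add)
    qed
    \<comment> \<open>V and W split off one characteristic root each. A step multiplies V by cnj
      \<rho> and W by \<rho>, both of modulus 1, up to the term e m * D m. Their difference is (cnj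
      \<rho> - \<rho>) D m, so D is controlled as long as y > 0.\<close>
    define V where "V m = D (Suc m) - \<rho> * D m" for m
    define W where "W m = D (Suc m) - cnj \<rho> * D m" for m
    define Q where "Q m = norm (V m) + norm (W m)" for m
    have DQ: "norm (D m) \<le> Q m / (2 * y)" for m
    proof -
      have "V m - W m = (cnj \<rho> - \<rho>) * D m" by (simp add: V_def W_def algebra_simps)
      then have "norm (V m - W m) = 2 * y * norm (D m)"
        using y by (simp add: \<rho>(4) norm_mult)
      then have "2 * y * norm (D m) \<le> Q m"
        using norm_triangle_ineq4[of "V m" "W m"] by (simp add: Q_def)
      then show ?thesis using y by (simp add: field_simps)
    qed
    have e_le: "norm (e m) / y \<le> K / (real m)\<^sup>2" if m: "m \<ge> N" for m
    proof -
      have "norm (\<tau> - 1) \<le> R + 1" using norm_triangle_ineq4[of \<tau> 1] \<tau> by simp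
      moreover have "real m / 2 \<le> norm (of_nat (Suc m) + \<tau>)" using nt[of "Suc m"] m by simp
      ultimately have "norm (e m) \<le> (R * (R + 1)) / (real m / 2 * (real m / 2))"
        unfolding e_def norm_divide norm_mult norm_minus_cancel
        using nt[OF m] \<tau> R m N by (intro frac_le mult_mono mult_nonneg_nonneg mult_pos_pos) auto
      then have "norm (e m) / y \<le> (R * (R + 1)) / (real m / 2 * (real m / 2)) / y"
        using y by (intro divide_right_mono) auto
      also have "\<dots> = K / (real m)\<^sup>2" by (simp add: K_def power2_eq_square mult_ac)
      finally show ?thesis .
    qed
    have step: "Q (Suc m) \<le> exp (K / (real m)\<^sup>2) * Q m" if m: "m \<ge> N" for m
    proof -
      have "V (Suc m) = cnj \<rho> * V m - e m * D m - (1 - \<rho> * cnj \<rho>) * D m"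
           "W (Suc m) = \<rho> * W m - e m * D m - (1 - \<rho> * cnj \<rho>) * D m"
        using rec[OF m] by (simp_all add: V_def W_def algebra_simps)
      then have "norm (V (Suc m)) \<le> norm (V m) + norm (e m) * norm (D m)"
                "norm (W (Suc m)) \<le> norm (W m) + norm (e m) * norm (D m)"
        using norm_triangle_ineq4[of "cnj \<rho> * V m" "e m * D m"]
              norm_triangle_ineq4[of "\<rho> * W m" "e m * D m"] \<rho> by (simp_all add: norm_mult)
      then have "Q (Suc m) \<le> Q m + 2 * (norm (e m) * norm (D m))" by (simp add: Q_def)
      also have "norm (e m) * norm (D m) \<le> norm (e m) * (Q m / (2 * y))"
        by (intro mult_left_mono DQ) auto
      also have "Q m + 2 * (norm (e m) * (Q m / (2 * y))) = (1 + norm (e m) / y) * Q m"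
        using y by (simp add: field_simps)
      also have "\<dots> \<le> exp (K / (real m)\<^sup>2) * Q m"
        by (intro mult_right_mono order_trans[OF _ exp_ge_add_one_self])
           (use e_le[OF m] in \<open>auto simp: Q_def\<close>)
      finally show ?thesis by simp
    qed
    have "Q n \<le> exp (2 * K) * Q N"
      by (rule discrete_gronwall[OF _ K _ _ n]) (use step N in \<open>auto simp: Q_def\<close>)
    moreover have "Q N \<le> 2 * (M (Suc N) / B' + M N / B)"
    proof -
      have "norm (V N) \<le> norm (D (Suc N)) + norm (D N)" "norm (W N) \<le> norm (D (Suc N)) + norm (D N)"
        using norm_triangle_ineq4[of "D (Suc N)" "\<rho> * D N"]
              norm_triangle_ineq4[of "D (Suc N)" "cnj \<rho> * D N"] \<rho>
        by (simp_all add: V_def W_def norm_mult)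
      moreover have "norm (D N) \<le> M N / B"
        using M[OF \<tau>, of N] by (simp add: D_def L_def norm_divide norm_mult B_def divide_right_mono)
      moreover have "norm (D (Suc N)) \<le> M (Suc N) / B'"
      proof -
        have "norm (L \<tau> (Suc N)) = norm (of_nat N + \<tau>) * B'"
          by (simp add: L_def norm_mult B'_def add_ac)
        moreover have "norm (of_nat N + \<tau>) \<ge> 1" using nt[of N] N by simp
        ultimately have "B' \<le> norm (L \<tau> (Suc N))" using B by (simp add: mult_le_cancel_right1)
        then show ?thesis unfolding D_def norm_divide using B M[OF \<tau>, of "Suc N"]
          by (intro frac_le) (auto intro: order_trans[OF norm_ge_zero])
      qed
      ultimately show ?thesis by (simp add: Q_def)
    qed
    ultimately have "Q n \<le> exp (2 * K) * (2 * (M (Suc N) / B' + M N / B))"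
      by (smt (verit, best) exp_gt_zero mult_left_mono)
    then have "norm (D n) \<le> M'"
      using DQ[of n] y unfolding M'_def by (smt (verit) divide_right_mono)
    then show ?thesis using L0[of n] by (simp add: D_def norm_divide field_simps)
  qed
  \<comment> \<open>To be used with p = \<tau> + N, q = 1 + N and index n - N, where Re (p - q) = Re
    \<tau> - 1. The radius R + N + 1 covers both shifted parameters.\<close>
  obtain C N' where C: "C \<ge> 0" "N' \<ge> 1" "\<And>p q n. norm p \<le> R + real N + 1 \<Longrightarrow>
       norm q \<le> R + real N + 1 \<Longrightarrow> n \<ge> N' \<Longrightarrow>
       norm (pochhammer p n * rGamma (q + of_nat n) :: complex) \<le> C * real n powr Re (p - q)"
    using pochhammer_rGamma_growth[of "R + real N + 1"] R by auto
  have M'0: "M' \<ge> 0"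
  proof -
    have "norm (0::complex) \<le> R" using R by simp
    from M[OF this] have "M n \<ge> 0" for n by (meson norm_ge_zero order_trans)
    then show ?thesis unfolding M'_def using B y by auto
  qed
  show ?thesis
  proof (rule that[of "M' * (C * 2 powr (R + 1))" "2 * N + N'"])
    show "M' * (C * 2 powr (R + 1)) \<ge> 0" using M'0 C by simp
    show "1 \<le> 2 * N + N'" using N by simp
    fix \<tau> :: complex and n assume \<tau>: "norm \<tau> \<le> R" and n: "n \<ge> 2 * N + N'"
    have "norm (\<tau> + of_nat N) \<le> R + real N + 1"
      using norm_triangle_ineq[of \<tau> "of_nat N"] \<tau> by simp
    moreover have "norm (1 + of_nat N :: complex) \<le> R + real N + 1"
      using norm_triangle_ineq[of 1 "of_nat N :: complex"] R by simp
    ultimately have "norm (pochhammer (\<tau> + of_nat N) (n - N) * rGamma (1 + of_nat N + of_nat (n - N)))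
       \<le> C * real (n - N) powr Re (\<tau> + of_nat N - (1 + of_nat N))"
      by (rule C(3)) (use n in auto)
    then have "norm (L \<tau> n) \<le> C * real (n - N) powr (Re \<tau> - 1)"
      using n by (simp add: L_def of_nat_diff)
    \<comment> \<open>Since n >= 2N, the quotient (n - N)/n lies in [1/2, 1]. The exponent may have
      either sign: the power is at most 1 in one case and at most 2^(R+1) in the other.\<close>
    also have "real (n - N) powr (Re \<tau> - 1) \<le> 2 powr (R + 1) * real n powr (Re \<tau> - 1)"
    proof -
      have r: "real (n - N) / real n \<le> 1" "real (n - N) / real n \<ge> 1 / 2" "real n > 0"
        using n N by (auto simp: field_simps)
      have "(real (n - N) / real n) powr (Re \<tau> - 1) \<le> (1 / 2) powr (- (R + 1))"
      proof (cases "Re \<tau> - 1 \<ge> 0")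
        case True
        then have "(real (n - N) / real n) powr (Re \<tau> - 1) \<le> 1 powr (Re \<tau> - 1)"
          using r by (intro powr_mono2) auto
        also have "\<dots> \<le> 2 powr (R + 1)" using R by (simp add: ge_one_powr_ge_zero)
        finally show ?thesis unfolding powr_divide powr_minus by (simp del: minus_add_distrib)
      next
        case False
        then have "(real (n - N) / real n) powr (Re \<tau> - 1) \<le> (1 / 2) powr (Re \<tau> - 1)"
          using r by (intro powr_mono2') auto
        also have "\<dots> \<le> (1 / 2) powr (- (R + 1))"
          using abs_Re_le_cmod[of \<tau>] \<tau> by (intro powr_mono') auto
        finally show ?thesis .
      qed
      also have "(1 / 2 :: real) powr (- (R + 1)) = 2 powr (R + 1)"
        unfolding powr_divide powr_minus by (simp del: minus_add_distrib)
      finally have "real (n - N) powr (Re \<tau> - 1) / real n powr (Re \<tau> - 1) \<le> 2 powr (R + 1)"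
        using r by (simp add: powr_divide)
      moreover have "real n powr (Re \<tau> - 1) > 0" using r by simp
      ultimately show ?thesis by (simp add: pos_divide_le_eq)
    qed
    finally have "norm (L \<tau> n) \<le> C * (2 powr (R + 1) * real n powr (Re \<tau> - 1))"
      using C by (simp add: mult_left_mono)
    then have "M' * norm (L \<tau> n) \<le> M' * (C * (2 powr (R + 1) * real n powr (Re \<tau> - 1)))"
      using M'0 by (intro mult_left_mono)
    moreover have "norm (gcoef \<tau> x n) \<le> M' * norm (L \<tau> n)" using main[OF \<tau>] n by simp
    ultimately show "norm (gcoef \<tau> x n) \<le> M' * (C * 2 powr (R + 1)) * real n powr (Re \<tau> - 1)"
      by (simp add: mult_ac)
  qed
qed

section \<open>Holomorphy in the parameters\<close>

text \<open>A ratio test that is uniform in the parameters: the quotient of consecutive terms is at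
  most (k+R)^2/((k-R)(k+1)) r, which tends to r and so falls below q = (1+r)/2.\<close>

lemma hyp2F1_reg_terms_bound:
  fixes R r :: real
  assumes R: "R \<ge> 0" and r: "0 \<le> r" "r < 1"
  obtains K q N where "0 \<le> q" "q < 1"
    "\<And>a b c z k. norm a \<le> R \<Longrightarrow> norm b \<le> R \<Longrightarrow> norm c \<le> R \<Longrightarrow> norm z \<le> r \<Longrightarrow> k \<ge> N \<Longrightarrow>
       norm (pochhammer a k * pochhammer b k * rGamma (c + of_nat k) / fact k * z ^ k :: complex)
         \<le> K * q ^ k"
proof -
  define q where "q = (1 + r) / 2"
  have q: "0 < q" "q < 1" "r < q" using r by (auto simp: q_def)
  have "(\<lambda>k. (real k + R)\<^sup>2 / ((real k - R) * (real k + 1)) * r) \<longlonglongrightarrow> 1 * r"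
    by (intro tendsto_intros) real_asymp
  then have "\<forall>\<^sub>F k in sequentially. (real k + R)\<^sup>2 / ((real k - R) * (real k + 1)) * r < q"
    using q order_tendstoD(2)[of _ "1 * r" sequentially q] by simp
  then obtain N0 where N0: "\<And>k. k \<ge> N0 \<Longrightarrow> (real k + R)\<^sup>2 / ((real k - R) * (real k + 1)) * r < q"
    by (auto simp: eventually_sequentially)
  define N where "N = max N0 (nat \<lceil>R\<rceil> + 1)"
  have N: "real N > R" "N \<ge> N0" by (auto simp: N_def less_max_iff_disj) linarith
  have "(\<lambda>c. rGamma (c + of_nat N) :: complex) holomorphic_on cball 0 R"
    by (intro holomorphic_intros)
  then have "bounded ((\<lambda>c. rGamma (c + of_nat N) :: complex) ` cball 0 R)"
    by (intro compact_imp_bounded compact_continuous_image holomorphic_on_imp_continuous_on) auto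
  then obtain M where M: "\<And>c::complex. norm c \<le> R \<Longrightarrow> norm (rGamma (c + of_nat N)) \<le> M"
    unfolding bounded_iff by (metis imageI mem_cball_0)
  define K where "K = (pochhammer R N * pochhammer R N * M / fact N) / q ^ N"
  show ?thesis
  proof (rule that[of q N K])
    fix a b c z :: complex and k
    assume a: "norm a \<le> R" and b: "norm b \<le> R" and c: "norm c \<le> R" and z: "norm z \<le> r" and k: "k \<ge> N"
    define t where "t k = pochhammer a k * pochhammer b k * rGamma (c + of_nat k) / fact k * z ^ k" for k
    have "norm (t k) \<le> K * q ^ k"
      using k
    proof (induction k rule: dec_induct)
      case base
      have "norm (t N) \<le> pochhammer R N * pochhammer R N * M / fact N * 1"
        unfolding t_def norm_mult norm_divide norm_power
        using norm_pochhammer_le[OF a, of N] norm_pochhammer_le[OF b, of N] M[OF c] z r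
          order_trans[OF norm_ge_zero norm_pochhammer_le[OF a, of N]]
          order_trans[OF norm_ge_zero M[OF c]]
        by (intro mult_mono divide_mono mult_nonneg_nonneg divide_nonneg_nonneg power_le_one) auto
      then show ?case using q by (simp add: K_def)
    next
      case (step k)
      have kR: "real k > R" "k \<ge> N0" using step N by auto
      have "norm (of_nat k :: complex) \<le> norm (c + of_nat k) + norm c"
        using norm_triangle_ineq4[of "c + of_nat k" c] by simp
      then have ck: "norm (c + of_nat k) \<ge> real k - R" using c by simp
      then have nz: "c + of_nat k \<noteq> 0" using kR by auto
      have "rGamma (c + of_nat k) = (c + of_nat k) * rGamma (c + of_nat (Suc k))"
        using rGamma_plus1[of "c + of_nat k"] by (simp add: add_ac)
      then have "t (Suc k) = (a + of_nat k) * (b + of_nat k) / ((c + of_nat k) * of_nat (Suc k)) * z * t k"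
        using nz by (simp add: t_def pochhammer_Suc divide_simps del: of_nat_Suc)
      moreover have "norm ((a + of_nat k) * (b + of_nat k) / ((c + of_nat k) * of_nat (Suc k)) * z) \<le>
          (real k + R) * (real k + R) / ((real k - R) * (real k + 1)) * r"
        unfolding norm_mult norm_divide norm_of_nat
        using norm_triangle_ineq[of a "of_nat k"] norm_triangle_ineq[of b "of_nat k"] a b ck kR z r R
        by (intro mult_mono divide_mono mult_nonneg_nonneg divide_nonneg_nonneg mult_pos_pos) auto
      moreover have "\<dots> \<le> q" using N0[OF kR(2)] by (simp add: power2_eq_square)
      ultimately have "norm (t (Suc k)) \<le> q * norm (t k)"
        by (simp only: norm_mult) (intro mult_right_mono, auto)
      also have "\<dots> \<le> q * (K * q ^ k)" using step.IH q by (intro mult_left_mono) auto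
      finally show ?case by (simp add: mult_ac)
    qed
    then show "norm (pochhammer a k * pochhammer b k * rGamma (c + of_nat k) / fact k * z ^ k) \<le> K * q ^ k"
      unfolding t_def .
  qed (use q in auto)
qed

lemma summable_hyp2F1_reg:
  fixes a b c z :: complex
  assumes "norm z < 1"
  shows "summable (\<lambda>k. norm (pochhammer a k * pochhammer b k * rGamma (c + of_nat k) / fact k * z ^ k))"
proof -
  define R where "R = norm a + norm b + norm c"
  have R: "R \<ge> 0" by (simp add: R_def)
  obtain K q N where q: "0 \<le> q" "q < 1" and
    K: "\<And>a b c w k. norm a \<le> R \<Longrightarrow> norm b \<le> R \<Longrightarrow> norm c \<le> R \<Longrightarrow> norm w \<le> norm z \<Longrightarrow> k \<ge> N \<Longrightarrow>
       norm (pochhammer a k * pochhammer b k * rGamma (c + of_nat k) / fact k * w ^ k :: complex)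
         \<le> K * q ^ k"
    by (rule hyp2F1_reg_terms_bound[OF R norm_ge_zero[of z] assms]) (rule that; assumption)
  show ?thesis
  proof (rule summable_comparison_test[OF exI[of _ N]])
    show "summable (\<lambda>k. K * q ^ k)" using q by (intro summable_mult summable_geometric) auto
  qed (use K in \<open>auto simp: R_def\<close>)
qed

lemma holomorphic_bounded_on_cball:
  assumes "f holomorphic_on A" "cball t d \<subseteq> A"
  obtains R :: real where "R \<ge> 0" "\<And>s. s \<in> cball t d \<Longrightarrow> norm (f s) \<le> R"
proof -
  have "bounded (f ` cball t d)"
    by (intro compact_imp_bounded compact_continuous_image holomorphic_on_imp_continuous_on
        holomorphic_on_subset[OF assms] compact_cball)
  then obtain R where "\<And>s. s \<in> cball t d \<Longrightarrow> norm (f s) \<le> R"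
    unfolding bounded_iff by blast
  then have "s \<in> cball t d \<Longrightarrow> norm (f s) \<le> max 0 R" for s
    by (simp add: le_max_iff_disj)
  then show ?thesis using that[of "max 0 R"] by auto
qed

lemma holomorphic_pochhammer:
  "f holomorphic_on A \<Longrightarrow> (\<lambda>t. pochhammer (f t) n :: complex) holomorphic_on A"
  by (induction n) (auto simp: pochhammer_Suc intro!: holomorphic_intros)

text \<open>All three parameters may move at once, because \<alpha>, \<beta> and \<tau> enter
  \<open>coupling\<close> only through combinations. On a closed disc one radius bounds the three of
  them, which makes the geometric majorant uniform.\<close>

lemma holomorphic_hyp2F1_reg:
  assumes A: "open A" and h: "a holomorphic_on A" "b holomorphic_on A" "c holomorphic_on A"
    and z: "norm z < 1"
  shows "(\<lambda>t. hyp2F1_reg (a t) (b t) (c t) z) holomorphic_on A"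
  unfolding hyp2F1_reg_def
proof (rule holomorphic_suminf[OF A])
  fix k
  show "(\<lambda>t. pochhammer (a t) k * pochhammer (b t) k * rGamma (c t + of_nat k) / fact k * z ^ k) holomorphic_on A"
    using h by (intro holomorphic_intros holomorphic_pochhammer) auto
next
  fix t assume "t \<in> A"
  then obtain d where d: "d > 0" "cball t d \<subseteq> A" using A open_contains_cball by blast
  obtain R1 where R1: "R1 \<ge> 0" "\<And>s. s \<in> cball t d \<Longrightarrow> norm (a s) \<le> R1"
    using holomorphic_bounded_on_cball[OF h(1) d(2)] by metis
  obtain R2 where R2: "R2 \<ge> 0" "\<And>s. s \<in> cball t d \<Longrightarrow> norm (b s) \<le> R2"
    using holomorphic_bounded_on_cball[OF h(2) d(2)] by metis
  obtain R3 where R3: "R3 \<ge> 0" "\<And>s. s \<in> cball t d \<Longrightarrow> norm (c s) \<le> R3"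
    using holomorphic_bounded_on_cball[OF h(3) d(2)] by metis
  define R where "R = R1 + R2 + R3"
  have R: "R \<ge> 0" using R1 R2 R3 by (simp add: R_def)
  obtain K q N where q: "0 \<le> q" "q < 1" and
    K: "\<And>a b c w k. norm a \<le> R \<Longrightarrow> norm b \<le> R \<Longrightarrow> norm c \<le> R \<Longrightarrow> norm w \<le> norm z \<Longrightarrow> k \<ge> N \<Longrightarrow>
       norm (pochhammer a k * pochhammer b k * rGamma (c + of_nat k) / fact k * w ^ k :: complex)
         \<le> K * q ^ k"
    by (rule hyp2F1_reg_terms_bound[OF R norm_ge_zero[of z] z]) (rule that; assumption)
  show "\<exists>d M N. d > 0 \<and> cball t d \<subseteq> A \<and> summable M \<and> (\<forall>k\<ge>N. \<forall>s\<in>cball t d.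
     norm (pochhammer (a s) k * pochhammer (b s) k * rGamma (c s + of_nat k) / fact k * z ^ k) \<le> M k)"
  proof (intro exI conjI allI ballI impI)
    show "summable (\<lambda>k. K * q ^ k)" using q by (intro summable_mult summable_geometric) auto
    fix k s assume "k \<ge> N" "s \<in> cball t d"
    then show "norm (pochhammer (a s) k * pochhammer (b s) k * rGamma (c s + of_nat k) / fact k * z ^ k) \<le> K * q ^ k"
      using R1(1) R2(1) R3(1) R1(2)[of s] R2(2)[of s] R3(2)[of s] by (intro K) (auto simp: R_def)
  qed (use d in auto)
qed

text \<open>Up to the factor 2^(-a) \<Gamma>(\<alpha>) \<Gamma>(2\<beta>) with a = 2\<alpha> +
  2\<beta> - 2\<tau> - 1, this is the n-th moment on [0,1] of the weight s^(\<alpha>-1)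
  (1-s)^(2\<beta>-1) (1+s)^(-a). Without that factor it is entire in all three parameters.\<close>

definition coupling :: "complex \<Rightarrow> complex \<Rightarrow> complex \<Rightarrow> nat \<Rightarrow> complex" where
  "coupling \<alpha> \<beta> \<tau> n = pochhammer \<alpha> n *
     hyp2F1_reg (2 * \<alpha> + 2 * \<beta> - 2 * \<tau> - 1) (2 * \<beta>) (of_nat n + \<alpha> + 2 * \<beta>) (1 / 2)"

text \<open>Put q = \<alpha> + 2\<beta>. Dividing the k-th term of the series by 1/\<Gamma>(q+n)
  leaves 1/(q+n)_k, which is at most 1/k! for large n. The series is thus dominated by
  |1/\<Gamma>(q+n)| times a fixed convergent one, and (\<alpha>)_n/\<Gamma>(q+n) has order \<alpha>
  - q = -2\<beta>.\<close>

lemma coupling_growth: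
  fixes R :: real
  assumes "R \<ge> 0"
  obtains C N where "C \<ge> 0" "N \<ge> 1"
    "\<And>\<alpha> \<beta> \<tau> n. norm \<alpha> \<le> R \<Longrightarrow> norm \<beta> \<le> R \<Longrightarrow> norm \<tau> \<le> R \<Longrightarrow> n \<ge> N \<Longrightarrow>
       norm (coupling \<alpha> \<beta> \<tau> n) \<le> C * real n powr (- 2 * Re \<beta>)"
proof -
  \<comment> \<open>Bounds all parameters in play: the largest is 2\<alpha> + 2\<beta> - 2\<tau> -
    1, of modulus at most 6R + 1.\<close>
  define P where "P = 6 * R + 1"
  have P: "P \<ge> 0" using assms by (simp add: P_def)
  obtain C N where C: "C \<ge> 0" "N \<ge> 1" "\<And>p q n. norm p \<le> P \<Longrightarrow> norm q \<le> P \<Longrightarrow> n \<ge> N \<Longrightarrow>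
       norm (pochhammer p n * rGamma (q + of_nat n) :: complex) \<le> C * real n powr Re (p - q)"
    by (rule pochhammer_rGamma_growth[OF P]) (rule that; assumption)
  \<comment> \<open>The terms of F(P, P; 1; 1/2), a majorant independent of n and of the
    parameters.\<close>
  define S where "S k = pochhammer P k * pochhammer P k / (fact k * fact k) * (1 / 2) ^ k" for k
  have P_nonneg: "pochhammer P k \<ge> 0" for k
    using norm_pochhammer_le[of 0 P k] P norm_ge_zero[of "pochhammer (0::complex) k"]
    unfolding norm_zero by linarith
  have "summable (\<lambda>k. norm (pochhammer (of_real P) k * pochhammer (of_real P) k *
      rGamma (1 + of_nat k) / fact k * (1 / 2) ^ k :: complex))"
    by (rule summable_hyp2F1_reg) auto
  also have "(\<lambda>k. norm (pochhammer (of_real P) k * pochhammer (of_real P) k *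
      rGamma (1 + of_nat k) / fact k * (1 / 2) ^ k :: complex)) = S"
  proof
    fix k
    have "rGamma (1 + of_nat k :: complex) = 1 / Gamma (1 + of_nat k)"
      using inverse_inverse_eq[of "rGamma (1 + of_nat k :: complex)"]
      unfolding Gamma_def by (simp add: inverse_eq_divide)
    also have "\<dots> = 1 / fact k" by (simp add: Gamma_fact)
    finally have "rGamma (1 + of_nat k :: complex) = 1 / fact k" .
    moreover have "pochhammer (complex_of_real P) k = of_real (pochhammer P k)"
      by (simp add: pochhammer_of_real)
    ultimately show "norm (pochhammer (of_real P) k * pochhammer (of_real P) k *
      rGamma (1 + of_nat k) / fact k * (1 / 2) ^ k :: complex) = S k"
      using P_nonneg[of k] by (simp add: S_def norm_mult norm_divide norm_power)
  qed
  finally have S: "summable S" .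
  have S_nonneg: "S k \<ge> 0" for k using P_nonneg[of k] by (simp add: S_def)
  define N' where "N' = max N (nat \<lceil>P + 1\<rceil>)"
  have N': "real N' \<ge> P + 1" "N' \<ge> N" by (auto simp: N'_def le_max_iff_disj) linarith
  show ?thesis
  proof (rule that[of "C * suminf S" N'])
    show "C * suminf S \<ge> 0" using C(1) suminf_nonneg[OF S S_nonneg] by simp
    show "N' \<ge> 1" using N' C by simp
    fix \<alpha> \<beta> \<tau> :: complex and n
    assume p: "norm \<alpha> \<le> R" "norm \<beta> \<le> R" "norm \<tau> \<le> R" and n: "n \<ge> N'"
    define a where "a = 2 * \<alpha> + 2 * \<beta> - 2 * \<tau> - 1"
    define q where "q = \<alpha> + 2 * \<beta>"
    have a: "norm a \<le> P"
    proof -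
      have "norm a \<le> norm (2 * \<alpha>) + norm (2 * \<beta>) + norm (2 * \<tau>) + norm (1::complex)"
        using norm_triangle_ineq4[of "2 * \<alpha> + 2 * \<beta> - 2 * \<tau>" 1]
          norm_triangle_ineq4[of "2 * \<alpha> + 2 * \<beta>" "2 * \<tau>"] norm_triangle_ineq[of "2 * \<alpha>" "2 * \<beta>"]
        unfolding a_def by linarith
      then show ?thesis using p by (simp add: P_def norm_mult)
    qed
    have q: "norm q \<le> P"
      using norm_triangle_ineq[of \<alpha> "2 * \<beta>"] p assms by (simp add: P_def norm_mult q_def)
    have b: "norm (2 * \<beta>) \<le> P" and \<alpha>: "norm \<alpha> \<le> P" using p assms by (auto simp: P_def norm_mult)
    have nP: "real n \<ge> P + 1" "n \<ge> N" using n N' by auto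
    define t where "t k = pochhammer a k * pochhammer (2 * \<beta>) k *
        rGamma (of_nat n + \<alpha> + 2 * \<beta> + of_nat k) / fact k * (1 / 2) ^ k" for k
    have t: "norm (t k) \<le> norm (rGamma (q + of_nat n)) * S k" for k
    proof -
      have "real i + 1 \<le> norm (q + of_nat n + of_nat i)" for i
      proof -
        have "norm (of_nat (n + i) :: complex) \<le> norm (q + of_nat n + of_nat i) + norm q"
          using norm_triangle_ineq4[of "q + of_nat n + of_nat i" q] by simp
        then have "real n + real i \<le> norm (q + of_nat n + of_nat i) + norm q"
          unfolding norm_of_nat by simp
        then show ?thesis using q nP by linarith
      qed
      then have "(\<Prod>i<k. real i + 1) \<le> norm (pochhammer (q + of_nat n) k)"
        unfolding pochhammer_prod atLeast0LessThan prod_norm[symmetric] by (intro prod_mono) auto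
      then have f: "fact k \<le> norm (pochhammer (q + of_nat n) k)"
        by (simp add: fact_prod_Suc atLeast0LessThan add.commute)
      have "norm (rGamma (q + of_nat n)) =
          norm (pochhammer (q + of_nat n) k) * norm (rGamma (q + of_nat n + of_nat k))"
        unfolding norm_mult[symmetric] by (subst pochhammer_rGamma[of _ k]) (rule refl)
      then have "fact k * norm (rGamma (q + of_nat n + of_nat k)) \<le> norm (rGamma (q + of_nat n))"
        using mult_right_mono[OF f norm_ge_zero[of "rGamma (q + of_nat n + of_nat k)"]] by linarith
      then have g: "norm (rGamma (q + of_nat n + of_nat k)) \<le> norm (rGamma (q + of_nat n)) / fact k"
        by (simp add: field_simps)
      have "norm (t k) = norm (pochhammer a k) * norm (pochhammer (2 * \<beta>) k) *
              norm (rGamma (q + of_nat n + of_nat k)) / fact k * (1 / 2) ^ k"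
        unfolding t_def q_def norm_mult norm_divide norm_power norm_fact
        by (simp add: add_ac)
      also have "\<dots> \<le> pochhammer P k * pochhammer P k * (norm (rGamma (q + of_nat n)) / fact k) / fact k * (1 / 2) ^ k"
        using norm_pochhammer_le[OF a, of k] norm_pochhammer_le[OF b, of k] g P_nonneg
        by (intro mult_right_mono divide_right_mono mult_mono) auto
      also have "\<dots> = norm (rGamma (q + of_nat n)) * S k" by (simp add: S_def)
      finally show ?thesis .
    qed
    have "norm (\<Sum>k. t k) \<le> (\<Sum>k. norm (rGamma (q + of_nat n)) * S k)"
      using t S by (intro norm_suminf_le summable_mult)
    then have "norm (\<Sum>k. t k) \<le> norm (rGamma (q + of_nat n)) * suminf S"
      using S by (simp add: suminf_mult)
    then have "norm (coupling \<alpha> \<beta> \<tau> n) \<le> norm (pochhammer \<alpha> n) * (norm (rGamma (q + of_nat n)) * suminf S)"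
      unfolding coupling_def hyp2F1_reg_def a_def[symmetric] t_def[symmetric] norm_mult
      by (intro mult_left_mono) auto
    also have "\<dots> = norm (pochhammer \<alpha> n * rGamma (q + of_nat n)) * suminf S" by (simp add: norm_mult)
    also have "\<dots> \<le> C * real n powr Re (\<alpha> - q) * suminf S"
      by (intro mult_right_mono C(3) \<alpha> q nP suminf_nonneg[OF S S_nonneg])
    also have "Re (\<alpha> - q) = - 2 * Re \<beta>" by (simp add: q_def)
    finally show "norm (coupling \<alpha> \<beta> \<tau> n) \<le> C * suminf S * real n powr (- 2 * Re \<beta>)"
      by (simp add: mult_ac)
  qed
qed

text \<open>The exponents -2 Re \<beta> and Re \<tau> - 1 of the two growth bounds add up to Re
  (\<tau> - 2\<beta>) - 1. On a compact disc Re (\<tau> - 2\<beta>) attains a maximum, still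
  negative, so a single summable power of n dominates.\<close>

lemma coupling_gcoef_bound:
  assumes x: "-1 < x" "x < 1" and A: "open A"
    and h: "\<alpha> holomorphic_on A" "\<beta> holomorphic_on A" "\<tau> holomorphic_on A"
    and neg: "\<And>s. s \<in> A \<Longrightarrow> Re (\<tau> s - 2 * \<beta> s) < 0" and t: "t \<in> A"
  shows "\<exists>d M N. d > 0 \<and> cball t d \<subseteq> A \<and> summable M \<and>
     (\<forall>n\<ge>N. \<forall>s\<in>cball t d. norm (coupling (\<alpha> s) (\<beta> s) (\<tau> s) n * gcoef (\<tau> s) x n) \<le> M n)"
proof -
  obtain d where d: "d > 0" "cball t d \<subseteq> A" using A t open_contains_cball by blast
  obtain R1 where R1: "R1 \<ge> 0" "\<And>s. s \<in> cball t d \<Longrightarrow> norm (\<alpha> s) \<le> R1"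
    using holomorphic_bounded_on_cball[OF h(1) d(2)] by metis
  obtain R2 where R2: "R2 \<ge> 0" "\<And>s. s \<in> cball t d \<Longrightarrow> norm (\<beta> s) \<le> R2"
    using holomorphic_bounded_on_cball[OF h(2) d(2)] by metis
  obtain R3 where R3: "R3 \<ge> 0" "\<And>s. s \<in> cball t d \<Longrightarrow> norm (\<tau> s) \<le> R3"
    using holomorphic_bounded_on_cball[OF h(3) d(2)] by metis
  define R where "R = R1 + R2 + R3"
  have R: "R \<ge> 0" using R1 R2 R3 by (simp add: R_def)
  obtain C N where C: "C \<ge> 0" "N \<ge> 1"
    "\<And>\<alpha> \<beta> \<tau> n. norm \<alpha> \<le> R \<Longrightarrow> norm \<beta> \<le> R \<Longrightarrow> norm \<tau> \<le> R \<Longrightarrow> n \<ge> N \<Longrightarrow>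
       norm (coupling \<alpha> \<beta> \<tau> n) \<le> C * real n powr (- 2 * Re \<beta>)"
    by (rule coupling_growth[OF R]) (rule that; assumption)
  obtain D N' where D: "D \<ge> 0" "N' \<ge> 1"
    "\<And>\<tau> n. norm \<tau> \<le> R \<Longrightarrow> n \<ge> N' \<Longrightarrow> norm (gcoef \<tau> x n) \<le> D * real n powr (Re \<tau> - 1)"
    by (rule gcoef_growth[OF R x]) (rule that; assumption)
  have "(\<lambda>s. \<tau> s - 2 * \<beta> s) holomorphic_on A" by (intro holomorphic_intros h)
  from holomorphic_on_imp_continuous_on[OF holomorphic_on_subset[OF this d(2)]]
  have "continuous_on (cball t d) (\<lambda>s. Re (\<tau> s - 2 * \<beta> s))"
    by (rule continuous_on_Re)
  moreover have "cball t d \<noteq> {}" using d by auto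
  ultimately obtain s0 where s0: "s0 \<in> cball t d"
    "\<And>s. s \<in> cball t d \<Longrightarrow> Re (\<tau> s - 2 * \<beta> s) \<le> Re (\<tau> s0 - 2 * \<beta> s0)"
    using continuous_attains_sup[OF compact_cball] by blast
  define \<delta> where "\<delta> = Re (\<tau> s0 - 2 * \<beta> s0)"
  have \<delta>: "\<delta> < 0" using neg s0(1) d(2) by (auto simp: \<delta>_def)
  show ?thesis
  proof (intro exI conjI allI ballI impI)
    show "summable (\<lambda>n. C * D * real n powr (\<delta> - 1))"
      using \<delta> by (intro summable_mult) (simp add: summable_real_powr_iff)
    fix n s assume n: "n \<ge> max N N'" and s: "s \<in> cball t d"
    have le: "norm (\<alpha> s) \<le> R" "norm (\<beta> s) \<le> R" "norm (\<tau> s) \<le> R"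
      using R1(1) R2(1) R3(1) R1(2)[OF s] R2(2)[OF s] R3(2)[OF s] by (auto simp: R_def)
    have "norm (coupling (\<alpha> s) (\<beta> s) (\<tau> s) n * gcoef (\<tau> s) x n) \<le>
        (C * real n powr (- 2 * Re (\<beta> s))) * (D * real n powr (Re (\<tau> s) - 1))"
      unfolding norm_mult using n C(1) by (intro mult_mono C(3) D(3) le) auto
    also have "\<dots> = C * D * real n powr (Re (\<tau> s - 2 * \<beta> s) - 1)"
      by (simp add: powr_add[symmetric] algebra_simps)
    also have "\<dots> \<le> C * D * real n powr (\<delta> - 1)"
      using n C D s0(2)[OF s] by (intro mult_left_mono powr_mono) (auto simp: \<delta>_def)
    finally show "norm (coupling (\<alpha> s) (\<beta> s) (\<tau> s) n * gcoef (\<tau> s) x n) \<le> C * D * real n powr (\<delta> - 1)" .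
  qed (use d in auto)
qed

lemma summable_coupling_gcoef:
  assumes "-1 < x" "x < 1" "Re (\<tau> - 2 * \<beta>) < 0"
  shows "summable (\<lambda>n. coupling \<alpha> \<beta> \<tau> n * gcoef \<tau> x n)"
proof -
  have "\<exists>d M N. d > 0 \<and> cball (0::complex) d \<subseteq> UNIV \<and> summable M \<and>
     (\<forall>n\<ge>N. \<forall>s\<in>cball (0::complex) d. norm (coupling \<alpha> \<beta> \<tau> n * gcoef \<tau> x n) \<le> M n)"
    by (rule coupling_gcoef_bound) (use assms in auto)
  then obtain d M N where *: "d > 0" "summable M"
     "\<forall>n\<ge>N. \<forall>s\<in>cball (0::complex) d. norm (coupling \<alpha> \<beta> \<tau> n * gcoef \<tau> x n) \<le> M n"
    by blast
  then have "\<exists>N. \<forall>n\<ge>N. norm (coupling \<alpha> \<beta> \<tau> n * gcoef \<tau> x n) \<le> M n"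
    by (metis centre_in_cball less_imp_le)
  then show ?thesis using *(2) by (rule summable_comparison_test)
qed

lemma holomorphic_coupling_sum:
  assumes x: "-1 < x" "x < 1" and A: "open A"
    and h: "\<alpha> holomorphic_on A" "\<beta> holomorphic_on A" "\<tau> holomorphic_on A"
    and neg: "\<And>s. s \<in> A \<Longrightarrow> Re (\<tau> s - 2 * \<beta> s) < 0"
  shows "(\<lambda>t. \<Sum>n. coupling (\<alpha> t) (\<beta> t) (\<tau> t) n * gcoef (\<tau> t) x n) holomorphic_on A"
proof (rule holomorphic_suminf[OF A])
  fix n
  show "(\<lambda>t. coupling (\<alpha> t) (\<beta> t) (\<tau> t) n * gcoef (\<tau> t) x n) holomorphic_on A"
    unfolding coupling_def
    by (rule holomorphic_on_mult[OF holomorphic_on_mult[OF holomorphic_pochhammer[OF h(1)]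
          holomorphic_hyp2F1_reg[OF A]] holomorphic_gcoef[OF _ _ h(3)]])
       (use x in \<open>auto intro!: holomorphic_intros h\<close>)
qed (use coupling_gcoef_bound[OF x A h neg] in auto)

section \<open>Integral formulas\<close>

text \<open>The M-test makes the convergence uniform, so integration term by term is elementary. The
  price is continuity of the terms up to both endpoints, which is why the integral formulas below
  are stated with exponents bounded away from the singular range.\<close>

lemma has_integral_suminf:
  fixes f :: "nat \<Rightarrow> real \<Rightarrow> complex"
  assumes cont: "\<And>n. continuous_on {0..1} (f n)"
    and int: "\<And>n. (f n has_integral I n) {0..1}"
    and bound: "\<And>n s. s \<in> {0..1} \<Longrightarrow> norm (f n s) \<le> M n" and M: "summable M"
    and g: "\<And>s. s \<in> {0..1} \<Longrightarrow> (\<lambda>n. f n s) sums g s"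
  shows "(g has_integral suminf I) {0..1}" "summable I"
proof -
  have 1: "uniform_limit {0..1} (\<lambda>n s. \<Sum>i<n. f i s) (\<lambda>s. \<Sum>i. f i s) sequentially"
    using bound M by (intro Weierstrass_m_test) auto
  have 2: "continuous_on {0..1} (\<lambda>s. \<Sum>i<n. f i s)" for n
    by (intro continuous_on_sum cont)
  obtain K J where K: "\<And>n. ((\<lambda>s. \<Sum>i<n. f i s) has_integral K n) {0..1}"
    and J: "((\<lambda>s. \<Sum>i. f i s) has_integral J) {0..1}" "K \<longlonglongrightarrow> J"
    by (rule uniform_limit_integral[OF 1 2 sequentially_bot]) (rule that; assumption)
  have "((\<lambda>s. \<Sum>i<n. f i s) has_integral (\<Sum>i<n. I i)) {0..1}" for n
    by (intro has_integral_sum int) auto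
  then have "K n = (\<Sum>i<n. I i)" for n using K has_integral_unique by blast
  then have "K = (\<lambda>n. \<Sum>i<n. I i)" by blast
  then have "I sums J" using J by (simp add: sums_def)
  moreover have "(g has_integral J) {0..1}"
    using J(1) by (rule has_integral_eq[rotated]) (use g in \<open>auto simp: sums_iff\<close>)
  ultimately show "(g has_integral suminf I) {0..1}" "summable I" by (auto simp: sums_iff)
qed

lemma
  fixes e :: real
  assumes "e > 0"
  shows continuous_on_powr_unit: "continuous_on {0..1} (\<lambda>t. t powr e)"
    and continuous_on_powr_unit_reflected: "continuous_on {0..1} (\<lambda>t. (1 - t) powr e)"
  using assms by (auto intro!: continuous_on_powr' continuous_on_diff continuous_on_id continuous_on_const)

lemma has_integral_reflect_unit:
  fixes f :: "real \<Rightarrow> 'a::banach"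
  assumes "(f has_integral I) {0..1}"
  shows "((\<lambda>s. f (1 - s)) has_integral I) {0..1}"
  using has_integral_affinity[of f I 0 1 "-1" 1] assms by simp



text \<open>The strict lower bounds on \<open>p\<close> and \<open>q\<close> make the integrand continuous on the closed interval.\<close>
lemma Euler_integral:
  fixes p q r a :: real
  assumes p: "p > 1" and q: "q > 1" and r: "0 \<le> r" "r < 1"
  shows "((\<lambda>t. of_real (t powr (p - 1) * (1 - t) powr (q - 1) * (1 - r * t) powr (- a))) has_integral
     Gamma (of_real p) * Gamma (of_real q) * hyp2F1_reg (of_real a) (of_real p) (of_real (p + q)) (of_real r)) {0..1}"
proof -
  define co where "co k = (- a gchoose k) * (- r) ^ k" for k
  have co: "co k = pochhammer a k / fact k * r ^ k" for k
  proof -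
    have "(- 1) ^ k * (- r) ^ k = r ^ k" by (simp flip: power_mult_distrib)
    then show ?thesis by (simp add: co_def gbinomial_pochhammer)
  qed
  define f where "f k t = complex_of_real (co k * (t powr (p + real k - 1) * (1 - t) powr (q - 1)))" for k t
  define I where "I k = complex_of_real (co k * Beta (p + real k) q)" for k
  have cont: "continuous_on {0..1} (f k)" for k
    unfolding f_def using p q
    by (intro continuous_on_of_real continuous_on_mult continuous_on_const
        continuous_on_powr_unit continuous_on_powr_unit_reflected) auto
  have int: "(f k has_integral I k) {0..1}" for k
    unfolding f_def I_def
    by (intro has_integral_of_real has_integral_mult_right has_integral_Beta_real) (use p q in auto)
  have bound: "norm (f k t) \<le> \<bar>co k\<bar>" if "t \<in> {0..1}" for k t
  proof -
    have "t powr (p + real k - 1) \<le> 1" "(1 - t) powr (q - 1) \<le> 1"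
      using that p q by (auto intro!: powr_le1)
    then have "t powr (p + real k - 1) * (1 - t) powr (q - 1) \<le> 1" by (intro mult_le_one) auto
    then have "\<bar>co k\<bar> * (t powr (p + real k - 1) * (1 - t) powr (q - 1)) \<le> \<bar>co k\<bar> * 1"
      by (intro mult_left_mono) auto
    then show ?thesis unfolding f_def norm_of_real by (simp add: abs_mult)
  qed
  \<comment> \<open>The binomial series is the regularized series with b = c = 1, where
    (1)_k/\<Gamma>(1+k) = 1.\<close>
  have sum: "summable (\<lambda>k. \<bar>co k\<bar>)"
  proof -
    have "pochhammer 1 k * rGamma (1 + of_nat k) = (1 :: complex)" for k
      using pochhammer_rGamma[of "1 :: complex" k] by simp
    then have "norm (pochhammer (of_real a) k * pochhammer 1 k * rGamma (1 + of_nat k) / fact k * (of_real r) ^ k :: complex)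
       = norm (complex_of_real (co k))" for k
      by (simp add: co mult.assoc pochhammer_of_real)
    then show ?thesis
      using summable_hyp2F1_reg[of "of_real r" "of_real a" 1 1] r by simp
  qed
  have sums: "(\<lambda>k. f k t) sums of_real (t powr (p - 1) * (1 - t) powr (q - 1) * (1 - r * t) powr (- a))"
    if "t \<in> {0..1}" for t
  proof -
    have "r * t \<le> r * 1" using that r by (intro mult_left_mono) auto
    then have "\<bar>- (r * t)\<bar> < 1" using r that by (simp add: abs_mult)
    from gen_binomial_real[OF this, of "- a"]
    have "(\<lambda>k. (- a gchoose k) * (- (r * t)) ^ k) sums (1 - r * t) powr (- a)" by simp
    then have "(\<lambda>k. complex_of_real (t powr (p - 1) * (1 - t) powr (q - 1) * ((- a gchoose k) * (- (r * t)) ^ k))) sums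
      of_real (t powr (p - 1) * (1 - t) powr (q - 1) * (1 - r * t) powr (- a))"
      unfolding sums_of_real_iff by (rule sums_mult)
    moreover have "t powr (p - 1) * (1 - t) powr (q - 1) * ((- a gchoose k) * (- (r * t)) ^ k) =
        co k * (t powr (p + real k - 1) * (1 - t) powr (q - 1))" for k
    proof -
      have "t powr (p + real k - 1) = t powr (p - 1) * t ^ k"
      proof (cases "t = 0")
        case False
        then have "t > 0" using that by simp
        have "p + real k - 1 = (p - 1) + real k" by simp
        then show ?thesis using \<open>t > 0\<close> by (simp only: powr_add powr_realpow)
      qed auto
      then show ?thesis
        by (simp add: co_def power_mult_distrib power_minus[of "r * t"] power_minus[of r])
    qed
    ultimately show ?thesis unfolding f_def by simp
  qed
  have "suminf I = Gamma (of_real p) * Gamma (of_real q) *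
      hyp2F1_reg (of_real a) (of_real p) (of_real (p + q)) (of_real r)"
  proof -
    define h where "h k = pochhammer (complex_of_real a) k * pochhammer (of_real p) k *
        rGamma (of_real (p + q) + of_nat k) / fact k * (of_real r) ^ k" for k
    have "I k = Gamma (of_real p) * Gamma (of_real q) * h k" for k
    proof -
      have np: "complex_of_real p \<notin> \<int>\<^sub>\<le>\<^sub>0" using p by (auto elim!: nonpos_Ints_cases simp: complex_eq_iff)
      have G: "Gamma (complex_of_real p + of_nat k) = pochhammer (of_real p) k * Gamma (of_real p)"
        using pochhammer_Gamma[OF np, of k] np by (simp add: Gamma_eq_zero_iff)
      have "complex_of_real (Beta (p + real k) q) = Gamma (complex_of_real p + of_nat k) *
          Gamma (of_real q) * rGamma (of_real (p + q) + of_nat k)"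
        using p q
        by (simp add: Beta_def rGamma_inverse_Gamma Gamma_complex_of_real[symmetric] add_ac divide_inverse)
      then show ?thesis unfolding I_def h_def co G
        by (simp add: pochhammer_of_real)
    qed
    then have "I = (\<lambda>k. Gamma (of_real p) * Gamma (of_real q) * h k)" by blast
    moreover have "summable (\<lambda>k. norm (h k))"
      unfolding h_def using r by (intro summable_hyp2F1_reg) auto
    then have "summable h" by (rule summable_norm_cancel)
    ultimately show ?thesis
      by (simp only: suminf_mult) (simp only: hyp2F1_reg_def h_def)
  qed
  then show ?thesis
    using has_integral_suminf(1)[OF cont int bound sum sums] by simp
qed

text \<open>Written with 1/\<Gamma>, Legendre's formula has no exceptional points: if z or z + 1/2
  is a pole of \<Gamma>, then so is 2z, and both sides vanish.\<close>

lemma rGamma_duplication: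
  fixes z :: complex
  shows "rGamma (2 * z) = 2 powr (1 - 2 * z) * of_real (sqrt pi) * rGamma z * rGamma (z + 1 / 2)"
proof (cases "z \<in> \<int>\<^sub>\<le>\<^sub>0 \<or> z + 1 / 2 \<in> \<int>\<^sub>\<le>\<^sub>0")
  case True
  then have "2 * z \<in> \<int>\<^sub>\<le>\<^sub>0"
  proof
    assume "z \<in> \<int>\<^sub>\<le>\<^sub>0"
    then obtain n where "z = - of_nat n" by (auto elim: nonpos_Ints_cases')
    then have "2 * z = - of_nat (2 * n)" by simp
    then show ?thesis by (metis minus_of_nat_in_nonpos_Ints)
  next
    assume "z + 1 / 2 \<in> \<int>\<^sub>\<le>\<^sub>0"
    then obtain n where "z + 1 / 2 = - of_nat n" by (auto elim: nonpos_Ints_cases')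
    moreover have "2 * z = 2 * (z + 1 / 2) - 1" by simp
    ultimately have "2 * z = - of_nat (2 * n + 1)" by simp
    then show ?thesis by (metis minus_of_nat_in_nonpos_Ints)
  qed
  moreover have "rGamma z * rGamma (z + 1 / 2) = 0"
    using True by (auto simp: rGamma_eq_zero_iff)
  ultimately show ?thesis using rGamma_eq_zero_iff[of "2 * z"] by (simp add: mult.assoc)
next
  case False
  define k where "k = 2 powr (1 - 2 * z) * complex_of_real (sqrt pi)"
  have k: "k \<noteq> 0" by (simp add: k_def)
  have "Gamma z * Gamma (z + 1 / 2) = k * Gamma (2 * z)"
    using Gamma_legendre_duplication[of z] False Ln_of_real[of 2] by (simp add: powr_def k_def)
  then have "inverse k * rGamma (2 * z) = rGamma z * rGamma (z + 1 / 2)"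
    unfolding rGamma_inverse_Gamma inverse_mult_distrib[symmetric] by (simp only:)
  then have "rGamma (2 * z) = k * (rGamma z * rGamma (z + 1 / 2))"
    using k by (simp add: field_simps)
  then show ?thesis by (simp add: k_def mult.assoc)
qed

section \<open>The transformations of Euler and Pfaff\<close>

text \<open>The Euler operator z d/dz. It is diagonal on coefficients and so turns differential
  equations into term recurrences.\<close>

definition fps_theta :: "complex fps \<Rightarrow> complex fps" where
  "fps_theta F = fps_X * fps_deriv F"

lemma fps_theta_nth: "fps_nth (fps_theta F) n = of_nat n * fps_nth F n"
  by (cases n) (simp_all add: fps_theta_def)

lemma fps_theta_mult: "fps_theta (F * G) = fps_theta F * G + F * fps_theta G"
  by (simp add: fps_theta_def algebra_simps)

lemma fps_theta_add: "fps_theta (F + G) = fps_theta F + fps_theta G"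
  by (simp add: fps_theta_def algebra_simps)

lemma fps_theta_const_mult: "fps_theta (fps_const k * F) = fps_const k * fps_theta F"
  by (simp add: fps_theta_def algebra_simps)

text \<open>Gauss's equation in the form \<theta>(\<theta> + c - 1)F = z(\<theta> + a)(\<theta> +
  b)F with the Euler operator \<theta>, multiplied out.\<close>

definition hypergeo_fps_eq :: "complex \<Rightarrow> complex \<Rightarrow> complex \<Rightarrow> complex fps \<Rightarrow> bool" where
  "hypergeo_fps_eq a b c F \<longleftrightarrow>
     fps_theta (fps_theta F) + fps_const (c - 1) * fps_theta F =
     fps_X * (fps_theta (fps_theta F) + fps_const (a + b) * fps_theta F + fps_const (a * b) * F)"

lemma hypergeo_fps_eq_iff:
  "hypergeo_fps_eq a b c F \<longleftrightarrow>
     (\<forall>n. of_nat (Suc n) * (c + of_nat n) * fps_nth F (Suc n) = (a + of_nat n) * (b + of_nat n) * fps_nth F n)"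
proof -
  define L where "L = fps_theta (fps_theta F) + fps_const (c - 1) * fps_theta F"
  define H where "H = fps_theta (fps_theta F) + fps_const (a + b) * fps_theta F + fps_const (a * b) * F"
  have "hypergeo_fps_eq a b c F \<longleftrightarrow> (\<forall>n. fps_nth L n = fps_nth (fps_X * H) n)"
    by (simp add: hypergeo_fps_eq_def fps_eq_iff L_def H_def)
  also have "\<dots> \<longleftrightarrow> (\<forall>n. fps_nth L (Suc n) = fps_nth H n)"
  proof safe
    fix n assume "\<forall>n. fps_nth L n = fps_nth (fps_X * H) n"
    from this[rule_format, of "Suc n"] show "fps_nth L (Suc n) = fps_nth H n" by simp
  next
    fix n assume "\<forall>n. fps_nth L (Suc n) = fps_nth H n"
    then show "fps_nth L n = fps_nth (fps_X * H) n"
      by (cases n) (simp_all add: L_def fps_theta_nth)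
  qed
  moreover have "fps_nth L (Suc n) = of_nat (Suc n) * (c + of_nat n) * fps_nth F (Suc n)" for n
    by (simp add: L_def fps_theta_nth) (simp add: algebra_simps)
  moreover have "fps_nth H n = (a + of_nat n) * (b + of_nat n) * fps_nth F n" for n
    by (simp add: H_def fps_theta_nth) (simp add: algebra_simps)
  ultimately show ?thesis by simp
qed

lemma hypergeo_fps_unique:
  assumes "hypergeo_fps_eq a b c F" "hypergeo_fps_eq a b c G" "fps_nth F 0 = fps_nth G 0" "c \<notin> \<int>\<^sub>\<le>\<^sub>0"
  shows "F = G"
proof (rule fps_ext)
  fix n show "fps_nth F n = fps_nth G n"
  proof (induction n)
    case (Suc n)
    have "c + of_nat n \<noteq> 0"
      using assms(4) by (metis add_eq_0_iff2 minus_of_nat_in_nonpos_Ints)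
    moreover have "of_nat (Suc n) * (c + of_nat n) * fps_nth F (Suc n) = of_nat (Suc n) * (c + of_nat n) * fps_nth G (Suc n)"
      using assms(1,2) Suc unfolding hypergeo_fps_eq_iff by metis
    ultimately show ?case by (simp del: of_nat_Suc)
  qed (use assms in auto)
qed

text \<open>The binomial series of (1 - z)^(-a); the exponent is -a.\<close>

definition fps_one_minus_powr :: "complex \<Rightarrow> complex fps" where
  "fps_one_minus_powr a = Abs_fps (\<lambda>n. pochhammer a n / fact n)"

lemma fps_one_minus_powr_theta:
  "(1 - fps_X) * fps_theta (fps_one_minus_powr a) = fps_const a * fps_X * fps_one_minus_powr a"
proof (rule fps_ext)
  fix n
  have rec: "(1 + of_nat m) * fps_nth (fps_one_minus_powr a) (Suc m) =
      (a + of_nat m) * fps_nth (fps_one_minus_powr a) m" for m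
    using of_nat_neq_0[of m, where 'a = complex] by (simp add: fps_one_minus_powr_def pochhammer_Suc)
  show "fps_nth ((1 - fps_X) * fps_theta (fps_one_minus_powr a)) n =
     fps_nth (fps_const a * fps_X * fps_one_minus_powr a) n"
    by (cases n) (simp_all add: fps_theta_nth left_diff_distrib mult.assoc rec, simp add: algebra_simps)
qed

lemma fps_one_minus_powr_sums:
  assumes "norm z < 1"
  shows "(\<lambda>n. fps_nth (fps_one_minus_powr a) n * z ^ n) sums ((1 - z) powr (- a))"
proof -
  have "(- a gchoose n) * (- z) ^ n = fps_nth (fps_one_minus_powr a) n * z ^ n" for n
    by (simp add: gbinomial_pochhammer fps_one_minus_powr_def power_minus[of z])
  then show ?thesis using gen_binomial_complex[of "- z" "- a"] assms by simp
qed

text \<open>The factor B = (1 - X)^(c-a-b) is known only through its first-order equation. That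
  equation and its image under the Euler operator express the derivatives of B through B, after
  which the claim is polynomial algebra.\<close>

lemma hypergeo_fps_Euler:
  assumes F: "hypergeo_fps_eq (c - a) (c - b) c F"
  shows "hypergeo_fps_eq a b c (fps_one_minus_powr (a + b - c) * F)"
proof -
  define X where "X = (fps_X :: complex fps)"
  define B where "B = fps_one_minus_powr (a + b - c)"
  define B1 where "B1 = fps_theta B"
  define B2 where "B2 = fps_theta B1"
  define F1 where "F1 = fps_theta F"
  define F2 where "F2 = fps_theta F1"
  define A where "A = fps_const a"
  define A' where "A' = fps_const b"
  define C where "C = fps_const c"
  have C1: "C - 1 = fps_const (c - 1)" by (metis C_def fps_const_1_eq_1 fps_const_sub)
  have e1: "F2 + (C - 1) * F1 = X * (F2 + (2 * C - A - A') * F1 + (C - A) * (C - A') * F)"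
    using F unfolding hypergeo_fps_eq_def F1_def F2_def X_def A_def A'_def C_def
    by (simp add: fps_numeral_fps_const flip: fps_const_1_eq_1)
  have e2: "(1 - X) * B1 = (A + A' - C) * X * B"
    using fps_one_minus_powr_theta[of "a + b - c"] unfolding X_def B1_def B_def A_def A'_def C_def by simp
  have "fps_theta ((1 - X) * B1) = fps_theta (fps_const (a + b - c) * (X * B))"
    using e2 by (simp add: A_def A'_def C_def mult.assoc)
  then have e3: "(1 - X) * B2 - X * B1 = (A + A' - C) * (X * B + X * B1)"
    unfolding fps_theta_const_mult fps_theta_mult
    by (simp add: X_def B2_def B1_def A_def A'_def C_def fps_theta_def left_diff_distrib)
  define G1 where "G1 = B1 * F + B * F1"
  define G2 where "G2 = B2 * F + 2 * B1 * F1 + B * F2"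
  \<comment> \<open>The extra factor 1 - X clears the denominators of B1 and B2; it cancels because
    formal power series form an integral domain.\<close>
  have "(1 - X) * (G2 + (C - 1) * G1 - X * (G2 + (A + A') * G1 + A * A' * (B * F))) = 0"
    using e1 e2 e3 unfolding G1_def G2_def by algebra
  moreover have "1 - X \<noteq> 0" by (simp add: X_def)
  ultimately have "G2 + (C - 1) * G1 = X * (G2 + (A + A') * G1 + A * A' * (B * F))"
    by simp
  moreover have "fps_theta (B * F) = G1" "fps_theta G1 = G2"
    unfolding G1_def G2_def by (simp_all add: fps_theta_mult fps_theta_add B1_def B2_def F1_def F2_def algebra_simps)
  ultimately show ?thesis
    unfolding hypergeo_fps_eq_def B_def[symmetric] X_def[symmetric]
    unfolding A_def A'_def C1 by simp
qed

text \<open>For Y = -X/(1-X) one has (1 - X) X Y' = Y, so composition with Y turns the Euler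
  operator into (1 - X) times itself. The rest is elimination as for Euler's transformation, now
  with a factor (1 - X)^2 to cancel.\<close>

lemma hypergeo_fps_Pfaff:
  assumes F: "hypergeo_fps_eq a (c - b) c F"
  defines "Y \<equiv> - fps_X * inverse (1 - fps_X)"
  shows "hypergeo_fps_eq a b c (fps_one_minus_powr a * fps_compose F Y)"
proof -
  define X where "X = (fps_X :: complex fps)"
  define B where "B = fps_one_minus_powr a"
  define B1 where "B1 = fps_theta B"
  define B2 where "B2 = fps_theta B1"
  define K0 where "K0 = fps_compose F Y"
  define K1 where "K1 = fps_compose (fps_theta F) Y"
  define K2 where "K2 = fps_compose (fps_theta (fps_theta F)) Y"
  define A where "A = fps_const a"
  define A' where "A' = fps_const b"
  define C where "C = fps_const c"
  have C1: "C - 1 = fps_const (c - 1)" by (metis C_def fps_const_1_eq_1 fps_const_sub)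
  have X1: "1 - X \<noteq> 0" by (simp add: X_def)
  have Y0: "fps_nth Y 0 = 0" by (simp add: Y_def)
  have Y: "(1 - X) * Y = - X"
    unfolding Y_def X_def by (simp add: inverse_mult_eq_1' mult.left_commute)
  have "fps_deriv ((1 - X) * Y) = - 1" unfolding Y by (simp add: X_def)
  then have Y': "(1 - X) * fps_deriv Y - Y = - 1" by (simp add: X_def algebra_simps)
  have "(1 - X) * ((1 - X) * (X * fps_deriv Y)) = (1 - X) * Y"
    using Y Y' by algebra
  then have XY': "(1 - X) * (X * fps_deriv Y) = Y" using X1 by simp
  have theta: "(1 - X) * fps_theta (fps_compose H Y) = fps_compose (fps_theta H) Y" for H
  proof -
    have "(1 - X) * fps_theta (fps_compose H Y) = ((1 - X) * (X * fps_deriv Y)) * fps_compose (fps_deriv H) Y"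
      by (simp add: fps_theta_def fps_compose_deriv[OF Y0] X_def mult_ac)
    also have "\<dots> = fps_compose (fps_theta H) Y"
      unfolding XY' fps_theta_def by (simp add: fps_compose_mult_distrib[OF Y0] Y0)
    finally show ?thesis .
  qed
  have k: "(1 - X) * fps_theta K0 = K1" "(1 - X) * fps_theta K1 = K2"
    unfolding K0_def K1_def K2_def by (rule theta)+
  have "fps_compose (fps_theta (fps_theta F) + fps_const (c - 1) * fps_theta F) Y =
     fps_compose (fps_X * (fps_theta (fps_theta F) + fps_const (a + (c - b)) * fps_theta F + fps_const (a * (c - b)) * F)) Y"
    using F unfolding hypergeo_fps_eq_def by (rule arg_cong)
  then have "K2 + (C - 1) * K1 = Y * (K2 + (A + (C - A')) * K1 + A * (C - A') * K0)"
    by (simp add: K0_def K1_def K2_def A_def A'_def C_def Y0 fps_compose_add_distrib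
        fps_compose_mult_distrib[OF Y0] fps_const_compose flip: fps_const_1_eq_1)
  then have e1: "(1 - X) * (K2 + (C - 1) * K1) = - X * (K2 + (A + (C - A')) * K1 + A * (C - A') * K0)"
    using Y by algebra
  have e2: "(1 - X) * B1 = A * X * B"
    using fps_one_minus_powr_theta[of a] unfolding X_def B1_def B_def A_def by simp
  have "fps_theta ((1 - X) * B1) = fps_theta (fps_const a * (X * B))"
    using e2 by (simp add: A_def mult.assoc)
  then have e3: "(1 - X) * B2 - X * B1 = A * (X * B + X * B1)"
    unfolding fps_theta_const_mult fps_theta_mult
    by (simp add: X_def B2_def B1_def A_def fps_theta_def left_diff_distrib)
  define L1 where "L1 = fps_theta K0"
  define L2 where "L2 = fps_theta L1"
  have l1: "(1 - X) * L1 = K1" using k by (simp add: L1_def)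
  have "fps_theta ((1 - X) * L1) = fps_theta K1" using l1 by simp
  then have "(1 - X) * L2 - X * L1 = fps_theta K1"
    unfolding fps_theta_mult by (simp add: X_def L2_def fps_theta_def left_diff_distrib)
  then have l2: "(1 - X) * ((1 - X) * L2 - X * L1) = K2" using k by simp
  define G1 where "G1 = B1 * K0 + B * L1"
  define G2 where "G2 = B2 * K0 + 2 * B1 * L1 + B * L2"
  have "(1 - X) * (1 - X) * (G2 + (C - 1) * G1 - X * (G2 + (A + A') * G1 + A * A' * (B * K0))) = 0"
    using e1 e2 e3 l1 l2 unfolding G1_def G2_def by algebra
  then have "G2 + (C - 1) * G1 = X * (G2 + (A + A') * G1 + A * A' * (B * K0))"
    using X1 by simp
  moreover have "fps_theta (B * K0) = G1" "fps_theta G1 = G2"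
    unfolding G1_def G2_def by (simp_all add: fps_theta_mult fps_theta_add B1_def B2_def L1_def L2_def algebra_simps)
  ultimately show ?thesis
    unfolding hypergeo_fps_eq_def B_def[symmetric] X_def[symmetric] K0_def[symmetric]
    unfolding A_def A'_def C1 by simp
qed


text \<open>Uniqueness of power series solutions gives this for c outside the nonpositive integers;
  at those the recurrence no longer determines all coefficients. Since each side is a finite
  expression entire in c, continuity settles the remaining values.\<close>

lemma hyp2F1_reg_Euler_coeff:
  fixes a b c :: complex
  shows "pochhammer a n * pochhammer b n * rGamma (c + of_nat n) / fact n =
    (\<Sum>i\<le>n. pochhammer (a + b - c) i / fact i *
       (pochhammer (c - a) (n - i) * pochhammer (c - b) (n - i) * rGamma (c + of_nat (n - i)) / fact (n - i)))"
    (is "?L c = ?R c")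
proof -
  have main: "?L c = ?R c" if c: "c \<notin> \<int>\<^sub>\<le>\<^sub>0" for c
  proof -
    define F where "F a b = Abs_fps (\<lambda>k. pochhammer a k * pochhammer b k * rGamma (c + of_nat k) / fact k)" for a b
    have F: "hypergeo_fps_eq a b c (F a b)" for a b
      unfolding hypergeo_fps_eq_iff
    proof
      fix k
      have "rGamma (c + of_nat k) = (c + of_nat k) * rGamma (c + of_nat (Suc k))"
        using rGamma_plus1[of "c + of_nat k"] by (simp add: add_ac)
      then show "of_nat (Suc k) * (c + of_nat k) * fps_nth (F a b) (Suc k) =
          (a + of_nat k) * (b + of_nat k) * fps_nth (F a b) k"
        using of_nat_neq_0[of k, where 'a = complex] by (simp add: F_def pochhammer_Suc)
    qed
    have "F a b = fps_one_minus_powr (a + b - c) * F (c - a) (c - b)"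
      by (rule hypergeo_fps_unique[OF F hypergeo_fps_Euler[OF F] _ c])
         (simp add: F_def fps_one_minus_powr_def)
    then have "fps_nth (F a b) n = fps_nth (fps_one_minus_powr (a + b - c) * F (c - a) (c - b)) n"
      by simp
    then show ?thesis
      by (simp add: F_def fps_one_minus_powr_def fps_mult_nth atLeast0AtMost)
  qed
  show ?thesis
  proof (cases "c \<in> \<int>\<^sub>\<le>\<^sub>0")
    case True
    have hol: "?L holomorphic_on UNIV" "?R holomorphic_on UNIV"
      by (intro holomorphic_intros holomorphic_pochhammer; simp)+
    have "isCont ?L c"
      using holomorphic_on_imp_continuous_on[OF hol(1)]
      unfolding continuous_on_eq_continuous_at[OF open_UNIV] by blast
    moreover have "isCont ?R c"
      using holomorphic_on_imp_continuous_on[OF hol(2)]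
      unfolding continuous_on_eq_continuous_at[OF open_UNIV] by blast
    ultimately have lim: "(?L \<longlongrightarrow> ?L c) (at c)" "(?R \<longlongrightarrow> ?R c) (at c)" by (simp_all only: isCont_def)
    \<comment> \<open>The exceptional values are integers, so the punctured unit disc around one of
      them contains no other.\<close>
    have "\<forall>\<^sub>F u in at c. ?L u = ?R u"
      unfolding eventually_at
    proof (intro exI[of _ 1] conjI ballI impI)
      fix u assume u: "u \<noteq> c \<and> dist u c < 1"
      have "u \<notin> \<int>\<^sub>\<le>\<^sub>0"
      proof
        assume "u \<in> \<int>\<^sub>\<le>\<^sub>0"
        then obtain i j where ij: "u = of_int i" "c = of_int j"
          using True by (auto elim!: nonpos_Ints_cases)
        then have "norm (of_int (i - j) :: complex) < 1" using u by (simp add: dist_norm)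
        then have "real_of_int \<bar>i - j\<bar> < 1" unfolding norm_of_int by simp
        then have "i = j" by linarith
        then show False using u ij by simp
      qed
      then show "?L u = ?R u" by (rule main)
    qed simp
    with lim(1) have "(?R \<longlongrightarrow> ?L c) (at c)" by (rule Lim_transform_eventually)
    from LIM_unique[OF this lim(2)] show ?thesis .
  qed (rule main)
qed

text \<open>The coefficient identity summed up: the right side is the Cauchy product of two
  absolutely convergent series. No condition on c is needed, which matters because the Ferrers
  function is entire in its upper index.\<close>

lemma hyp2F1_reg_Euler:
  assumes "norm z < 1"
  shows "hyp2F1_reg a b c z = (1 - z) powr (c - a - b) * hyp2F1_reg (c - a) (c - b) c z"
proof -
  define p where "p i = pochhammer (a + b - c) i / fact i * z ^ i" for i
  define h where "h a b i = pochhammer a i * pochhammer b i * rGamma (c + of_nat i) / fact i * z ^ i" for a b i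
  have "summable (\<lambda>i. norm (pochhammer (a + b - c) i * pochhammer 1 i * rGamma (1 + of_nat i) / fact i * z ^ i))"
    by (rule summable_hyp2F1_reg) (rule assms)
  moreover have "pochhammer 1 i * rGamma (1 + of_nat i) = (1 :: complex)" for i
    using pochhammer_rGamma[of "1 :: complex" i] by simp
  ultimately have p: "summable (\<lambda>i. norm (p i))" by (simp add: p_def mult.assoc)
  have h: "summable (\<lambda>i. norm (h (c - a) (c - b) i))"
    unfolding h_def by (rule summable_hyp2F1_reg) (rule assms)
  have "h a b n = (\<Sum>i\<le>n. p i * h (c - a) (c - b) (n - i))" for n
  proof -
    have "z ^ i * z ^ (n - i) = z ^ n" if "i \<le> n" for i
      using that by (simp flip: power_add)
    moreover have "p i * h (c - a) (c - b) (n - i) = pochhammer (a + b - c) i / fact i *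
       (pochhammer (c - a) (n - i) * pochhammer (c - b) (n - i) * rGamma (c + of_nat (n - i)) / fact (n - i)) *
       (z ^ i * z ^ (n - i))" for i
      by (simp only: p_def h_def mult_ac)
    ultimately have "(\<Sum>i\<le>n. p i * h (c - a) (c - b) (n - i)) = (\<Sum>i\<le>n. pochhammer (a + b - c) i / fact i *
       (pochhammer (c - a) (n - i) * pochhammer (c - b) (n - i) * rGamma (c + of_nat (n - i)) / fact (n - i)) * z ^ n)"
      by (intro sum.cong refl) simp
    then show ?thesis
      unfolding h_def[of a b] hyp2F1_reg_Euler_coeff[of a n b c] sum_distrib_right by simp
  qed
  then have "suminf (h a b) = (\<Sum>n. \<Sum>i\<le>n. p i * h (c - a) (c - b) (n - i))"
    by (intro arg_cong[where f = suminf] ext)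
  moreover have "(\<Sum>n. \<Sum>i\<le>n. p i * h (c - a) (c - b) (n - i)) = suminf p * suminf (h (c - a) (c - b))"
    by (rule Cauchy_product[symmetric]) (rule p h)+
  moreover have "p sums ((1 - z) powr (- (a + b - c)))"
    using fps_one_minus_powr_sums[OF assms, of "a + b - c"]
    by (simp only: fps_one_minus_powr_def p_def[abs_def] fps_nth_Abs_fps)
  then have "suminf p = (1 - z) powr (c - a - b)" by (simp add: sums_iff algebra_simps)
  ultimately show ?thesis by (simp add: hyp2F1_reg_def h_def[abs_def])
qed

section \<open>Pfaff's transformation at the boundary point -1\<close>

lemma hyp2F1_series_fps:
  fixes a b c :: complex
  assumes "c \<notin> \<int>\<^sub>\<le>\<^sub>0"
  defines "F \<equiv> Abs_fps (\<lambda>k. pochhammer a k * pochhammer b k / (pochhammer c k * fact k))"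
  shows "hypergeo_fps_eq a b c F" "hyp2F1_series a b c has_fps_expansion F"
    "hyp2F1_series a b c holomorphic_on ball 0 1"
proof -
  have "c + of_nat k \<noteq> 0" for k
    using assms(1) by (metis add_eq_0_iff2 minus_of_nat_in_nonpos_Ints)
  then show "hypergeo_fps_eq a b c F"
    unfolding hypergeo_fps_eq_iff F_def
    using of_nat_neq_0[where 'a = complex] by (simp add: pochhammer_Suc)
  have sums: "(\<lambda>k. fps_nth F k * z ^ k) sums hyp2F1_series a b c z" if "norm z < 1" for z
    using summable_hyp2F1_series[OF that assms(1), of a b] by (simp add: F_def hyp2F1_series_def summable_sums)
  have "\<forall>\<^sub>F z in nhds (0::complex). norm z < 1"
    using eventually_nhds_in_open[of "ball (0::complex) 1" 0] by simp
  then show "hyp2F1_series a b c has_fps_expansion F"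
    by (intro has_fps_expansionI) (use sums in \<open>auto elim!: eventually_mono\<close>)
  show "hyp2F1_series a b c holomorphic_on ball 0 1"
    by (rule power_series_holomorphic[where a = "fps_nth F"]) (use sums in auto)
qed

text \<open>The half-plane Re w < 1/2 consists of the points nearer to 0 than to 1, which is |w| <
  |1 - w|.\<close>

lemma norm_Moebius_less_1:
  assumes "Re w < 1 / 2"
  shows "norm (- w * inverse (1 - w)) < 1"
proof -
  have "(norm w)\<^sup>2 < (norm (1 - w))\<^sup>2"
    unfolding cmod_power2 using assms by (simp add: power2_eq_square algebra_simps)
  then have "norm w < norm (1 - w)" by (rule power_less_imp_less_base) simp
  moreover from this have "norm (1 - w) > 0" using norm_ge_zero[of w] by linarith
  ultimately have "norm w / norm (1 - w) < 1" by simp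
  then show ?thesis by (simp add: norm_mult norm_inverse divide_inverse)
qed

text \<open>The point -1 lies on the boundary of the disc of convergence, so a holomorphic extension
  has to be exhibited. The right side of Pfaff's transformation supplies one on Re w < 1/2, a set
  star-shaped about 0 that contains -1; there -w/(1-w) takes the value 1/2 at w = -1.\<close>

lemma hyp2F1_Pfaff:
  assumes c: "c \<notin> \<int>\<^sub>\<le>\<^sub>0"
  shows "hyp2F1 a b c (- 1) = 2 powr (- a) * hyp2F1 a (c - b) c (1 / 2)"
proof -
  define f where "f w = (1 - w) powr (- a) * hyp2F1_series a (c - b) c (- w * inverse (1 - w))" for w
  define S where "S = {w. Re w < 1 / 2}"
  have S: "open S" "convex S" unfolding S_def by (rule open_halfspace_Re_lt convex_halfspace_Re_lt)+
  have S0: "0 \<in> S" "- 1 \<in> S" by (auto simp: S_def)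
  have f_hol: "f holomorphic_on S"
  proof -
    have "(\<lambda>w. - w * inverse (1 - w)) holomorphic_on S"
      by (intro holomorphic_intros) (auto simp: S_def)
    moreover have "(\<lambda>w. - w * inverse (1 - w)) ` S \<subseteq> ball 0 1"
      using norm_Moebius_less_1 by (auto simp: S_def)
    ultimately have "(\<lambda>w. hyp2F1_series a (c - b) c (- w * inverse (1 - w))) holomorphic_on S"
      using holomorphic_on_compose_gen[OF _ hyp2F1_series_fps(3)[OF c, of a "c - b"]]
      by (simp add: o_def)
    moreover have "(\<lambda>w. (1 - w) powr (- a)) holomorphic_on S"
      by (intro holomorphic_intros) (auto simp: S_def complex_nonpos_Reals_iff)
    ultimately show ?thesis unfolding f_def by (rule holomorphic_on_mult[rotated])
  qed
  define F where "F b = Abs_fps (\<lambda>k. pochhammer a k * pochhammer b k / (pochhammer c k * fact k))" for b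
  define Y where "Y = - fps_X * inverse (1 - fps_X :: complex fps)"
  have ev: "\<forall>\<^sub>F z in nhds (0::complex). norm z < 1"
    using eventually_nhds_in_open[of "ball (0::complex) 1" 0] by simp
  have B: "(\<lambda>w. (1 - w) powr (- a)) has_fps_expansion fps_one_minus_powr a"
    by (intro has_fps_expansionI) (use ev fps_one_minus_powr_sums in \<open>auto elim!: eventually_mono\<close>)
  have Y: "(\<lambda>w. - w * inverse (1 - w)) has_fps_expansion Y"
    unfolding Y_def by (intro fps_expansion_intros) simp
  have "(hyp2F1_series a (c - b) c \<circ> (\<lambda>w. - w * inverse (1 - w))) has_fps_expansion fps_compose (F (c - b)) Y"
    unfolding F_def using Y by (intro has_fps_expansion_compose hyp2F1_series_fps c) (simp_all add: Y_def)
  then have "(\<lambda>w. hyp2F1_series a (c - b) c (- w * inverse (1 - w))) has_fps_expansion fps_compose (F (c - b)) Y"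
    by (simp add: o_def)
  from has_fps_expansion_mult[OF B this]
  have "f has_fps_expansion fps_one_minus_powr a * fps_compose (F (c - b)) Y"
    unfolding f_def .
  also have "fps_one_minus_powr a * fps_compose (F (c - b)) Y = F b"
  proof (rule hypergeo_fps_unique[OF _ _ _ c])
    show "hypergeo_fps_eq a b c (fps_one_minus_powr a * fps_compose (F (c - b)) Y)"
      unfolding Y_def F_def by (rule hypergeo_fps_Pfaff hyp2F1_series_fps c)+
    show "hypergeo_fps_eq a b c (F b)" unfolding F_def by (rule hyp2F1_series_fps c)+
  qed (simp add: fps_one_minus_powr_def F_def)
  finally have "\<forall>\<^sub>F w in nhds 0. eval_fps (F b) w = f w"
    by (simp add: has_fps_expansion_def)
  moreover have "\<forall>\<^sub>F w in nhds 0. eval_fps (F b) w = hyp2F1_series a b c w"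
    using hyp2F1_series_fps(2)[OF c, of a b] by (simp add: has_fps_expansion_def F_def)
  ultimately have "\<forall>\<^sub>F w in nhds 0. f w = hyp2F1_series a b c w" by eventually_elim simp
  then obtain T where T: "open T" "0 \<in> T" "\<And>w. w \<in> T \<Longrightarrow> f w = hyp2F1_series a b c w"
    by (auto simp: eventually_nhds)
  \<comment> \<open>Equality of the formal series yields agreement only near 0; the identity theorem
    on the convex set S \<inter> ball 0 1 extends it to the range that the definition of
    \<open>hyp2F1\<close> asks for.\<close>
  have eq: "f w = hyp2F1_series a b c w" if w: "w \<in> S" "norm w < 1" for w
  proof -
    let ?U = "S \<inter> ball 0 1"
    have "f w - hyp2F1_series a b c w = 0"
    proof (rule analytic_continuation[where f = "\<lambda>w. f w - hyp2F1_series a b c w"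
          and S = ?U and U = "?U \<inter> T" and \<xi> = 0])
      show "(\<lambda>w. f w - hyp2F1_series a b c w) holomorphic_on ?U"
        using f_hol hyp2F1_series_fps(3)[OF c, of a b]
        by (intro holomorphic_on_diff) (auto elim: holomorphic_on_subset)
      show "connected ?U" using S by (intro convex_connected convex_Int) auto
      show "0 islimpt ?U \<inter> T"
        using S S0 T by (intro interior_limit_point) (auto simp: interior_open open_Int)
    qed (use S S0 T w in auto)
    then show ?thesis by simp
  qed
  have "hyp2F1 a b c (- 1) = f (- 1)"
  proof (rule hyp2F1_eqI[OF S(1) S0(1) _ S0(2) f_hol eq])
    fix w assume "w \<in> S"
    then show "closed_segment 0 w \<subseteq> S" using S S0 by (intro closed_segment_subset)
  qed
  also have "f (- 1) = 2 powr (- a) * hyp2F1 a (c - b) c (1 / 2)"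
    using hyp2F1_eq_series[OF _ c, of "1 / 2"] by (simp add: f_def)
  finally show ?thesis .
qed

section \<open>Bailey's theorem\<close>

text \<open>After t = 1 - s the Euler integrand is 2^(1-b) s^(q-1) (1 - s^2)^(b-1): the choice a = 1
  - b lets (1 - s) and (1 + s) combine. Then y = s^2 gives a beta integral, and the duplication
  formula for \<Gamma>(q) brings the result into the stated form. The bound q > 2 keeps y^(q/2-1)
  continuous at 0.\<close>

lemma hyp2F1_reg_Bailey_real:
  fixes b q :: real
  assumes b: "b > 1" and q: "q > 2"
  shows "hyp2F1_reg (1 - of_real b) (of_real b) (of_real b + of_real q) (1 / 2) =
     2 powr (1 - of_real b - of_real q) * of_real (sqrt pi) *
     rGamma (of_real q / 2 + of_real b) * rGamma ((of_real q + 1) / 2)"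
proof -
  define J where "J = complex_of_real (2 powr (1 - b) * (Beta (q / 2) b / 2))"
  have "((\<lambda>t. of_real (t powr (b - 1) * (1 - t) powr (q - 1) * (1 - 1 / 2 * t) powr (- (1 - b)))) has_integral
     Gamma (of_real b) * Gamma (of_real q) * hyp2F1_reg (of_real (1 - b)) (of_real b) (of_real (b + q)) (of_real (1 / 2))) {0..1}"
    by (rule Euler_integral) (use b q in auto)
  from has_integral_reflect_unit[OF this]
  have 1: "((\<lambda>s. complex_of_real ((1 - s) powr (b - 1) * (1 - (1 - s)) powr (q - 1) * (1 - 1 / 2 * (1 - s)) powr (- (1 - b)))) has_integral
     Gamma (of_real b) * Gamma (of_real q) * hyp2F1_reg (1 - of_real b) (of_real b) (of_real b + of_real q) (1 / 2)) {0..1}"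
    by simp
  define F where "F y = y powr (q / 2 - 1) * (1 - y) powr (b - 1) / 2" for y
  have cont: "continuous_on {0..1} F"
    unfolding F_def using b q
    by (intro continuous_on_divide continuous_on_mult continuous_on_const
        continuous_on_powr_unit continuous_on_powr_unit_reflected) auto
  have "(F has_integral Beta (q / 2) b / 2) {0..1}"
    unfolding F_def by (intro has_integral_divide has_integral_Beta_real) (use b q in auto)
  then have "integral {0..1} F = Beta (q / 2) b / 2" by (rule integral_unique)
  moreover have "((\<lambda>s. (2 * s) *\<^sub>R F (s ^ 2)) has_integral integral {0 ^ 2..1 ^ 2} F) {0..1::real}"
    by (rule has_integral_substitution[where c = 0 and d = 1])
       (auto intro!: cont derivative_eq_intros simp: power_le_one)
  ultimately have "((\<lambda>s. (2 * s) * F (s ^ 2)) has_integral Beta (q / 2) b / 2) {0..1::real}"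
    unfolding real_scaleR_def power_zero_numeral power_one by (simp only:)
  then have "((\<lambda>s. 2 powr (1 - b) * ((2 * s) * F (s ^ 2))) has_integral 2 powr (1 - b) * (Beta (q / 2) b / 2)) {0..1::real}"
    by (rule has_integral_mult_right)
  then have K1: "((\<lambda>s. complex_of_real (2 powr (1 - b) * ((2 * s) * F (s ^ 2)))) has_integral J) {0..1::real}"
    unfolding J_def by (rule has_integral_of_real)
  have K2: "2 powr (1 - b) * ((2 * s) * F (s ^ 2)) =
      (1 - s) powr (b - 1) * (1 - (1 - s)) powr (q - 1) * (1 - 1 / 2 * (1 - s)) powr (- (1 - b))"
    if s: "s \<in> {0..1}" for s
  proof (cases "s = 0")
    case False
    then have s: "s > 0" "s \<le> 1" using s by auto
    have "(s\<^sup>2) powr (q / 2 - 1) = s powr (q - 2)"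
      using s powr_powr[of s 2 "q / 2 - 1"] by (simp add: algebra_simps)
    moreover have "s * s powr (q - 2) = s powr (q - 1)"
      using s powr_mult_base[of s "q - 2"] by simp
    moreover have "(1 - s\<^sup>2) powr (b - 1) = (1 - s) powr (b - 1) * (1 + s) powr (b - 1)"
    proof -
      have "1 - s\<^sup>2 = (1 - s) * (1 + s)" by (simp add: power2_eq_square algebra_simps)
      then show ?thesis using s by (simp add: powr_mult)
    qed
    moreover have "(1 - 1 / 2 * (1 - s)) powr (- (1 - b)) = (1 + s) powr (b - 1) * 2 powr (1 - b)"
    proof -
      have "1 - 1 / 2 * (1 - s) = (1 + s) * (1 / 2)" by (simp add: field_simps)
      then have "(1 - 1 / 2 * (1 - s)) powr (b - 1) = (1 + s) powr (b - 1) * (1 / 2) powr (b - 1)"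
        using s powr_mult[of "1 + s" "1 / 2" "b - 1"] by (simp only:)
      also have "(1 / 2 :: real) powr (b - 1) = 2 powr (1 - b)"
        by (simp add: powr_divide powr_minus_divide[symmetric])
      finally show ?thesis by simp
    qed
    ultimately show ?thesis by (simp add: F_def mult_ac)
  qed (use q in auto)
  have "((\<lambda>s. complex_of_real ((1 - s) powr (b - 1) * (1 - (1 - s)) powr (q - 1) * (1 - 1 / 2 * (1 - s)) powr (- (1 - b)))) has_integral J) {0..1}"
    by (rule has_integral_eq[OF _ K1]) (simp only: K2)
  with 1 have "Gamma (of_real b) * Gamma (of_real q) * hyp2F1_reg (1 - of_real b) (of_real b) (of_real b + of_real q) (1 / 2) = J"
    by (rule has_integral_unique)
  also have "J = 2 powr (1 - of_real b) / 2 * Gamma (of_real q / 2) * Gamma (of_real b) * rGamma (of_real q / 2 + of_real b)"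
  proof -
    have "complex_of_real (Beta (q / 2) b) =
        Gamma (of_real (q / 2)) * Gamma (of_real b) * rGamma (of_real (q / 2 + b))"
      by (simp only: Beta_altdef Gamma_complex_of_real rGamma_complex_of_real of_real_mult)
    moreover have "complex_of_real (2 powr (1 - b)) = 2 powr (1 - of_real b)"
      using powr_of_real[of 2 "1 - b"] by simp
    ultimately show ?thesis by (simp add: J_def)
  qed
  finally have E: "Gamma (of_real b) * (Gamma (of_real q) * hyp2F1_reg (1 - of_real b) (of_real b) (of_real b + of_real q) (1 / 2)) =
     Gamma (of_real b) * (2 powr (1 - of_real b) / 2 * Gamma (of_real q / 2) * rGamma (of_real q / 2 + of_real b))"
    by (simp add: mult_ac)
  have np: "complex_of_real p \<notin> \<int>\<^sub>\<le>\<^sub>0" if "p > 0" for p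
    using that by (auto elim!: nonpos_Ints_cases simp: complex_eq_iff)
  have nz: "Gamma (complex_of_real p) \<noteq> 0" if "p > 0" for p
    using np[OF that] by (simp add: Gamma_eq_zero_iff)
  define H where "H = hyp2F1_reg (1 - of_real b) (of_real b) (of_real b + of_real q) (1 / 2)"
  have "Gamma (of_real q) * H = 2 powr (1 - of_real b) / 2 * Gamma (of_real q / 2) * rGamma (of_real q / 2 + of_real b)"
  proof -
    have "Gamma (complex_of_real b) \<noteq> 0" using nz[of b] b by simp
    from mult_left_cancel[OF this] E show ?thesis unfolding H_def by (simp only:)
  qed
  then have "rGamma (of_real q) * (Gamma (of_real q) * H) =
     rGamma (complex_of_real q) * (2 powr (1 - of_real b) / 2 * Gamma (of_real q / 2) * rGamma (of_real q / 2 + of_real b))"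
    by (simp only:)
  also have "rGamma (of_real q) * (Gamma (of_real q) * H) = H"
    using nz[of q] q by (simp add: rGamma_inverse_Gamma)
  also have "rGamma (complex_of_real q) = 2 powr (1 - of_real q) * of_real (sqrt pi) * rGamma (of_real q / 2) * rGamma ((of_real q + 1) / 2)"
    using rGamma_duplication[of "of_real q / 2"] by (simp add: add_divide_distrib)
  finally have "H = (2 powr (1 - of_real q) * (2 powr (1 - of_real b) / 2)) * of_real (sqrt pi) *
      rGamma (of_real q / 2 + of_real b) * rGamma ((of_real q + 1) / 2) *
      (rGamma (of_real q / 2) * Gamma (of_real q / 2))"
    by (simp only: mult_ac)
  also have "rGamma (complex_of_real q / 2) * Gamma (of_real q / 2) = 1"
    using nz[of "q / 2"] q by (simp add: rGamma_inverse_Gamma)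
  also have "2 powr (1 - of_real q) * (2 powr (1 - of_real b) / 2) = 2 powr (1 - of_real b - complex_of_real q)"
    by (simp add: powr_diff)
  finally show ?thesis unfolding H_def by simp
qed

text \<open>The integral evaluations hold for real parameters only, so the set of known zeros is a
  real segment, accumulating at its midpoint. Convexity of S supplies the connectedness.\<close>

lemma eq_zero_from_real_interval:
  fixes f :: "complex \<Rightarrow> complex" and l u :: real
  assumes f: "f holomorphic_on S" and S: "open S" "convex S" and lu: "l < u"
    and r: "\<And>r. l < r \<Longrightarrow> r < u \<Longrightarrow> complex_of_real r \<in> S \<and> f (of_real r) = 0"
    and w: "w \<in> S"
  shows "f w = 0"
proof (rule analytic_continuation[OF f S(1) convex_connected[OF S(2)], where U = "complex_of_real ` {l<..<u}"])
  define m where "m = (l + u) / 2"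
  have m: "l < m" "m < u" using lu by (auto simp: m_def)
  show "complex_of_real m \<in> S" using r m by blast
  show "complex_of_real m islimpt complex_of_real ` {l<..<u}"
    unfolding islimpt_approachable
  proof safe
    fix e :: real assume e: "e > 0"
    define r where "r = min ((m + u) / 2) (m + e / 2)"
    have "m < r" "r < u" "r < m + e" using m e by (auto simp: r_def min_less_iff_disj)
    then show "\<exists>x'\<in>complex_of_real ` {l<..<u}. x' \<noteq> of_real m \<and> dist x' (of_real m) < e"
      using m by (intro bexI[of _ "of_real r"]) (auto simp: dist_of_real dist_real_def)
  qed
qed (use r w in auto)

lemma hyp2F1_reg_Bailey:
  fixes b q :: complex
  shows "hyp2F1_reg (1 - b) b (b + q) (1 / 2) =
     2 powr (1 - b - q) * of_real (sqrt pi) * rGamma (q / 2 + b) * rGamma ((q + 1) / 2)"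
proof -
  define D where "D b q = hyp2F1_reg (1 - b) b (b + q) (1 / 2) -
     2 powr (1 - b - q) * of_real (sqrt pi) * rGamma (q / 2 + b) * rGamma ((q + 1) / 2)" for b q
  have hol: "(\<lambda>t. D (f t) (g t)) holomorphic_on UNIV" if "f holomorphic_on UNIV" "g holomorphic_on UNIV" for f g
    unfolding D_def by (intro holomorphic_intros holomorphic_hyp2F1_reg that open_UNIV) auto
  have D0: "D (of_real b) (of_real q) = 0" if "b > 1" "q > 2" for b q
    using hyp2F1_reg_Bailey_real[OF that] by (simp add: D_def)
  \<comment> \<open>Continuation proceeds in one variable at a time: q while b is still real, then b
    for arbitrary q.\<close>
  have D1: "D (of_real b) q = 0" if b: "b > 1" for b :: real and q
    by (rule eq_zero_from_real_interval[where l = 2 and u = 3 and S = UNIV])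
       (use b D0 hol[OF holomorphic_on_const holomorphic_on_ident] in auto)
  have "D b q = 0"
    by (rule eq_zero_from_real_interval[where f = "\<lambda>b. D b q" and l = 1 and u = 2 and S = UNIV])
       (use D1 hol[OF holomorphic_on_ident holomorphic_on_const] in auto)
  then show ?thesis by (simp add: D_def)
qed

section \<open>The general expansion\<close>

text \<open>For Re \<tau> < 0 the exponent Re \<tau> - 1 is below -1. The generating series then has
  a summable majorant on all of [0,1], including s = 1; this is the reason for \<tau> < 0 in the
  real case.\<close>

lemma summable_norm_gcoef:
  assumes x: "-1 < x" "x < 1" and \<tau>: "Re \<tau> < 0"
  shows "summable (\<lambda>n. norm (gcoef \<tau> x n))"
proof -
  obtain C N where C: "C \<ge> 0" "N \<ge> 1"
    "\<And>\<sigma> n. norm \<sigma> \<le> norm \<tau> \<Longrightarrow> n \<ge> N \<Longrightarrow> norm (gcoef \<sigma> x n) \<le> C * real n powr (Re \<sigma> - 1)"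
    by (rule gcoef_growth[OF norm_ge_zero[of \<tau>] x]) (rule that; assumption)
  show ?thesis
  proof (rule summable_comparison_test[OF exI[of _ N]])
    show "summable (\<lambda>n. C * real n powr (Re \<tau> - 1))"
      using \<tau> by (intro summable_mult) (simp add: summable_real_powr_iff)
  qed (use C(3)[of \<tau>] in auto)
qed

text \<open>
  The substitution \<open>y = 4s/(1+s)\<^sup>2\<close> turns \<open>s\<^sup>2 + 2xs + 1\<close> into \<open>(1+s)\<^sup>2(1 - yz)\<close> with \<open>z = (1-x)/2\<close>,
  so one integral is expanded once by the generating function in powers of \<open>s\<close> and once by the
  binomial series in powers of \<open>z\<close>.
\<close>
lemma hyp2F1_reg_gegenbauer_real:
  fixes \<alpha> \<beta> \<tau> x :: real
  assumes x: "-1 < x" "x < 1" and \<alpha>: "\<alpha> > 1" and \<beta>: "\<beta> > 1" and \<tau>: "\<tau> < 0"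
  shows "hyp2F1_reg (of_real \<tau>) (of_real \<alpha>) (of_real \<alpha> + of_real \<beta>) (of_real ((1 - x) / 2)) *
           rGamma (of_real \<beta> + 1 / 2) =
         4 powr (of_real \<tau>) / of_real (sqrt pi) *
           (\<Sum>n. coupling (of_real \<alpha>) (of_real \<beta>) (of_real \<tau>) n * gcoef (of_real \<tau>) x n)"
proof -
  \<comment> \<open>The power of 1/(1 + s) left by the substitution: 3 from v', 2(\<alpha>-1) from
    v, 2(\<beta>-1) from 1 - v, and -2\<tau> from 1 - zv.\<close>
  define a where "a = 2 * \<alpha> + 2 * \<beta> - 2 * \<tau> - 1"
  define z where "z = (1 - x) / 2"
  have z: "0 < z" "z < 1" using x by (auto simp: z_def)
  define w where "w s = s powr (\<alpha> - 1) * (1 - s) powr (2 * \<beta> - 1) * (1 + s) powr (- a)" for s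
  define u where "u s = s\<^sup>2 + 2 * s * x + 1" for s
  define h where "h s = complex_of_real (w s * u s powr (- \<tau>))" for s
  define \<alpha>' where "\<alpha>' = complex_of_real \<alpha>"
  define \<beta>' where "\<beta>' = complex_of_real \<beta>"
  define \<tau>' where "\<tau>' = complex_of_real \<tau>"
  have nz: "Gamma (complex_of_real p) \<noteq> 0" if "p > 0" for p
  proof -
    have "complex_of_real p \<notin> \<int>\<^sub>\<le>\<^sub>0"
      using that by (auto elim!: nonpos_Ints_cases simp: complex_eq_iff)
    then show ?thesis by (simp add: Gamma_eq_zero_iff)
  qed
  have u_pos: "u s > 0" if "s \<ge> 0" for s
  proof -
    have "u s = (s + x)\<^sup>2 + (1 - x\<^sup>2)" by (simp add: u_def power2_eq_square algebra_simps)
    moreover have "x\<^sup>2 < 1" using x by (simp add: abs_square_less_1)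
    ultimately show ?thesis using zero_le_power2[of "s + x"] by linarith
  qed
  have w_cont: "continuous_on {0..1} w"
    unfolding w_def using \<alpha> \<beta>
    by (intro continuous_on_mult continuous_on_powr_unit continuous_on_powr_unit_reflected
        continuous_on_powr continuous_on_add continuous_on_const continuous_on_id) auto
  then have "bounded (w ` {0..1})" by (intro compact_imp_bounded compact_continuous_image) auto
  then obtain W where W: "\<And>s. s \<in> {0..1} \<Longrightarrow> \<bar>w s\<bar> \<le> W"
    unfolding bounded_iff by (metis imageI real_norm_def)

  define g where "g n s = complex_of_real (w s) * (gcoef \<tau>' x n * of_real s ^ n)" for n s
  define moment where "moment n = 2 powr (- of_real a) * Gamma \<alpha>' * Gamma (2 * \<beta>') * coupling \<alpha>' \<beta>' \<tau>' n" for n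
  have moment: "((\<lambda>s. complex_of_real (w s) * of_real s ^ n) has_integral moment n) {0..1}" for n
  proof -
    \<comment> \<open>Euler's integral at argument 1/2, to be reflected by t = 1 - s: then 1 - t/2 =
      (1 + s)/2, which produces the weight (1 + s)^(-a) together with the factor 2^(-a).\<close>
    have "((\<lambda>t. of_real (t powr (2 * \<beta> - 1) * (1 - t) powr (\<alpha> + real n - 1) * (1 - 1 / 2 * t) powr (- a))) has_integral
       Gamma (of_real (2 * \<beta>)) * Gamma (of_real (\<alpha> + real n)) *
       hyp2F1_reg (of_real a) (of_real (2 * \<beta>)) (of_real (2 * \<beta> + (\<alpha> + real n))) (of_real (1 / 2))) {0..1}"
      by (rule Euler_integral) (use \<alpha> \<beta> in auto)
    from has_integral_mult_right[OF has_integral_reflect_unit[OF this], of "of_real (2 powr (- a))"]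
    have 1: "((\<lambda>s. of_real (2 powr (- a)) * complex_of_real ((1 - s) powr (2 * \<beta> - 1) * (1 - (1 - s)) powr (\<alpha> + real n - 1) * (1 - 1 / 2 * (1 - s)) powr (- a))) has_integral
       of_real (2 powr (- a)) * (Gamma (of_real (2 * \<beta>)) * Gamma (of_real (\<alpha> + real n)) *
       hyp2F1_reg (of_real a) (of_real (2 * \<beta>)) (of_real (2 * \<beta> + (\<alpha> + real n))) (of_real (1 / 2)))) {0..1}" .
    have 2: "of_real (2 powr (- a)) * complex_of_real ((1 - s) powr (2 * \<beta> - 1) * (1 - (1 - s)) powr (\<alpha> + real n - 1) * (1 - 1 / 2 * (1 - s)) powr (- a)) =
       complex_of_real (w s) * of_real s ^ n" if s: "s \<in> {0..1}" for s
    proof -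
      have "s powr (\<alpha> + real n - 1) = s powr (\<alpha> - 1) * s ^ n"
      proof (cases "s = 0")
        case False
        then have "s > 0" using s by simp
        have "\<alpha> + real n - 1 = (\<alpha> - 1) + real n" by simp
        then show ?thesis using \<open>s > 0\<close> by (simp only: powr_add powr_realpow)
      qed (use \<alpha> in auto)
      moreover have "2 powr (- a) * (1 - 1 / 2 * (1 - s)) powr (- a) = (1 + s) powr (- a)"
      proof -
        have "1 - 1 / 2 * (1 - s) \<ge> 0" "1 + s = 2 * (1 - 1 / 2 * (1 - s))" using s by (auto simp: field_simps)
        then show ?thesis by (metis powr_mult zero_le_numeral)
      qed
      ultimately have "2 powr (- a) * ((1 - s) powr (2 * \<beta> - 1) * (1 - (1 - s)) powr (\<alpha> + real n - 1) * (1 - 1 / 2 * (1 - s)) powr (- a)) = w s * s ^ n"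
        unfolding w_def by (simp add: mult_ac)
      from arg_cong[OF this, of complex_of_real] show ?thesis by (simp only: of_real_mult of_real_power)
    qed
    have 3: "of_real (2 powr (- a)) * (Gamma (of_real (2 * \<beta>)) * Gamma (of_real (\<alpha> + real n)) *
       hyp2F1_reg (of_real a) (of_real (2 * \<beta>)) (of_real (2 * \<beta> + (\<alpha> + real n))) (of_real (1 / 2))) = moment n"
    proof -
      have "\<alpha>' \<notin> \<int>\<^sub>\<le>\<^sub>0" using nz[of \<alpha>] \<alpha> by (simp add: \<alpha>'_def Gamma_eq_zero_iff)
      from pochhammer_Gamma[OF this, of n]
      have "Gamma (complex_of_real (\<alpha> + real n)) = Gamma \<alpha>' * pochhammer \<alpha>' n"
        using nz[of \<alpha>] \<alpha> by (simp add: \<alpha>'_def)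
      moreover have "complex_of_real (2 powr (- a)) = 2 powr (- of_real a)"
        using powr_of_real[of 2 "- a"] by simp
      moreover have "complex_of_real (2 * \<beta> + (\<alpha> + real n)) = of_nat n + \<alpha>' + 2 * \<beta>'"
        "complex_of_real a = 2 * \<alpha>' + 2 * \<beta>' - 2 * \<tau>' - 1" "complex_of_real (2 * \<beta>) = 2 * \<beta>'"
        by (simp_all add: a_def \<alpha>'_def \<beta>'_def \<tau>'_def)
      ultimately show ?thesis by (simp add: moment_def coupling_def add_ac)
    qed
    show ?thesis using has_integral_eq[OF 2 1] unfolding 3 .
  qed
  have A: "(h has_integral (\<Sum>n. moment n * gcoef \<tau>' x n)) {0..1}"
  proof (rule has_integral_suminf(1)[where f = g and M = "\<lambda>n. W * norm (gcoef \<tau>' x n)"])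
    show "continuous_on {0..1} (g n)" for n
      unfolding g_def
      by (intro continuous_on_mult continuous_on_of_real w_cont continuous_on_power continuous_on_const continuous_on_id)
    show "(g n has_integral moment n * gcoef \<tau>' x n) {0..1}" for n
      using has_integral_mult_left[OF moment[of n], of "gcoef \<tau>' x n"] by (simp add: g_def[abs_def] mult_ac)
    show "norm (g n s) \<le> W * norm (gcoef \<tau>' x n)" if s: "s \<in> {0..1}" for n s
    proof -
      have "norm (g n s) = \<bar>w s\<bar> * (norm (gcoef \<tau>' x n) * s ^ n)"
        using s by (simp add: g_def norm_mult norm_power)
      also have "\<dots> \<le> W * (norm (gcoef \<tau>' x n) * 1)"
        using s W[OF s] by (intro mult_mono mult_left_mono power_le_one) (auto intro: order_trans[OF abs_ge_zero])
      finally show ?thesis by simp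
    qed
    show "summable (\<lambda>n. W * norm (gcoef \<tau>' x n))"
      using x \<tau> by (intro summable_mult summable_norm_gcoef) (simp_all add: \<tau>'_def)
    show "(\<lambda>n. g n s) sums h s" if s: "s \<in> {0..1}" for s
    proof (cases "s = 1")
      \<comment> \<open>The generating function is available only for |s| < 1; at s = 1 the weight
        vanishes because 2\<beta> - 1 > 0.\<close>
      case True
      then show ?thesis using \<beta> by (simp add: g_def h_def w_def)
    next
      case False
      then have "norm (complex_of_real s) < 1" using s by simp
      from gcoef_sums[OF _ _ this, of x \<tau>'] x
      have "(\<lambda>n. gcoef \<tau>' x n * of_real s ^ n) sums
          (((of_real s)\<^sup>2 + 2 * of_real s * of_real x + 1) powr (- \<tau>'))" by simp
      also have "((of_real s)\<^sup>2 + 2 * of_real s * of_real x + 1) powr (- \<tau>') = complex_of_real (u s powr (- \<tau>))"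
        using powr_of_real[of "u s" "- \<tau>"] u_pos[of s] s by (simp add: u_def \<tau>'_def)
      finally show ?thesis unfolding g_def h_def of_real_mult by (rule sums_mult)
    qed
  qed

  define F where "F y = complex_of_real (y powr (\<alpha> - 1) * (1 - y) powr (\<beta> - 1) * (1 - z * y) powr (- \<tau>))" for y
  define I where "I = Gamma \<alpha>' * Gamma \<beta>' * hyp2F1_reg \<tau>' \<alpha>' (\<alpha>' + \<beta>') (of_real z)"
  have "(F has_integral I) {0..1}"
    using Euler_integral[OF \<alpha> \<beta>, of z \<tau>] z by (simp add: F_def[abs_def] I_def \<alpha>'_def \<beta>'_def \<tau>'_def)
  then have FI: "integral {0..1} F = I" by (rule integral_unique)
  have F_cont: "continuous_on {0..1} F"
  proof -
    have "1 - z * y \<noteq> 0" if "y \<in> {0..1}" for y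
    proof -
      have "z * y \<le> z * 1" using that z by (intro mult_left_mono) auto
      then have "z * y < 1" using z by linarith
      then show ?thesis by simp
    qed
    then show ?thesis
      unfolding F_def using \<alpha> \<beta>
      by (intro continuous_on_of_real continuous_on_mult continuous_on_powr_unit continuous_on_powr_unit_reflected
        continuous_on_powr continuous_on_diff continuous_on_const continuous_on_id) auto
  qed
  define v where "v s = 4 * s / (1 + s)\<^sup>2" for s :: real
  define v' where "v' s = 4 * (1 - s) / (1 + s) ^ 3" for s :: real
  have v_range: "v s \<in> {0..1}" "1 - v s = ((1 - s) / (1 + s))\<^sup>2" if "s \<in> {0..1}" for s
  proof -
    have "1 + s \<noteq> 0" using that by auto
    then show *: "1 - v s = ((1 - s) / (1 + s))\<^sup>2"
      by (simp add: v_def power_divide diff_divide_eq_iff) (simp add: power2_eq_square algebra_simps)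
    have "1 - v s \<ge> 0" unfolding * by simp
    then show "v s \<in> {0..1}" using that by (simp add: v_def)
  qed
  have "((\<lambda>s. v' s *\<^sub>R F (v s)) has_integral integral {v 0..v 1} F) {0..1}"
  proof (rule has_integral_substitution[where c = 0 and d = 1])
    show "v ` {0..1} \<subseteq> {0..1}" using v_range by blast
    fix s :: real assume s: "s \<in> {0..1}"
    then have s1: "1 + s \<noteq> 0" by auto
    have "(v has_field_derivative (4 * (1 + s)\<^sup>2 - 4 * s * (2 * (1 + s))) / ((1 + s)\<^sup>2 * (1 + s)\<^sup>2)) (at s within {0..1})"
      unfolding v_def using s1 by (auto intro!: derivative_eq_intros)
    also have "4 * (1 + s)\<^sup>2 - 4 * s * (2 * (1 + s)) = 4 * (1 - s) * (1 + s)"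
      by (simp add: power2_eq_square algebra_simps)
    also have "4 * (1 - s) * (1 + s) / ((1 + s)\<^sup>2 * (1 + s)\<^sup>2) = v' s"
      using s1 by (simp add: v'_def power2_eq_square power3_eq_cube)
    finally show "(v has_field_derivative v' s) (at s within {0..1})" .
  qed (use F_cont in \<open>auto simp: v_def\<close>)
  then have B: "((\<lambda>s. v' s *\<^sub>R F (v s)) has_integral I) {0..1}"
    by (simp add: v_def FI)
  have pointwise: "v' s * ((v s) powr (\<alpha> - 1) * (1 - v s) powr (\<beta> - 1) * (1 - z * v s) powr (- \<tau>)) =
      4 powr \<alpha> * (w s * u s powr (- \<tau>))" if s: "s \<in> {0..1}" for s
  proof (cases "s = 0 \<or> s = 1")
    case True
    then show ?thesis using \<alpha> \<beta> by (auto simp: v_def v'_def w_def)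
  next
    case False
    then have s: "0 < s" "s < 1" "s \<in> {0..1}" using s by auto
    define A where "A = ln s"
    define B where "B = ln (1 - s)"
    define C where "C = ln (1 + s)"
    define D where "D = ln (u s)"
    define L where "L = ln (4 :: real)"
    have us: "u s > 0" using u_pos s by simp
    have e: "s = exp A" "1 - s = exp B" "1 + s = exp C" "u s = exp D" "(4::real) = exp L"
      using s us by (auto simp: A_def B_def C_def D_def L_def)
    have v1: "v s = exp (L + A - 2 * C)"
      unfolding v_def using e by (simp add: exp_diff exp_add exp_double[symmetric] mult.commute)
    have v2: "1 - v s = exp (2 * B - 2 * C)"
      unfolding v_range(2)[OF s(3)] using e by (simp add: exp_diff exp_double power_divide)
    have v3: "1 - z * v s = exp (D - 2 * C)"
    proof -
      have "1 - z * v s = u s / (1 + s)\<^sup>2"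
        using s by (simp add: v_def u_def z_def diff_divide_eq_iff) (simp add: power2_eq_square algebra_simps)
      then show ?thesis using e by (simp add: exp_diff exp_double)
    qed
    have v4: "v' s = exp (L + B - 3 * C)"
    proof -
      have "v' s = exp L * exp B / exp C ^ 3" unfolding v'_def using e by simp
      also have "exp C ^ 3 = exp (3 * C)" using exp_of_nat_mult[of 3 C] by simp
      finally show ?thesis by (simp add: exp_diff exp_add)
    qed
    have p: "exp q powr r = exp (r * q)" for q r :: real by (simp add: powr_def)
    have "4 powr \<alpha> * (w s * u s powr (- \<tau>)) =
       exp L powr \<alpha> * (exp A powr (\<alpha> - 1) * exp B powr (2 * \<beta> - 1) * exp C powr (- a) * exp D powr (- \<tau>))"
      unfolding w_def using e by simp
    then show ?thesis
      unfolding v2 v3 unfolding v1 v4 p exp_add[symmetric] by (simp add: a_def algebra_simps)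
  qed
  have "((\<lambda>s. of_real (4 powr \<alpha>) * h s) has_integral I) {0..1}"
  proof (rule has_integral_eq[OF _ B])
    fix s :: real assume s: "s \<in> {0..1}"
    have "v' s *\<^sub>R F (v s) = complex_of_real (v' s * ((v s) powr (\<alpha> - 1) * (1 - v s) powr (\<beta> - 1) * (1 - z * v s) powr (- \<tau>)))"
      unfolding F_def scaleR_conv_of_real of_real_mult ..
    also have "\<dots> = of_real (4 powr \<alpha>) * h s" unfolding pointwise[OF s] h_def of_real_mult ..
    finally show "v' s *\<^sub>R F (v s) = of_real (4 powr \<alpha>) * h s" .
  qed
  from has_integral_unique[OF this has_integral_mult_right[OF A]]
  have I: "I = of_real (4 powr \<alpha>) * (\<Sum>n. moment n * gcoef \<tau>' x n)" .
  define S where "S = (\<Sum>n. coupling \<alpha>' \<beta>' \<tau>' n * gcoef \<tau>' x n)"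
  have "summable (\<lambda>n. coupling \<alpha>' \<beta>' \<tau>' n * gcoef \<tau>' x n)"
    using x \<beta> \<tau> by (intro summable_coupling_gcoef) (auto simp: \<beta>'_def \<tau>'_def)
  then have "(\<Sum>n. moment n * gcoef \<tau>' x n) = 2 powr (- of_real a) * Gamma \<alpha>' * Gamma (2 * \<beta>') * S"
    unfolding moment_def S_def mult.assoc[of _ "coupling _ _ _ _" "gcoef _ _ _"] by (rule suminf_mult)
  with I have "Gamma \<alpha>' * (Gamma \<beta>' * hyp2F1_reg \<tau>' \<alpha>' (\<alpha>' + \<beta>') (of_real z)) =
     Gamma \<alpha>' * (of_real (4 powr \<alpha>) * 2 powr (- of_real a) * Gamma (2 * \<beta>') * S)"
    unfolding I_def by (simp only: mult_ac)
  then have E: "Gamma \<beta>' * hyp2F1_reg \<tau>' \<alpha>' (\<alpha>' + \<beta>') (of_real z) =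
     of_real (4 powr \<alpha>) * 2 powr (- of_real a) * Gamma (2 * \<beta>') * S"
    using nz[of \<alpha>] \<alpha> by (simp add: \<alpha>'_def)
  have np: "Gamma \<beta>' * rGamma \<beta>' = 1" "Gamma (2 * \<beta>') * rGamma (2 * \<beta>') = 1"
    using nz[of \<beta>] nz[of "2 * \<beta>"] \<beta> by (auto simp: \<beta>'_def rGamma_inverse_Gamma)
  \<comment> \<open>The power 2^(1-2\<beta>) is the one in the duplication formula for
    \<Gamma>(2\<beta>). It cancels, and what remains of the constant is 4^\<tau>/sqrt pi, with
    1/\<Gamma>(\<beta> + 1/2) on the other side.\<close>
  have k: "of_real (4 powr \<alpha>) * 2 powr (- of_real a) = 4 powr \<tau>' * 2 powr (1 - 2 * \<beta>')"
  proof -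
    have "(4::real) powr \<alpha> * 2 powr (- a) = 4 powr \<tau> * 2 powr (1 - 2 * \<beta>)"
    proof -
      have four: "(4::real) powr e = 2 powr (2 * e)" for e
        using powr_powr[of "2::real" 2 e] by simp
      show ?thesis unfolding four powr_add[symmetric] by (simp add: a_def algebra_simps)
    qed
    from arg_cong[OF this, of complex_of_real] show ?thesis
      using powr_of_real[of 2 "- a"] powr_of_real[of 4 \<tau>] powr_of_real[of 2 "1 - 2 * \<beta>"]
      by (simp add: \<tau>'_def \<beta>'_def)
  qed
  define H where "H = hyp2F1_reg \<tau>' \<alpha>' (\<alpha>' + \<beta>') (of_real z)"
  have dup: "rGamma (2 * \<beta>') = 2 powr (1 - 2 * \<beta>') * of_real (sqrt pi) * rGamma \<beta>' * rGamma (\<beta>' + 1 / 2)"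
    by (rule rGamma_duplication)
  have sp: "complex_of_real (sqrt pi) \<noteq> 0" by simp
  have p2: "2 powr (1 - 2 * \<beta>') \<noteq> (0::complex)" by simp
  have "2 powr (1 - 2 * \<beta>') * of_real (sqrt pi) * (H * rGamma (\<beta>' + 1 / 2)) = 2 powr (1 - 2 * \<beta>') * (4 powr \<tau>' * S)"
    using E np dup unfolding k H_def[symmetric] by algebra
  then have "of_real (sqrt pi) * (H * rGamma (\<beta>' + 1 / 2)) = 4 powr \<tau>' * S"
    using p2 by (simp add: mult.assoc)
  then show ?thesis
    using sp unfolding H_def S_def z_def \<alpha>'_def \<beta>'_def \<tau>'_def by (simp add: field_simps)
qed

text \<open>The order of continuation follows the condition Re \<tau> < 2 Re \<beta>. For real
  \<beta> it is a half-plane in \<tau> that contains the interval (-1, 0); \<alpha> is unrestricted;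
  for fixed \<tau> it is a half-plane in \<beta>. Every domain is convex and contains a real
  interval on which the previous stage applies.\<close>

lemma hyp2F1_reg_gegenbauer:
  fixes \<alpha> \<beta> \<tau> :: complex and x :: real
  assumes x: "-1 < x" "x < 1" and neg: "Re (\<tau> - 2 * \<beta>) < 0"
  shows "hyp2F1_reg \<tau> \<alpha> (\<alpha> + \<beta>) (of_real ((1 - x) / 2)) * rGamma (\<beta> + 1 / 2) =
         4 powr \<tau> / of_real (sqrt pi) * (\<Sum>n. coupling \<alpha> \<beta> \<tau> n * gcoef \<tau> x n)"
proof -
  define D where "D \<alpha> \<beta> \<tau> = hyp2F1_reg \<tau> \<alpha> (\<alpha> + \<beta>) (of_real ((1 - x) / 2)) * rGamma (\<beta> + 1 / 2) -
         4 powr \<tau> / of_real (sqrt pi) * (\<Sum>n. coupling \<alpha> \<beta> \<tau> n * gcoef \<tau> x n)" for \<alpha> \<beta> \<tau>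
  have nz: "norm (complex_of_real ((1 - x) / 2)) < 1" using x unfolding norm_of_real by simp
  have hol: "(\<lambda>t. D (f t) (g t) (h t)) holomorphic_on A"
    if "open A" "f holomorphic_on A" "g holomorphic_on A" "h holomorphic_on A"
      "\<And>t. t \<in> A \<Longrightarrow> Re (h t - 2 * g t) < 0" for f g h A
    unfolding D_def
    by (rule holomorphic_on_diff[OF holomorphic_on_mult[OF holomorphic_hyp2F1_reg[OF that(1) that(4) that(2)
          holomorphic_on_add[OF that(2,3)] nz]]
          holomorphic_on_mult[OF _ holomorphic_coupling_sum[OF x that]]])
       (intro holomorphic_intros that; simp)+
  have D0: "D (of_real \<alpha>) (of_real \<beta>) (of_real \<tau>) = 0" if "\<alpha> > 1" "\<beta> > 1" "\<tau> < 0" for \<alpha> \<beta> \<tau>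
    using hyp2F1_reg_gegenbauer_real[OF x that] by (simp add: D_def)
  have D1: "D (of_real \<alpha>) (of_real \<beta>) \<tau> = 0"
    if ab: "\<alpha> > 1" "\<beta> > 1" and "Re \<tau> < 2 * \<beta>" for \<alpha> \<beta> :: real and \<tau>
  proof (rule eq_zero_from_real_interval[where f = "\<lambda>\<tau>. D (of_real \<alpha>) (of_real \<beta>) \<tau>"
        and S = "{\<tau>. Re \<tau> < 2 * \<beta>}" and l = "-1" and u = 0])
    show "(\<lambda>\<tau>. D (of_real \<alpha>) (of_real \<beta>) \<tau>) holomorphic_on {\<tau>. Re \<tau> < 2 * \<beta>}"
      by (rule hol) (auto intro: open_halfspace_Re_lt)
  qed (use that D0 in \<open>auto intro: open_halfspace_Re_lt convex_halfspace_Re_lt\<close>)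
  have D2: "D \<alpha> (of_real \<beta>) \<tau> = 0"
    if \<beta>: "\<beta> > 1" and \<tau>: "Re \<tau> < 2 * \<beta>" for \<alpha> \<tau> and \<beta> :: real
  proof (rule eq_zero_from_real_interval[where f = "\<lambda>\<alpha>. D \<alpha> (of_real \<beta>) \<tau>" and l = 1 and u = 2 and S = UNIV])
    show "(\<lambda>\<alpha>. D \<alpha> (of_real \<beta>) \<tau>) holomorphic_on UNIV"
      by (rule hol) (use \<tau> in auto)
  qed (use that D1 in auto)
  have "D \<alpha> \<beta> \<tau> = 0"
  \<comment> \<open>A real \<beta> must exceed 1 for the previous stage and Re \<tau>/2 to lie in
    the half-plane; hence the maximum as left end of the interval.\<close>
  proof (rule eq_zero_from_real_interval[where f = "\<lambda>\<beta>. D \<alpha> \<beta> \<tau>" and S = "{\<beta>. Re \<beta> > Re \<tau> / 2}"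
        and l = "max 1 (Re \<tau> / 2)" and u = "max 1 (Re \<tau> / 2) + 1"])
    show "(\<lambda>\<beta>. D \<alpha> \<beta> \<tau>) holomorphic_on {\<beta>. Re \<beta> > Re \<tau> / 2}"
      by (rule hol[OF open_halfspace_Re_gt]) auto
    show "complex_of_real r \<in> {\<beta>. Re \<beta> > Re \<tau> / 2} \<and> D \<alpha> (complex_of_real r) \<tau> = 0"
      if "max 1 (Re \<tau> / 2) < r" for r
      using that by (auto intro!: D2)
    show "open {\<beta>. Re \<beta> > Re \<tau> / 2}" "convex {\<beta>. Re \<beta> > Re \<tau> / 2}"
      by (rule open_halfspace_Re_gt convex_halfspace_Re_gt)+
  qed (use neg in auto)
  then show ?thesis by (simp add: D_def)
qed

section \<open>The Ferrers function\<close>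

text \<open>With q = n + w + 1 one has 1/\<Gamma>(w+1) = (w+1)_n/\<Gamma>(q), and duplication
  cancels \<Gamma>(q/2) against 1/\<Gamma>(q). What is left is entire in w, so the limiting value is
  found by evaluation.\<close>

lemma gamma_quot_eq:
  "gamma_quot n w = pochhammer (w + 1) n * 2 powr (- of_nat n - w) * of_real (sqrt pi) *
     rGamma ((of_nat n + w + 2) / 2)" (is "_ = ?E w")
proof -
  have main: "Gamma ((of_nat n + u + 1) / 2) * rGamma (u + 1) = ?E u"
    if u: "(of_nat n + u + 1) / 2 \<notin> \<int>\<^sub>\<le>\<^sub>0" for u
  proof -
    define q where "q = of_nat n + u + 1"
    have "Gamma (q / 2) * rGamma (q / 2) = 1"
      using u by (simp add: q_def rGamma_inverse_Gamma Gamma_eq_zero_iff)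
    moreover have "rGamma (u + 1) = pochhammer (u + 1) n * rGamma q"
      using pochhammer_rGamma[of "u + 1" n] by (simp add: q_def add_ac)
    moreover have "rGamma q = 2 powr (1 - q) * of_real (sqrt pi) * rGamma (q / 2) * rGamma (q / 2 + 1 / 2)"
      using rGamma_duplication[of "q / 2"] by simp
    moreover have "1 - q = - of_nat n - u" by (simp add: q_def)
    moreover have "q / 2 + 1 / 2 = (of_nat n + u + 2) / 2" by (simp add: q_def add_divide_distrib)
    ultimately have "Gamma (q / 2) * rGamma (u + 1) = ?E u" by algebra
    then show ?thesis by (simp add: q_def)
  qed
  show ?thesis
  proof (cases "(of_nat n + w + 1) / 2 \<in> \<int>\<^sub>\<le>\<^sub>0")
    case False
    then show ?thesis using main by (simp add: gamma_quot_def)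
  next
    case True
    then obtain j where "(of_nat n + w + 1) / 2 = - of_nat j" by (auto elim: nonpos_Ints_cases')
    moreover have "w + 1 = 2 * ((of_nat n + w + 1) / 2) - of_nat n" by (simp add: field_simps)
    ultimately have "w + 1 = - of_nat (2 * j + n)" by simp
    then have w: "w + 1 \<in> \<int>\<^sub>\<le>\<^sub>0" by (metis minus_of_nat_in_nonpos_Ints)
    have "?E holomorphic_on UNIV"
      by (intro holomorphic_intros holomorphic_pochhammer) auto
    from holomorphic_on_imp_continuous_on[OF this] have "isCont ?E w"
      unfolding continuous_on_eq_continuous_at[OF open_UNIV] by blast
    then have "(?E \<longlongrightarrow> ?E w) (at w)" by (simp only: isCont_def)
    moreover have "\<forall>\<^sub>F u in at w. ?E u = Gamma ((of_nat n + u + 1) / 2) / Gamma (u + 1)"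
      unfolding eventually_at
    \<comment> \<open>Poles of the numerator are 2 apart in u, so radius 1 isolates the one at
      w.\<close>
    proof (intro exI[of _ 1] conjI ballI impI)
      fix u assume u: "u \<noteq> w \<and> dist u w < 1"
      have "(of_nat n + u + 1) / 2 \<notin> \<int>\<^sub>\<le>\<^sub>0"
      proof
        assume "(of_nat n + u + 1) / 2 \<in> \<int>\<^sub>\<le>\<^sub>0"
        then obtain i where i: "(of_nat n + u + 1) / 2 = of_int i" by (auto elim: nonpos_Ints_cases)
        obtain k where k: "(of_nat n + w + 1) / 2 = of_int k" using True by (auto elim: nonpos_Ints_cases)
        have "u - w = 2 * ((of_nat n + u + 1) / 2) - 2 * ((of_nat n + w + 1) / 2)"
          by (simp add: field_simps)
        then have e: "u - w = of_int (2 * i - 2 * k)" unfolding i k by simp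
        then have "norm (of_int (2 * i - 2 * k) :: complex) < 1" using u by (simp add: dist_norm)
        then have "real_of_int \<bar>2 * i - 2 * k\<bar> < 1" unfolding norm_of_int by simp
        then have "2 * i - 2 * k = 0" by linarith
        then show False using u e by simp
      qed
      have "Gamma ((of_nat n + u + 1) / 2) / Gamma (u + 1) = Gamma ((of_nat n + u + 1) / 2) * rGamma (u + 1)"
        by (simp only: rGamma_inverse_Gamma divide_inverse)
      also have "\<dots> = ?E u" by (rule main) fact
      finally show "?E u = Gamma ((of_nat n + u + 1) / 2) / Gamma (u + 1)" ..
    qed simp
    ultimately have "((\<lambda>u. Gamma ((of_nat n + u + 1) / 2) / Gamma (u + 1)) \<longlongrightarrow> ?E w) (at w)"
      by (rule Lim_transform_eventually)
    then have "Lim (at w) (\<lambda>u. Gamma ((of_nat n + u + 1) / 2) / Gamma (u + 1)) = ?E w"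
      by (intro tendsto_Lim) auto
    then show ?thesis using True w by (simp add: gamma_quot_def)
  qed
qed

lemma hyp2F1_reg_commute: "hyp2F1_reg a b c z = hyp2F1_reg b a c z"
  by (simp add: hyp2F1_reg_def mult_ac)

lemma hyp2F1_div_Gamma:
  assumes z: "norm z < 1" and c: "c \<notin> \<int>\<^sub>\<le>\<^sub>0"
  shows "hyp2F1 a b c z / Gamma c = hyp2F1_reg a b c z"
proof -
  have nz: "pochhammer c k \<noteq> 0" for k
    using c by (metis minus_of_nat_in_nonpos_Ints pochhammer_eq_0_iff)
  have "pochhammer a k * pochhammer b k * rGamma (c + of_nat k) / fact k * z ^ k =
      rGamma c * (pochhammer a k * pochhammer b k / (pochhammer c k * fact k) * z ^ k)" for k
    using nz[of k] by (subst pochhammer_rGamma[of c k]) simp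
  then have "hyp2F1_reg a b c z = rGamma c * hyp2F1_series a b c z"
    unfolding hyp2F1_reg_def hyp2F1_series_def
    using suminf_mult[OF summable_hyp2F1_series[OF z c, of a b], of "rGamma c"] by (simp only:)
  then show ?thesis
    using hyp2F1_eq_series[OF z c, of a b] by (simp add: rGamma_inverse_Gamma divide_inverse)
qed

lemma not_nonpos_Ints_if_not_Nats:
  fixes w :: complex
  assumes "w \<notin> \<nat>"
  shows "- w \<notin> \<int>\<^sub>\<le>\<^sub>0"
  using assms by (auto elim!: nonpos_Ints_cases')

lemma of_real_powr_eq_exp:
  assumes "p > 0"
  shows "complex_of_real p powr w = exp (w * of_real (ln p))"
  using assms by (simp add: powr_def Ln_of_real)

section \<open>Specialization of the general expansion to the Ferrers function\<close>

theorem theorem2: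
  fixes \<nu> \<mu> \<tau> :: complex and x :: real
  assumes "-1 < x" and "x < 1"
  shows
    "(Re (\<tau> + 2 * \<nu>) < 0 \<and> \<nu> - 1 / 2 \<notin> \<nat> \<longrightarrow>
        (let a = (\<lambda>n. (-1) ^ n * gamma_quot n (\<tau> + 2 * \<nu>) *
                        rGamma ((of_nat n + \<tau> - 2 * \<nu> + 1) / 2) * gegenbauer \<tau> x n)
         in summable a \<and>
            ferrersP \<nu> (- \<tau> - \<nu>) x / complex_of_real (1 - x\<^sup>2) powr ((\<tau> + \<nu>) / 2) =
              2 powr (\<tau> + \<nu>) * Gamma (1 / 2 - \<nu>) / complex_of_real (sqrt pi) * (\<Sum>n. a n)))
     \<and>
     (\<nu> - \<mu> - 1 / 2 \<notin> \<nat> \<and> Re (2 * \<mu> - \<nu>) > 0 \<longrightarrow>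
        (let c = (\<lambda>n. 2 powr (2 * \<mu> + 2 * \<nu> + 1) * pochhammer (\<nu> + 1) n /
                        Gamma (of_nat n + 2 * \<mu> - \<nu> + 1) *
                        hyp2F1 (2 * \<mu> + 2 * \<nu> + 1) (of_nat n + \<nu> + 1)
                          (of_nat n + 2 * \<mu> - \<nu> + 1) (-1))
         in (\<forall>n. c n = pochhammer (\<nu> + 1) n / Gamma (of_nat n + 2 * \<mu> - \<nu> + 1) *
                        hyp2F1 (2 * \<mu> + 2 * \<nu> + 1) (2 * \<mu> - 2 * \<nu>)
                          (2 * \<mu> + of_nat n - \<nu> + 1) (1 / 2)) \<and>
            summable (\<lambda>n. (-1) ^ n * c n * gegenbauer (- \<nu>) x n) \<and>
            ferrersP \<nu> (- \<mu>) x =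
              complex_of_real ((1 - x) / (1 + x)) powr (\<mu> / 2) *
              (Gamma (\<mu> - \<nu> + 1 / 2) / (4 powr \<nu> * complex_of_real (sqrt pi))) *
              (\<Sum>n. (-1) ^ n * c n * gegenbauer (- \<nu>) x n)))"
proof (intro conjI impI; elim conjE)
  assume neg: "Re (\<tau> + 2 * \<nu>) < 0" and \<nu>: "\<nu> - 1 / 2 \<notin> \<nat>"
  define a where "a n = (-1) ^ n * gamma_quot n (\<tau> + 2 * \<nu>) *
      rGamma ((of_nat n + \<tau> - 2 * \<nu> + 1) / 2) * gegenbauer \<tau> x n" for n
  define w where "w = \<tau> + 2 * \<nu>"
  define z where "z = (1 - x) / 2"
  have z: "norm (complex_of_real z) < 1" using assms unfolding norm_of_real by (simp add: z_def)
  have neg': "Re (\<tau> - 2 * (- \<nu>)) < 0" using neg by simp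
  have summand: "coupling (w + 1) (- \<nu>) \<tau> n * gcoef \<tau> x n = 2 powr (2 * \<nu>) * a n" for n
  proof -
    define q where "q = of_nat n + w + 1"
    \<comment> \<open>For this choice of \<alpha> and \<beta> the two numerator parameters of
      \<open>coupling\<close> add up to 1, which is the situation of Bailey's theorem with b =
      -2\<nu>.\<close>
    have "2 * (w + 1) + 2 * (- \<nu>) - 2 * \<tau> - 1 = 1 - 2 * (- \<nu>)" "of_nat n + (w + 1) + 2 * (- \<nu>) = 2 * (- \<nu>) + q"
      by (simp_all add: w_def q_def algebra_simps)
    then have "coupling (w + 1) (- \<nu>) \<tau> n = pochhammer (w + 1) n *
        hyp2F1_reg (1 - 2 * (- \<nu>)) (2 * (- \<nu>)) (2 * (- \<nu>) + q) (1 / 2)"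
      unfolding coupling_def by (simp only:)
    also have "\<dots> = pochhammer (w + 1) n * (2 powr (1 - 2 * (- \<nu>) - q) * of_real (sqrt pi) *
        rGamma (q / 2 + 2 * (- \<nu>)) * rGamma ((q + 1) / 2))"
      unfolding hyp2F1_reg_Bailey ..
    also have "1 - 2 * (- \<nu>) - q = 2 * \<nu> + (- of_nat n - w)" by (simp add: q_def)
    also have "q / 2 + 2 * (- \<nu>) = (of_nat n + \<tau> - 2 * \<nu> + 1) / 2"
      by (simp add: q_def w_def field_simps)
    also have "(q + 1) / 2 = (of_nat n + w + 2) / 2" by (simp add: q_def)
    finally have "coupling (w + 1) (- \<nu>) \<tau> n =
        2 powr (2 * \<nu>) * (gamma_quot n w * rGamma ((of_nat n + \<tau> - 2 * \<nu> + 1) / 2))"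
      unfolding gamma_quot_eq powr_add by (simp only: mult_ac)
    then show ?thesis by (simp add: a_def w_def gcoef_def mult_ac)
  qed
  have "summable (\<lambda>n. 2 powr (2 * \<nu>) * a n)"
    using summable_coupling_gcoef[OF assms neg', of "w + 1"] unfolding summand .
  then have sum: "summable a" by (simp add: summable_cmult_iff)
  define S where "S = suminf a"
  define H where "H = hyp2F1_reg \<tau> (w + 1) (w + 1 + - \<nu>) (of_real z)"
  have G: "H * rGamma (- \<nu> + 1 / 2) = 4 powr \<tau> / of_real (sqrt pi) * (2 powr (2 * \<nu>) * S)"
    using hyp2F1_reg_gegenbauer[OF assms neg', of "w + 1"]
    unfolding summand suminf_mult[OF sum] S_def H_def z_def .
  have "1 / 2 - \<nu> \<notin> \<int>\<^sub>\<le>\<^sub>0" using not_nonpos_Ints_if_not_Nats[OF \<nu>] by simp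
  then have "rGamma (- \<nu> + 1 / 2) * Gamma (1 / 2 - \<nu>) = 1"
    by (simp add: rGamma_inverse_Gamma Gamma_eq_zero_iff)
  then have H: "H = 4 powr \<tau> * 2 powr (2 * \<nu>) * Gamma (1 / 2 - \<nu>) / of_real (sqrt pi) * S"
    using arg_cong[OF G, of "\<lambda>t. t * Gamma (1 / 2 - \<nu>)"] by (simp add: mult_ac)
  have "ferrersP \<nu> (- \<tau> - \<nu>) x =
      complex_of_real ((1 - x) / (1 + x)) powr ((\<tau> + \<nu>) / 2) * hyp2F1_reg (- \<nu>) (\<nu> + 1) (1 + \<tau> + \<nu>) (of_real z)"
  proof -
    have "1 - (- \<tau> - \<nu>) = 1 + \<tau> + \<nu>" "- (- \<tau> - \<nu>) / 2 = (\<tau> + \<nu>) / 2" by simp_all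
    then show ?thesis unfolding ferrersP_def z_def by (simp only:)
  qed
  \<comment> \<open>Here c - a - b = \<tau> + \<nu>, c - a = \<tau> + 2\<nu> + 1 = \<alpha> and c -
    b = \<tau>, which are the parameters of the general expansion up to order.\<close>
  also have "hyp2F1_reg (- \<nu>) (\<nu> + 1) (1 + \<tau> + \<nu>) (of_real z) =
      (1 - of_real z) powr (\<tau> + \<nu>) * hyp2F1_reg (1 + \<tau> + \<nu> - (- \<nu>)) (1 + \<tau> + \<nu> - (\<nu> + 1)) (1 + \<tau> + \<nu>) (of_real z)"
  proof -
    have "1 + \<tau> + \<nu> - (- \<nu>) - (\<nu> + 1) = \<tau> + \<nu>" by simp
    then show ?thesis by (subst hyp2F1_reg_Euler[OF z]) (simp only:)
  qed
  also have "hyp2F1_reg (1 + \<tau> + \<nu> - (- \<nu>)) (1 + \<tau> + \<nu> - (\<nu> + 1)) (1 + \<tau> + \<nu>) (of_real z) = H"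
    unfolding H_def w_def by (subst hyp2F1_reg_commute) (simp add: add_ac)
  finally have P: "ferrersP \<nu> (- \<tau> - \<nu>) x = complex_of_real ((1 - x) / (1 + x)) powr ((\<tau> + \<nu>) / 2) *
      ((1 - of_real z) powr (\<tau> + \<nu>) * H)" .
  define A where "A = complex_of_real (ln (1 - x))"
  define B where "B = complex_of_real (ln (1 + x))"
  define L where "L = complex_of_real (ln 2)"
  have p1: "complex_of_real ((1 - x) / (1 + x)) powr ((\<tau> + \<nu>) / 2) = exp ((\<tau> + \<nu>) / 2 * (A - B))"
    by (subst of_real_powr_eq_exp) (use assms in \<open>auto simp: A_def B_def ln_div\<close>)
  have "1 - x\<^sup>2 = (1 - x) * (1 + x)" by (simp add: power2_eq_square algebra_simps)
  then have p2: "complex_of_real (1 - x\<^sup>2) powr ((\<tau> + \<nu>) / 2) = exp ((\<tau> + \<nu>) / 2 * (A + B))"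
    by (simp only:, subst of_real_powr_eq_exp) (use assms in \<open>auto simp: A_def B_def ln_mult\<close>)
  have "1 - complex_of_real z = of_real ((1 + x) / 2)" by (simp add: z_def field_simps)
  then have p3: "(1 - complex_of_real z) powr (\<tau> + \<nu>) = exp ((\<tau> + \<nu>) * (B - L))"
    by (simp only:, subst of_real_powr_eq_exp) (use assms in \<open>auto simp: B_def L_def ln_div\<close>)
  have two: "2 powr t = exp (t * L)" for t :: complex
    using of_real_powr_eq_exp[of 2 t] by (simp add: L_def)
  have four: "4 powr t = exp (t * (2 * L))" for t :: complex
  proof -
    have "ln (4 :: real) = 2 * ln 2" using ln_realpow[of 2 2] by simp
    then show ?thesis using of_real_powr_eq_exp[of 4 t] by (simp add: L_def)
  qed
  \<comment> \<open>With e = \<tau> + \<nu>, the powers of 1 - x and 1 + x cancel, 2^(-e) remains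
    from 1 - z = (1 + x)/2, and 4^\<tau> 2^(2\<nu>) = 4^e turns it into 2^e.\<close>
  have E: "exp ((\<tau> + \<nu>) / 2 * (A - B)) * exp ((\<tau> + \<nu>) * (B - L)) * (4 powr \<tau> * 2 powr (2 * \<nu>)) / exp ((\<tau> + \<nu>) / 2 * (A + B))
      = 2 powr (\<tau> + \<nu>)"
    unfolding two four exp_add[symmetric] exp_diff[symmetric]
    by (rule arg_cong[where f = exp]) (simp add: field_simps)
  have "ferrersP \<nu> (- \<tau> - \<nu>) x / complex_of_real (1 - x\<^sup>2) powr ((\<tau> + \<nu>) / 2) =
      2 powr (\<tau> + \<nu>) * Gamma (1 / 2 - \<nu>) / complex_of_real (sqrt pi) * S"
  proof -
    have "p * (q * (k * G / s * t)) / d = p * q * k / d * G / s * t" for p q k G s t d :: complex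
      by (simp add: mult_ac)
    then show ?thesis unfolding P p1 p2 p3 H by (simp only: E)
  qed
  then show "let a = (\<lambda>n. (-1) ^ n * gamma_quot n (\<tau> + 2 * \<nu>) *
                        rGamma ((of_nat n + \<tau> - 2 * \<nu> + 1) / 2) * gegenbauer \<tau> x n)
         in summable a \<and>
            ferrersP \<nu> (- \<tau> - \<nu>) x / complex_of_real (1 - x\<^sup>2) powr ((\<tau> + \<nu>) / 2) =
              2 powr (\<tau> + \<nu>) * Gamma (1 / 2 - \<nu>) / complex_of_real (sqrt pi) * (\<Sum>n. a n)"
    using sum unfolding Let_def S_def a_def[abs_def] by simp
next
  assume \<mu>: "\<nu> - \<mu> - 1 / 2 \<notin> \<nat>" and pos: "Re (2 * \<mu> - \<nu>) > 0"
  define c where "c n = 2 powr (2 * \<mu> + 2 * \<nu> + 1) * pochhammer (\<nu> + 1) n /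
      Gamma (of_nat n + 2 * \<mu> - \<nu> + 1) *
      hyp2F1 (2 * \<mu> + 2 * \<nu> + 1) (of_nat n + \<nu> + 1) (of_nat n + 2 * \<mu> - \<nu> + 1) (-1)" for n
  \<comment> \<open>The real part exceeds 1, so neither \<Gamma> nor the hypergeometric series in
    c_n meets a pole.\<close>
  have np: "of_nat n + 2 * \<mu> - \<nu> + 1 \<notin> \<int>\<^sub>\<le>\<^sub>0" for n
  proof
    assume "of_nat n + 2 * \<mu> - \<nu> + 1 \<in> \<int>\<^sub>\<le>\<^sub>0"
    then obtain m where m: "of_nat n + 2 * \<mu> - \<nu> + 1 = of_int m" "m \<le> 0" by (rule nonpos_Ints_cases)
    from arg_cong[OF m(1), of Re] m(2) show False using pos by simp
  qed
  have c: "c n = pochhammer (\<nu> + 1) n / Gamma (of_nat n + 2 * \<mu> - \<nu> + 1) *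
      hyp2F1 (2 * \<mu> + 2 * \<nu> + 1) (2 * \<mu> - 2 * \<nu>) (of_nat n + 2 * \<mu> - \<nu> + 1) (1 / 2)" for n
  proof -
    have "of_nat n + 2 * \<mu> - \<nu> + 1 - (of_nat n + \<nu> + 1) = 2 * \<mu> - 2 * \<nu>" by simp
    moreover have "2 powr (2 * \<mu> + 2 * \<nu> + 1) * 2 powr (- (2 * \<mu> + 2 * \<nu> + 1)) = (1 :: complex)"
      unfolding powr_add[symmetric] by simp
    ultimately show ?thesis
      unfolding c_def hyp2F1_Pfaff[OF np] by (simp add: mult_ac)
  qed
  have cc: "c n = coupling (\<nu> + 1) (\<mu> - \<nu>) (- \<nu>) n" for n
  proof -
    have "2 * (\<nu> + 1) + 2 * (\<mu> - \<nu>) - 2 * (- \<nu>) - 1 = 2 * \<mu> + 2 * \<nu> + 1"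
      "2 * (\<mu> - \<nu>) = 2 * \<mu> - 2 * \<nu>" "of_nat n + (\<nu> + 1) + 2 * (\<mu> - \<nu>) = of_nat n + 2 * \<mu> - \<nu> + 1"
      by (simp_all add: algebra_simps)
    then have "coupling (\<nu> + 1) (\<mu> - \<nu>) (- \<nu>) n = pochhammer (\<nu> + 1) n *
        hyp2F1_reg (2 * \<mu> + 2 * \<nu> + 1) (2 * \<mu> - 2 * \<nu>) (of_nat n + 2 * \<mu> - \<nu> + 1) (1 / 2)"
      unfolding coupling_def by (simp only:)
    moreover have "c n = pochhammer (\<nu> + 1) n *
        (hyp2F1 (2 * \<mu> + 2 * \<nu> + 1) (2 * \<mu> - 2 * \<nu>) (of_nat n + 2 * \<mu> - \<nu> + 1) (1 / 2) /
         Gamma (of_nat n + 2 * \<mu> - \<nu> + 1))"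
      unfolding c by simp
    moreover have "norm (1 / 2 :: complex) < 1" by simp
    ultimately show ?thesis by (simp only: hyp2F1_div_Gamma[OF _ np])
  qed
  have neg: "Re (- \<nu> - 2 * (\<mu> - \<nu>)) < 0" using pos by simp
  have summand: "coupling (\<nu> + 1) (\<mu> - \<nu>) (- \<nu>) n * gcoef (- \<nu>) x n = (- 1) ^ n * c n * gegenbauer (- \<nu>) x n" for n
    by (simp add: cc gcoef_def)
  have sum: "summable (\<lambda>n. (- 1) ^ n * c n * gegenbauer (- \<nu>) x n)"
    using summable_coupling_gcoef[OF assms neg, of "\<nu> + 1"] unfolding summand .
  define S where "S = (\<Sum>n. (- 1) ^ n * c n * gegenbauer (- \<nu>) x n)"
  define H where "H = hyp2F1_reg (- \<nu>) (\<nu> + 1) (1 + \<mu>) (complex_of_real ((1 - x) / 2))"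
  \<comment> \<open>As \<alpha> + \<beta> = 1 + \<mu>, the left side of the general expansion is
    already the series in the definition of the Ferrers function, and Euler's transformation is not
    involved.\<close>
  have "\<nu> + 1 + (\<mu> - \<nu>) = 1 + \<mu>" by simp
  then have G: "H * rGamma (\<mu> - \<nu> + 1 / 2) = 4 powr (- \<nu>) / of_real (sqrt pi) * S"
    using hyp2F1_reg_gegenbauer[OF assms neg, of "\<nu> + 1"] unfolding summand S_def H_def by (simp only:)
  have e: "- (\<nu> - \<mu> - 1 / 2) = \<mu> - \<nu> + 1 / 2" by simp
  have "\<mu> - \<nu> + 1 / 2 \<notin> \<int>\<^sub>\<le>\<^sub>0" using not_nonpos_Ints_if_not_Nats[OF \<mu>] unfolding e .
  then have "rGamma (\<mu> - \<nu> + 1 / 2) * Gamma (\<mu> - \<nu> + 1 / 2) = 1"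
    by (simp add: rGamma_inverse_Gamma Gamma_eq_zero_iff)
  then have "H = H * rGamma (\<mu> - \<nu> + 1 / 2) * Gamma (\<mu> - \<nu> + 1 / 2)"
    by (simp only: mult.assoc mult_1_right)
  also have "\<dots> = 4 powr (- \<nu>) / of_real (sqrt pi) * S * Gamma (\<mu> - \<nu> + 1 / 2)"
    by (simp only: G)
  also have "\<dots> = Gamma (\<mu> - \<nu> + 1 / 2) / (4 powr \<nu> * complex_of_real (sqrt pi)) * S"
    unfolding powr_minus divide_inverse inverse_mult_distrib by (simp only: mult_ac)
  finally have H: "H = Gamma (\<mu> - \<nu> + 1 / 2) / (4 powr \<nu> * complex_of_real (sqrt pi)) * S" .
  have P: "ferrersP \<nu> (- \<mu>) x = complex_of_real ((1 - x) / (1 + x)) powr (\<mu> / 2) * H"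
    by (simp add: ferrersP_def H_def)
  have e': "2 * \<mu> + of_nat n - \<nu> + 1 = of_nat n + 2 * \<mu> - \<nu> + 1" for n by simp
  have c': "\<forall>n. c n = pochhammer (\<nu> + 1) n / Gamma (of_nat n + 2 * \<mu> - \<nu> + 1) *
      hyp2F1 (2 * \<mu> + 2 * \<nu> + 1) (2 * \<mu> - 2 * \<nu>) (2 * \<mu> + of_nat n - \<nu> + 1) (1 / 2)"
    unfolding e' by (intro allI c)
  have F: "ferrersP \<nu> (- \<mu>) x = complex_of_real ((1 - x) / (1 + x)) powr (\<mu> / 2) *
      (Gamma (\<mu> - \<nu> + 1 / 2) / (4 powr \<nu> * complex_of_real (sqrt pi))) * S"
    unfolding P H by (simp only: mult.assoc)
  show "let c = (\<lambda>n. 2 powr (2 * \<mu> + 2 * \<nu> + 1) * pochhammer (\<nu> + 1) n /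
                        Gamma (of_nat n + 2 * \<mu> - \<nu> + 1) *
                        hyp2F1 (2 * \<mu> + 2 * \<nu> + 1) (of_nat n + \<nu> + 1)
                          (of_nat n + 2 * \<mu> - \<nu> + 1) (-1))
         in (\<forall>n. c n = pochhammer (\<nu> + 1) n / Gamma (of_nat n + 2 * \<mu> - \<nu> + 1) *
                        hyp2F1 (2 * \<mu> + 2 * \<nu> + 1) (2 * \<mu> - 2 * \<nu>)
                          (2 * \<mu> + of_nat n - \<nu> + 1) (1 / 2)) \<and>
            summable (\<lambda>n. (-1) ^ n * c n * gegenbauer (- \<nu>) x n) \<and>
            ferrersP \<nu> (- \<mu>) x =
              complex_of_real ((1 - x) / (1 + x)) powr (\<mu> / 2) *
              (Gamma (\<mu> - \<nu> + 1 / 2) / (4 powr \<nu> * complex_of_real (sqrt pi))) *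
              (\<Sum>n. (-1) ^ n * c n * gegenbauer (- \<nu>) x n)"
    unfolding Let_def c_def[symmetric] S_def[symmetric] by (intro conjI c' sum F)
qed

end
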